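(* There are exactly $101$ equivalence classes of complete conditional independence relations on the set $[4]=\{1,2,3,4\}$.
   Context: Let $[m]=\{1,\dots,m\}$ (here $m=4$) and let $PD_m$ be the set of real symmetric positive definite $m\times m$ matrices. A conditional independence (CI) couple over $[m]$, written $ij|C$ (or $ij$ if $C=\emptyset$), consists of a two-element set $ij=\{i,j\}\subseteq[m]$ and a set $C\subseteq[m]\setminus ij$; thus $ij|C=ji|C$. $\mathcal{R}(m)$ is the set of all CI couples over $[m]$, and a CI relation on $[m]$ is any subset $\mathcal{L}\subseteq\mathcal{R}(m)$. Concatenation of symbols denotes union of index sets (indices are identified with singletons), e.g. $iC=\{i\}\cup C$; $\Sigma_{A,B}$ is the submatrix of $\Sigma$ with rows $A$ and columns $B$ (for $\Sigma_{iC,jC}$ list $i$, resp. $j$, first and then $C$ in a fixed order). Define $$V_{\mathrm{pd}}(\mathcal{L})=\{\Sigma\in PD_m:\det(\Sigma_{iC,jC})=0\text{ for all }ij|C\in\mathcal{L}\}.$$ A relation $\mathcal{L}$ is complete if for every couple $ij|C\in\mathcal{R}(m)\setminus\mathcal{L}$ there exists $\Sigma\in V_{\mathrm{pd}}(\mathcal{L})$ with $\det(\Sigma_{iC,jC})\neq 0$. Two relations on $[m]$ are equivalent if some permutation of the ground set $[m]$, applied to all indices, turns one into the other. *)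

theory Defs
  imports Complex_Main "HOL-Combinatorics.Permutations" "Jordan_Normal_Form.Determinant"
begin

(* The ground set is [m] = {1..m}. Matrices of type "real mat" are indexed from 0, so the
   entry (i, j) of S is S $$ (i - 1, j - 1); the shift occurs only in submat below. *)

definition PD :: "nat \<Rightarrow> real mat set" where
  "PD m = {S \<in> carrier_mat m m. transpose_mat S = S \<and>
             (\<forall>v \<in> carrier_vec m. v \<noteq> 0\<^sub>v m \<longrightarrow> v \<bullet> (S *\<^sub>v v) > 0)}"

(* A couple ij|C is encoded as the pair ({i, j}, C), so that ij|C = ji|C. *)
type_synonym ci_couple = "nat set \<times> nat set"

definition couples :: "nat \<Rightarrow> ci_couple set" where
  "couples m = {(K, C). K \<subseteq> {1..m} \<and> card K = 2 \<and> C \<subseteq> {1..m} - K}"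

definition submat :: "real mat \<Rightarrow> nat list \<Rightarrow> nat list \<Rightarrow> real mat" where
  "submat S rs cs =
     mat (length rs) (length cs) (\<lambda>(a, b). S $$ (rs ! a - 1, cs ! b - 1))"

(* det of S_{iC,jC}: rows i, C and columns j, C, with C in increasing order. *)
definition ci_minor :: "real mat \<Rightarrow> nat \<Rightarrow> nat \<Rightarrow> nat set \<Rightarrow> real" where
  "ci_minor S i j C =
     det (submat S (i # sorted_list_of_set C) (j # sorted_list_of_set C))"

definition V_pd :: "nat \<Rightarrow> ci_couple set \<Rightarrow> real mat set" where
  "V_pd m L = {S \<in> PD m. \<forall>i j C. ({i, j}, C) \<in> L \<longrightarrow> ci_minor S i j C = 0}"

definition complete_relation :: "nat \<Rightarrow> ci_couple set \<Rightarrow> bool" where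
  "complete_relation m L \<longleftrightarrow> L \<subseteq> couples m \<and>
     (\<forall>i j C. ({i, j}, C) \<in> couples m - L \<longrightarrow> (\<exists>S \<in> V_pd m L. ci_minor S i j C \<noteq> 0))"

definition permute_relation :: "(nat \<Rightarrow> nat) \<Rightarrow> ci_couple set \<Rightarrow> ci_couple set" where
  "permute_relation p L = (\<lambda>(K, C). (p ` K, p ` C)) ` L"

definition ci_equiv :: "nat \<Rightarrow> (ci_couple set \<times> ci_couple set) set" where
  "ci_equiv m = {(L, L'). L \<subseteq> couples m \<and> L' \<subseteq> couples m \<and>
                          (\<exists>p. p permutes {1..m} \<and> permute_relation p L = L')}"

lemma permute_relation_comp:
  "permute_relation p (permute_relation q L) = permute_relation (p \<circ> q) L"
  by (simp add: permute_relation_def image_image case_prod_beta image_comp)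

lemma permute_relation_id: "permute_relation id L = L"
  by (simp add: permute_relation_def)

lemma equiv_ci_equiv: "equiv (Pow (couples m)) (ci_equiv m)"
proof (rule equivI)
  show "refl_on (Pow (couples m)) (ci_equiv m)"
    by (auto simp: refl_on_def ci_equiv_def intro!: exI[of _ id] permutes_id permute_relation_id)
  show "sym (ci_equiv m)"
  proof (rule symI)
    fix L L' assume "(L, L') \<in> ci_equiv m"
    then obtain p where p: "p permutes {1..m}" "permute_relation p L = L'"
      and sub: "L \<subseteq> couples m" "L' \<subseteq> couples m"
      by (auto simp: ci_equiv_def)
    have "permute_relation (Hilbert_Choice.inv p) L' = L"
      using p by (metis permute_relation_comp permute_relation_id permutes_inv_o(2))
    then show "(L', L) \<in> ci_equiv m"
      using sub permutes_inv[OF p(1)] by (auto simp: ci_equiv_def)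
  qed
  show "trans (ci_equiv m)"
    by (rule transI) (auto simp: ci_equiv_def permute_relation_comp intro: permutes_compose)
  show "ci_equiv m \<subseteq> Pow (couples m) \<times> Pow (couples m)"
    by (auto simp: ci_equiv_def)
qed

end

theory Submission
  imports Defs
begin

text \<open>
A matrix \<open>S\<close> in \<open>PD 4\<close> determines the set of all couples \<open>ij|C\<close> whose minor vanishes at \<open>S\<close>;
call such a set Gaussian. A relation is complete iff every couple outside it is missing from some
Gaussian relation above it, that is, iff it is an intersection of Gaussian relations (the full
relation being the relation of the identity matrix). There are only 24 couples on four points, so
relations are handled as lists of 24 truth values, and \<open>S\<^sub>4\<close> acts by permuting the entries. The
classification consists of a list of 101 relations (\<open>representatives\<close>) and three facts about it.

\<^item> Every listed relation is complete. There are 24 integer matrices (\<open>witness_matrices\<close>) such that every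
  listed relation is an intersection of relabelled copies of their Gaussian relations
  (\<open>meet_representations_checked\<close>).

\<^item> No two listed relations are equivalent, because each of them is the lexicographically least
  member of its orbit (\<open>rep_lex_least\<close>).

\<^item> Every complete relation is equivalent to a listed one. Gaussian relations satisfy the gaussoid
  axioms: if they contain one of \<open>ij|C, ij|kC\<close> and one of \<open>ik|C, ik|jC\<close>, then they contain all four
  (\<open>square\<close>); and weak transitivity holds (\<open>weak_transitivity\<close>). They also satisfy five further
  implications, which use that the principal minors of order up to three are positive
  (\<open>cyclic_rule3\<close>, \<open>cyclic_rule4\<close>, \<open>chain_rule\<close>, \<open>crossed_pairs_rule\<close>, \<open>four_cycle_rule\<close>). Now let \<open>L\<close>
  be complete and let \<open>R\<close> be the last listed relation that some relabelling of \<open>L\<close> contains. If the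
  containment were proper, there would be a further couple \<open>c\<close> in the relabelled \<open>L\<close>. For every listed
  \<open>R\<close> and every couple \<open>c\<close> outside it, a derivation from the implications above shows
  that all Gaussian relations containing \<open>R\<close> and \<open>c\<close> contain one and the same copy of a later listed
  relation. Since \<open>L\<close> is an intersection of Gaussian relations it contains that copy as well, against
  the choice of \<open>R\<close> (\<open>climb\<close>, \<open>complete_bits_rep\<close>).

The representatives, the witness matrices and the 1895 derivations come from a computer search;
here they are data that rewriting checks.
\<close>

section \<open>Complete relations as intersections of Gaussian relations\<close>

text \<open>The almost-principal minor with rows \<open>i, C\<close> and columns \<open>j, C\<close>, expanded for \<open>length C \<le> 2\<close>, which is
all that four indices leave room for. As a polynomial it makes sense for an arbitrary order of \<open>C\<close>, so
that relabelling the indices needs no sorting.\<close>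

fun apm :: "(nat \<Rightarrow> nat \<Rightarrow> real) \<Rightarrow> nat \<Rightarrow> nat \<Rightarrow> nat list \<Rightarrow> real" where
  "apm s i j [] = s i j"
| "apm s i j [k] = s i j * s k k - s i k * s k j"
| "apm s i j (k # l # _) =
     s i j * (s k k * s l l - s k l * s l k) - s i k * (s k j * s l l - s k l * s l j)
     + s i l * (s k j * s l k - s k k * s l j)"

text \<open>Positive definite matrices as functions on \<open>{1..4} \<times> {1..4}\<close>: relabelling the rows and columns is then
composition with a permutation.\<close>

definition posdef :: "(nat \<Rightarrow> nat \<Rightarrow> real) \<Rightarrow> bool" where
  "posdef s \<longleftrightarrow> (\<forall>i\<in>{1..4}. \<forall>j\<in>{1..4}. s i j = s j i) \<and>
     (\<forall>v. (\<exists>i\<in>{1..4}. v i \<noteq> 0) \<longrightarrow> 0 < (\<Sum>i\<in>{1..4}. \<Sum>j\<in>{1..4}. v i * s i j * v j))"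

lemma posdef_sym: "posdef s \<Longrightarrow> i \<in> {1..4} \<Longrightarrow> j \<in> {1..4} \<Longrightarrow> s i j = s j i"
  by (auto simp: posdef_def)

lemma ground_set: "{1..4::nat} = {1, 2, 3, 4}"
  by auto

lemma list_upto2:
  assumes "length C \<le> 2"
  shows "C = [] \<or> (\<exists>k. C = [k]) \<or> (\<exists>k l. C = [k, l])"
proof (cases C)
  case (Cons k D)
  then show ?thesis using assms by (cases D) auto
qed simp

lemma posdef_cong:
  assumes "\<And>i j. i \<in> {1..4} \<Longrightarrow> j \<in> {1..4} \<Longrightarrow> s i j = t i j"
  shows "posdef s \<longleftrightarrow> posdef t"
proof -
  have "(\<Sum>i\<in>{1..4}. \<Sum>j\<in>{1..4}. v i * s i j * v j) = (\<Sum>i\<in>{1..4}. \<Sum>j\<in>{1..4}. v i * t i j * v j)" for v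
    by (intro sum.cong refl) (simp only: assms)
  moreover have "(\<forall>i\<in>{1..4}. \<forall>j\<in>{1..4}. s i j = s j i) \<longleftrightarrow> (\<forall>i\<in>{1..4}. \<forall>j\<in>{1..4}. t i j = t j i)"
    using assms by metis
  ultimately show ?thesis unfolding posdef_def by presburger
qed

lemma det_2:
  fixes A :: "real mat"
  assumes A: "A \<in> carrier_mat 2 2"
  shows "det A = A $$ (0,0) * A $$ (1,1) - A $$ (0,1) * A $$ (1,0)"
  using A laplace_expansion_row[OF A, of 0]
    by (simp add: cofactor_def numeral_2_eq_2 mat_delete_def det_single)

lemma det_3:
  fixes A :: "real mat"
  assumes A: "A \<in> carrier_mat 3 3"
  shows "det A = A $$ (0,0) * (A $$ (1,1) * A $$ (2,2) - A $$ (1,2) * A $$ (2,1))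
     - A $$ (0,1) * (A $$ (1,0) * A $$ (2,2) - A $$ (1,2) * A $$ (2,0))
     + A $$ (0,2) * (A $$ (1,0) * A $$ (2,1) - A $$ (1,1) * A $$ (2,0))"
proof -
  have "mat_delete A 0 j \<in> carrier_mat 2 2" for j
    using mat_delete_carrier[OF A, of 0 j] by simp
  then show ?thesis
    using A laplace_expansion_row[OF A, of 0]
    by (simp add: cofactor_def det_2 numeral_3_eq_3 numeral_2_eq_2 mat_delete_def algebra_simps)
qed

definition entries :: "real mat \<Rightarrow> nat \<Rightarrow> nat \<Rightarrow> real" where
  "entries S i j = S $$ (i - 1, j - 1)"

lemma ci_minor_apm:
  assumes "distinct C" "length C \<le> 2"
  shows "ci_minor S i j (set C) = apm (entries S) i j C"
proof -
  consider "C = []" | k where "C = [k]" | k l where "C = [k, l]" "k \<noteq> l"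
    using assms list_upto2[of C] by auto
  then show ?thesis
  proof cases
    case 1
    then show ?thesis
      by (simp add: ci_minor_def submat_def entries_def det_single)
  next
    case 2
    have "det (submat S [i, k] [j, k]) = apm (entries S) i j [k]"
      by (subst det_2) (simp_all add: submat_def entries_def numeral_2_eq_2)
    with 2 show ?thesis by (simp add: ci_minor_def)
  next
    case 3
    have d: "det (submat S [i, k, l] [j, k, l]) = apm (entries S) i j [k, l]" for k l
      by (subst det_3) (simp_all add: submat_def entries_def numeral_2_eq_2 numeral_3_eq_3)
    have "sorted_list_of_set {k, l} = (if k < l then [k, l] else [l, k])"
      using 3 by (auto simp: sorted_list_of_set.sorted_key_list_of_set_insert)
    then show ?thesis
      using 3 d[of k l] d[of l k] by (auto simp: ci_minor_def algebra_simps)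
  qed
qed

definition ci_relation :: "(nat \<Rightarrow> nat \<Rightarrow> real) \<Rightarrow> ci_couple set" where
  "ci_relation s = {({i, j}, set C) | i j C.
     distinct (i # j # C) \<and> set (i # j # C) \<subseteq> {1..4} \<and> apm s i j C = 0}"

lemma ci_relationI:
  assumes "distinct (i # j # C)" "set (i # j # C) \<subseteq> {1..4}" "apm s i j C = 0"
  shows "({i, j}, set C) \<in> ci_relation s"
  unfolding ci_relation_def using assms by blast

lemma distinct_length:
  assumes "distinct (i # j # C)" "set (i # j # C) \<subseteq> {1..(4::nat)}"
  shows "length C \<le> 2"
proof -
  have "card (set (i # j # C)) \<le> card {1..(4::nat)}"
    using assms(2) by (intro card_mono) auto
  then show ?thesis using distinct_card[OF assms(1)] by simp
qed

lemma couplesE: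
  assumes "(K, D) \<in> couples 4"
  obtains i j C where "K = {i, j}" "D = set C" "distinct (i # j # C)" "set (i # j # C) \<subseteq> {1..4}"
proof -
  from assms obtain i j where "K = {i, j}" "i \<noteq> j" "K \<subseteq> {1..4}" "D \<subseteq> {1..4} - K"
    by (auto simp: couples_def card_2_iff)
  moreover from this obtain C where "set C = D" "distinct C"
    by (metis finite_distinct_list finite_Diff finite_atLeastAtMost finite_subset)
  ultimately show ?thesis by (intro that[of i j C]) auto
qed

text \<open>Symmetry of \<open>s\<close> makes the minor depend only on the couple, not on the names chosen for its two
indices nor on the order of the conditioning set.\<close>

lemma apm_cong:
  assumes s: "posdef s"
    and d: "distinct (i # j # C)" "set (i # j # C) \<subseteq> {1..4}" "distinct (i' # j' # C')"
    and e: "{i, j} = {i', j'}" "set C = set C'"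
  shows "apm s i j C = apm s i' j' C'"
proof -
  have sy: "s a b = s b a" if "a \<in> set (i # j # C)" "b \<in> set (i # j # C)" for a b
    using posdef_sym[OF s, of a b] that d(2) by (metis subsetD)
  have l: "length C' = length C"
    using d e(2) by (metis distinct.simps(2) distinct_card)
  have swap: "apm s i j C = apm s j i C"
  proof -
    consider "C = []" | k where "C = [k]" | k l where "C = [k, l]"
      using list_upto2[OF distinct_length[OF d(1,2)]] by blast
    then show ?thesis
    proof cases
      case 1
      then show ?thesis using sy[of i j] by simp
    next
      case 2
      have "s i j = s j i" "s i k = s k i" "s k j = s j k" using 2 by (intro sy; simp)+
      then show ?thesis using 2 by simp
    next
      case (3 k l)
      have "s i j = s j i" "s i k = s k i" "s k j = s j k" "s i l = s l i" "s l j = s j l" "s l k = s k l"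
        using 3 by (intro sy; simp)+
      then show ?thesis using 3 by (simp add: algebra_simps)
    qed
  qed
  have "apm s a b C = apm s a b C'" for a b
  proof -
    consider "C = C'" | k l where "C = [k, l]" "C' = [l, k]"
    proof -
      consider "C = []" | k where "C = [k]" | k l where "C = [k, l]" "k \<noteq> l"
        using list_upto2[OF distinct_length[OF d(1,2)]] d(1) by auto
      then show ?thesis
      proof cases
        case 1
        then show ?thesis using l by (intro that(1)) simp
      next
        case (2 k)
        then have "length C' = 1" using l by simp
        then obtain x where x: "C' = [x]" by (metis One_nat_def length_0_conv length_Suc_conv)
        with e(2) 2 have "x = k" by simp
        with x 2 show ?thesis by (intro that(1)) simp
      next
        case (3 k m)
        then have "length C' = 2" using l by simp
        then obtain x y where xy: "C' = [x, y]"
          using list_upto2[of C'] by (metis One_nat_def length_0_conv length_Cons numeral_eq_one_iff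
              numeral_2_eq_2 le_refl list.size(3) nat.distinct(1) nat.inject)
        then have "{k, m} = {x, y}" using 3 e(2) by simp
        then have "C' = [k, m] \<or> C' = [m, k]" unfolding xy by (auto simp: doubleton_eq_iff)
        then show ?thesis using 3 that by metis
      qed
    qed
    then show ?thesis by cases (simp_all add: algebra_simps)
  qed
  moreover have "i' = i \<and> j' = j \<or> i' = j \<and> j' = i" using e(1) by (auto simp: doubleton_eq_iff)
  ultimately show ?thesis using swap by metis
qed

lemma ci_relation_iff:
  assumes "posdef s" "distinct (i # j # C)" "set (i # j # C) \<subseteq> {1..4}"
  shows "({i, j}, set C) \<in> ci_relation s \<longleftrightarrow> apm s i j C = 0"
proof
  assume "({i, j}, set C) \<in> ci_relation s"
  then obtain i' j' C' where "{i, j} = {i', j'}" "set C = set C'" "distinct (i' # j' # C')"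
    "apm s i' j' C' = 0" by (auto simp: ci_relation_def)
  then show "apm s i j C = 0" using apm_cong[OF assms] by simp
next
  assume "apm s i j C = 0"
  then show "({i, j}, set C) \<in> ci_relation s" using assms by (auto simp: ci_relation_def)
qed

lemma ci_relation_cong:
  assumes "\<And>i j. i \<in> {1..4} \<Longrightarrow> j \<in> {1..4} \<Longrightarrow> s i j = t i j"
  shows "ci_relation s = ci_relation t"
proof -
  have "apm s i j C = apm t i j C" if "set (i # j # C) \<subseteq> {1..4}" for i j C
  proof (cases C)
    case Nil
    then show ?thesis using that by (simp only: apm.simps list.set insert_subset assms)
  next
    case (Cons k D)
    then show ?thesis
      using that by (cases D) (simp_all only: apm.simps list.set insert_subset assms)
  qed
  then show ?thesis
    unfolding ci_relation_def by (intro Collect_cong ex_cong1 conj_cong refl) simp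
qed

lemma sum_shift: "sum f {1..4::nat} = (\<Sum>a\<in>{0..<4}. f (Suc a))" for f :: "nat \<Rightarrow> real"
proof -
  have "{1..4::nat} = {Suc 0..<Suc 4}" by auto
  then show ?thesis by (simp only: sum.atLeast_Suc_lessThan_Suc_shift o_def)
qed

lemma PD_posdef:
  assumes "S \<in> carrier_mat 4 4"
  shows "S \<in> PD 4 \<longleftrightarrow> posdef (entries S)"
proof -
  have sym: "transpose_mat S = S \<longleftrightarrow> (\<forall>i\<in>{1..4}. \<forall>j\<in>{1..4}. entries S i j = entries S j i)"
  proof
    assume "transpose_mat S = S"
    then have "S $$ (a, b) = S $$ (b, a)" if "a < 4" "b < 4" for a b
      using assms that by (metis carrier_matD index_transpose_mat(1))
    then show "\<forall>i\<in>{1..4}. \<forall>j\<in>{1..4}. entries S i j = entries S j i"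
      by (auto simp: entries_def)
  next
    assume *: "\<forall>i\<in>{1..4}. \<forall>j\<in>{1..4}. entries S i j = entries S j i"
    have "S $$ (a, b) = S $$ (b, a)" if "a < 4" "b < 4" for a b
      using *[rule_format, of "Suc a" "Suc b"] that by (simp add: entries_def)
    then show "transpose_mat S = S" using assms by (intro eq_matI) auto
  qed
  have form: "vec 4 (\<lambda>a. v (Suc a)) \<bullet> (S *\<^sub>v vec 4 (\<lambda>a. v (Suc a))) =
      (\<Sum>i\<in>{1..4}. \<Sum>j\<in>{1..4}. v i * entries S i j * v j)" for v
  proof -
    have "vec 4 (\<lambda>a. v (Suc a)) \<bullet> (S *\<^sub>v vec 4 (\<lambda>a. v (Suc a))) =
       (\<Sum>a\<in>{0..<4}. \<Sum>b\<in>{0..<4}. v (Suc a) * entries S (Suc a) (Suc b) * v (Suc b))"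
      using assms by (simp add: scalar_prod_def sum_distrib_left entries_def mult.assoc)
    also have "\<dots> = (\<Sum>i\<in>{1..4}. \<Sum>j\<in>{1..4}. v i * entries S i j * v j)"
      by (simp only: sum_shift)
    finally show ?thesis .
  qed
  have vecs: "(\<forall>v\<in>carrier_vec 4. v \<noteq> 0\<^sub>v 4 \<longrightarrow> v \<bullet> (S *\<^sub>v v) > 0) \<longleftrightarrow>
    (\<forall>v. (\<exists>i\<in>{1..4}. v i \<noteq> 0) \<longrightarrow> 0 < (\<Sum>i\<in>{1..4}. \<Sum>j\<in>{1..4}. v i * entries S i j * v j))"
  proof (intro iffI allI impI ballI)
    fix v :: "nat \<Rightarrow> real"
    assume *: "\<forall>v\<in>carrier_vec 4. v \<noteq> 0\<^sub>v 4 \<longrightarrow> v \<bullet> (S *\<^sub>v v) > 0" and "\<exists>i\<in>{1..4}. v i \<noteq> 0"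
    then obtain i where i: "i \<in> {1..4}" "v i \<noteq> 0" by blast
    have "vec 4 (\<lambda>a. v (Suc a)) \<noteq> 0\<^sub>v 4"
    proof
      assume "vec 4 (\<lambda>a. v (Suc a)) = 0\<^sub>v 4"
      then have "vec 4 (\<lambda>a. v (Suc a)) $ (i - 1) = 0\<^sub>v 4 $ (i - 1)" by simp
      moreover have "i - 1 < 4" "Suc (i - 1) = i" using i by auto
      ultimately show False using i by simp
    qed
    then show "0 < (\<Sum>i\<in>{1..4}. \<Sum>j\<in>{1..4}. v i * entries S i j * v j)"
      using *[rule_format, OF vec_carrier, of "\<lambda>a. v (Suc a)"] unfolding form by blast
  next
    fix v :: "real vec"
    assume *: "\<forall>v. (\<exists>i\<in>{1..4}. v i \<noteq> 0) \<longrightarrow>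
        0 < (\<Sum>i\<in>{1..4}. \<Sum>j\<in>{1..4}. v i * entries S i j * v j)"
      and v: "v \<in> carrier_vec 4" "v \<noteq> 0\<^sub>v 4"
    have e: "vec 4 (\<lambda>a. (\<lambda>i. v $ (i - 1)) (Suc a)) = v" using v by (intro eq_vecI) auto
    have "\<exists>a<4. v $ a \<noteq> 0" using v by (metis carrier_vecD eq_vecI index_zero_vec)
    then obtain a where "a < 4" "v $ a \<noteq> 0" by blast
    then have "\<exists>i\<in>{1..4}. (\<lambda>i. v $ (i - 1)) i \<noteq> 0" by (intro bexI[of _ "Suc a"]) auto
    then show "0 < v \<bullet> (S *\<^sub>v v)" using * form[of "\<lambda>i. v $ (i - 1)"] unfolding e by simp
  qed
  show ?thesis using assms sym vecs by (auto simp: PD_def posdef_def)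
qed

lemma posdef_realised:
  assumes "posdef s"
  obtains S where "S \<in> PD 4" "ci_relation (entries S) = ci_relation s"
proof -
  let ?S = "mat 4 4 (\<lambda>(a, b). s (Suc a) (Suc b))"
  have e: "entries ?S i j = s i j" if "i \<in> {1..4}" "j \<in> {1..4}" for i j
    using that by (auto simp: entries_def)
  have "posdef (entries ?S)" using assms posdef_cong[of "entries ?S" s, OF e] by blast
  then show ?thesis using that[of ?S] PD_posdef[of ?S] ci_relation_cong[OF e] by auto
qed

lemma ci_minor_ci_relation:
  assumes "S \<in> PD 4" "({i, j}, D) \<in> couples 4"
  shows "ci_minor S i j D = 0 \<longleftrightarrow> ({i, j}, D) \<in> ci_relation (entries S)"
proof -
  have S: "posdef (entries S)" using assms(1) PD_posdef by (auto simp: PD_def)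
  have ij: "i \<noteq> j" "{i, j} \<subseteq> {1..4}" "D \<subseteq> {1..4} - {i, j}"
    using assms(2) by (auto simp: couples_def)
  then obtain C where C: "set C = D" "distinct C"
    by (metis finite_distinct_list finite_Diff finite_atLeastAtMost finite_subset)
  then have d: "distinct (i # j # C)" "set (i # j # C) \<subseteq> {1..4}" using ij by auto
  show ?thesis
    unfolding C(1)[symmetric] ci_minor_apm[OF C(2) distinct_length[OF d]]
    using ci_relation_iff[OF S d] by blast
qed

lemma couple_pair: "c \<in> couples 4 \<Longrightarrow> \<exists>i j C. c = ({i, j}, C)"
  by (cases c) (metis couplesE)

lemma V_pd_ci_relation:
  assumes L: "L \<subseteq> couples 4" and S: "S \<in> PD 4"
  shows "S \<in> V_pd 4 L \<longleftrightarrow> L \<subseteq> ci_relation (entries S)"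
proof
  assume V: "S \<in> V_pd 4 L"
  show "L \<subseteq> ci_relation (entries S)"
  proof
    fix c assume c: "c \<in> L"
    then obtain i j D where ijD: "c = ({i, j}, D)" using L couple_pair by (metis subsetD)
    then have "ci_minor S i j D = 0" using V c by (auto simp: V_pd_def)
    then show "c \<in> ci_relation (entries S)"
      using ci_minor_ci_relation[OF S] c L unfolding ijD by (metis subsetD)
  qed
next
  assume R: "L \<subseteq> ci_relation (entries S)"
  have "ci_minor S i j D = 0" if "({i, j}, D) \<in> L" for i j D
    using ci_minor_ci_relation[OF S] R L that by (metis subsetD)
  then show "S \<in> V_pd 4 L" using S by (simp add: V_pd_def)
qed

text \<open>Completeness of \<open>L\<close> in terms of Gaussian relations: \<open>L\<close> is an intersection of relations of the form
\<open>ci_relation s\<close>.\<close>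

lemma complete_iff:
  "complete_relation 4 L \<longleftrightarrow> L \<subseteq> couples 4 \<and>
     (\<forall>c\<in>couples 4 - L. \<exists>s. posdef s \<and> L \<subseteq> ci_relation s \<and> c \<notin> ci_relation s)"
proof (cases "L \<subseteq> couples 4")
  case True
  have eq: "(\<exists>S\<in>V_pd 4 L. ci_minor S i j C \<noteq> 0) \<longleftrightarrow>
      (\<exists>s. posdef s \<and> L \<subseteq> ci_relation s \<and> ({i, j}, C) \<notin> ci_relation s)"
    if c: "({i, j}, C) \<in> couples 4" for i j C
  proof
    assume "\<exists>S\<in>V_pd 4 L. ci_minor S i j C \<noteq> 0"
    then obtain S where V: "S \<in> V_pd 4 L" and n: "ci_minor S i j C \<noteq> 0" by blast
    then have S: "S \<in> PD 4" by (simp add: V_pd_def)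
    then have "posdef (entries S)" using PD_posdef by (auto simp: PD_def)
    then show "\<exists>s. posdef s \<and> L \<subseteq> ci_relation s \<and> ({i, j}, C) \<notin> ci_relation s"
      using V_pd_ci_relation[OF True S] V ci_minor_ci_relation[OF S c] n by blast
  next
    assume "\<exists>s. posdef s \<and> L \<subseteq> ci_relation s \<and> ({i, j}, C) \<notin> ci_relation s"
    then obtain s where s: "posdef s" "L \<subseteq> ci_relation s" "({i, j}, C) \<notin> ci_relation s" by blast
    obtain S where S: "S \<in> PD 4" "ci_relation (entries S) = ci_relation s"
      using posdef_realised[OF s(1)] .
    then show "\<exists>S\<in>V_pd 4 L. ci_minor S i j C \<noteq> 0"
      using V_pd_ci_relation[OF True S(1)] ci_minor_ci_relation[OF S(1) c] s by auto
  qed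
  let ?Q = "\<lambda>c. \<exists>s. posdef s \<and> L \<subseteq> ci_relation s \<and> c \<notin> ci_relation s"
  have "complete_relation 4 L \<longleftrightarrow> (\<forall>i j C. ({i, j}, C) \<in> couples 4 - L \<longrightarrow> ?Q ({i, j}, C))"
    unfolding complete_relation_def using True eq by simp
  also have "\<dots> \<longleftrightarrow> (\<forall>c\<in>couples 4 - L. ?Q c)"
  proof
    assume *: "\<forall>i j C. ({i, j}, C) \<in> couples 4 - L \<longrightarrow> ?Q ({i, j}, C)"
    show "\<forall>c\<in>couples 4 - L. ?Q c"
    proof
      fix c assume c: "c \<in> couples 4 - L"
      then obtain i j C where "c = ({i, j}, C)" using couple_pair by blast
      then show "?Q c" using * c by simp
    qed
  qed simp
  finally show ?thesis using True by simp
qed (simp add: complete_relation_def)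

section \<open>Relations as bit lists and the action of the symmetric group\<close>

text \<open>The numbering of the 24 couples by \<open>0, \<dots>, 23\<close> that all tables below refer to: first the couples \<open>ij\<close>,
then \<open>ij|k\<close>, then \<open>ij|kl\<close>.\<close>

definition codes :: "(nat \<times> nat \<times> nat list) list" where
  "codes =
   [(1,2,[]), (1,3,[]), (1,4,[]), (2,3,[]), (2,4,[]), (3,4,[]),
    (1,2,[3]), (1,2,[4]), (1,3,[2]), (1,3,[4]), (1,4,[2]), (1,4,[3]),
    (2,3,[1]), (2,3,[4]), (2,4,[1]), (2,4,[3]), (3,4,[1]), (3,4,[2]),
    (1,2,[3,4]), (1,3,[2,4]), (1,4,[2,3]), (2,3,[1,4]), (2,4,[1,3]), (3,4,[1,2])]"

definition couple :: "nat \<times> nat \<times> nat list \<Rightarrow> ci_couple" where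
  "couple = (\<lambda>(i, j, C). ({i, j}, set C))"

definition bits :: "ci_couple set \<Rightarrow> bool list" where
  "bits L = map (\<lambda>c. couple c \<in> L) codes"

definition rel :: "bool list \<Rightarrow> ci_couple set" where
  "rel x = {couple (codes ! n) | n. n < 24 \<and> x ! n}"

lemma length_codes [simp]: "length codes = 24"
  by (simp add: codes_def)

lemma length_bits [simp]: "length (bits L) = 24"
  by (simp add: bits_def)

lemma bits_nth [simp]: "n < 24 \<Longrightarrow> bits L ! n \<longleftrightarrow> couple (codes ! n) \<in> L"
  by (simp add: bits_def)

text \<open>After ordering the pair \<open>i < j\<close> and listing the conditioning set increasingly, only the couples of
\<open>codes\<close> are left.\<close>

lemma couples_eq: "couples 4 = couple ` set codes"
proof
  show "couple ` set codes \<subseteq> couples 4"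
    by (auto simp: couple_def codes_def couples_def)
next
  have "({i, j}, D) \<in> couple ` set codes" if "i < j" "({i, j}, D) \<in> couples 4" for i j D
  proof -
    have ij: "i \<in> {1, 2, 3, 4}" "j \<in> {1, 2, 3, 4}" and D: "D \<subseteq> {1, 2, 3, 4} - {i, j}"
      using that(2) by (auto simp: couples_def ground_set)
    define C where "C = sorted_list_of_set D"
    have fin: "finite D" using D by (rule finite_subset) simp
    have C: "set C = D" "sorted_wrt (<) C" using fin by (auto simp: C_def)
    have "length C \<le> 2"
    proof (rule distinct_length[of i j])
      show "distinct (i # j # C)" using C that(1) D strict_sorted_iff by auto
      show "set (i # j # C) \<subseteq> {1..4}" using ij C D by auto
    qed
    moreover have pairs: "(a, b) \<in> {(1, 2), (1, 3), (1, 4), (2, 3), (2, 4), (3, 4)}"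
      if "a \<in> {1, 2, 3, 4}" "b \<in> {1, 2, 3, 4}" "a < b" for a b :: nat
      using that by auto
    ultimately consider "C = []" | k where "C = [k]" | k l where "C = [k, l]"
      using list_upto2 by blast
    then have "(i, j, C) \<in> set codes"
    proof cases
      case 1
      then show ?thesis using pairs[OF ij that(1)] by (auto simp: codes_def)
    next
      case (2 k)
      then have "k \<in> {1, 2, 3, 4}" "k \<noteq> i" "k \<noteq> j" using C D by auto
      with 2 show ?thesis using pairs[OF ij that(1)]
        by (simp only: insert_iff empty_iff prod.inject) (elim disjE; simp add: codes_def)
    next
      case (3 k l)
      then have kl: "k \<in> {1, 2, 3, 4}" "l \<in> {1, 2, 3, 4}" "k < l"
        and ne: "k \<noteq> i" "k \<noteq> j" "l \<noteq> i" "l \<noteq> j"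
        using C D by auto
      show ?thesis using 3 ne pairs[OF ij that(1)] pairs[OF kl]
        by (simp only: insert_iff empty_iff prod.inject) (elim disjE; simp add: codes_def)
    qed
    moreover have "couple (i, j, C) = ({i, j}, D)" using C by (simp add: couple_def)
    ultimately show ?thesis by (metis image_eqI)
  qed
  note * = this
  show "couples 4 \<subseteq> couple ` set codes"
  proof
    fix c assume c: "c \<in> couples 4"
    then obtain i j D where ijD: "c = ({i, j}, D)" using couple_pair by blast
    have "i \<noteq> j" using c by (auto simp: ijD couples_def)
    then consider "i < j" | "j < i" by linarith
    then show "c \<in> couple ` set codes"
      using *[of i j D] *[of j i D] c by cases (simp_all add: ijD insert_commute)
  qed
qed

lemma couplesE_nth:
  assumes "c \<in> couples 4"
  obtains n where "n < 24" "c = couple (codes ! n)"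
  using assms unfolding couples_eq by (auto simp: in_set_conv_nth)

lemma couple_nth_in: "n < 24 \<Longrightarrow> couple (codes ! n) \<in> couples 4"
  by (simp add: couples_eq)

lemma distinct_couples: "distinct (map couple codes)"
  by (simp add: codes_def couple_def doubleton_eq_iff)

lemma bits_rel:
  assumes "length x = 24"
  shows "bits (rel x) = x"
proof (rule nth_equalityI)
  fix n assume "n < length (bits (rel x))"
  then have n: "n < 24" by simp
  have "couple (codes ! n) \<in> rel x \<longleftrightarrow> x ! n"
  proof
    assume "couple (codes ! n) \<in> rel x"
    then obtain m where m: "m < 24" "x ! m" "couple (codes ! n) = couple (codes ! m)"
      by (auto simp: rel_def)
    then have "n = m"
      using n nth_eq_iff_index_eq[OF distinct_couples, of n m] by simp
    then show "x ! n" using m by simp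
  next
    assume "x ! n"
    then show "couple (codes ! n) \<in> rel x" using n by (auto simp: rel_def)
  qed
  then show "bits (rel x) ! n \<longleftrightarrow> x ! n" using n by simp
qed (simp add: assms)

lemma rel_bits:
  assumes "L \<subseteq> couples 4"
  shows "rel (bits L) = L"
proof
  show "rel (bits L) \<subseteq> L" by (auto simp: rel_def)
  show "L \<subseteq> rel (bits L)"
  proof
    fix c assume c: "c \<in> L"
    with assms obtain n where "n < 24" "c = couple (codes ! n)" using couplesE_nth by blast
    then show "c \<in> rel (bits L)" using c by (auto simp: rel_def)
  qed
qed

lemma rel_subset: "rel x \<subseteq> couples 4"
  using couple_nth_in by (auto simp: rel_def)

abbreviation below :: "bool list \<Rightarrow> bool list \<Rightarrow> bool" where
  "below \<equiv> list_all2 (\<longrightarrow>)"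

lemma below_iff: "below x y \<longleftrightarrow> length x = length y \<and> (\<forall>n<length x. x ! n \<longrightarrow> y ! n)"
  by (auto simp: list_all2_conv_all_nth)

lemma below_bits:
  assumes "L \<subseteq> couples 4"
  shows "below (bits L) (bits M) \<longleftrightarrow> L \<subseteq> M"
proof
  assume b: "below (bits L) (bits M)"
  show "L \<subseteq> M"
  proof
    fix c assume c: "c \<in> L"
    with assms obtain n where "n < 24" "c = couple (codes ! n)" using couplesE_nth by blast
    then show "c \<in> M" using b c by (auto simp: below_iff)
  qed
qed (auto simp: below_iff)

definition gaussian :: "bool list \<Rightarrow> bool" where
  "gaussian x \<longleftrightarrow> (\<exists>s. posdef s \<and> x = bits (ci_relation s))"

lemma length_gaussian: "gaussian x \<Longrightarrow> length x = 24"
  by (auto simp: gaussian_def)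

definition complete_bits :: "bool list \<Rightarrow> bool" where
  "complete_bits x \<longleftrightarrow> length x = 24 \<and>
     (\<forall>n<24. \<not> x ! n \<longrightarrow> (\<exists>y. gaussian y \<and> below x y \<and> \<not> y ! n))"

lemma complete_relation_bits:
  assumes L: "L \<subseteq> couples 4"
  shows "complete_relation 4 L \<longleftrightarrow> complete_bits (bits L)"
proof -
  have "(\<exists>y. gaussian y \<and> below (bits L) y \<and> \<not> y ! n) \<longleftrightarrow>
     (\<exists>s. posdef s \<and> L \<subseteq> ci_relation s \<and> couple (codes ! n) \<notin> ci_relation s)" if "n < 24" for n
    using that below_bits[OF L] by (fastforce simp: gaussian_def)
  moreover have "(\<forall>c\<in>couples 4 - L. Q c) \<longleftrightarrow> (\<forall>n<24. couple (codes ! n) \<notin> L \<longrightarrow> Q (couple (codes ! n)))"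
    for Q using couplesE_nth couple_nth_in by (metis DiffD1 DiffD2 DiffI)
  ultimately show ?thesis using L by (simp add: complete_iff complete_bits_def)
qed

definition perm_lists :: "nat list list" where
  "perm_lists =
   [[1,2,3,4], [1,2,4,3], [1,3,2,4], [1,3,4,2], [1,4,2,3], [1,4,3,2], [2,1,3,4], [2,1,4,3],
    [2,3,1,4], [2,3,4,1], [2,4,1,3], [2,4,3,1], [3,1,2,4], [3,1,4,2], [3,2,1,4], [3,2,4,1],
    [3,4,1,2], [3,4,2,1], [4,1,2,3], [4,1,3,2], [4,2,1,3], [4,2,3,1], [4,3,1,2], [4,3,2,1]]"

definition perm_of :: "nat \<Rightarrow> nat \<Rightarrow> nat" where
  "perm_of k i = (if i \<in> {1..4} then perm_lists ! k ! (i - 1) else i)"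

text \<open>Entry \<open>n\<close> of row \<open>k\<close> is the number of the image of couple \<open>n\<close> under the \<open>k\<close>-th permutation.\<close>

definition action_table :: "nat list list" where
  "action_table =
   [[0,1,2,3,4,5,6,7,8,9,10,11,12,13,14,15,16,17,18,19,20,21,22,23],
    [0,2,1,4,3,5,7,6,10,11,8,9,14,15,12,13,16,17,18,20,19,22,21,23],
    [1,0,2,3,5,4,8,9,6,7,11,10,12,13,16,17,14,15,19,18,20,21,23,22],
    [1,2,0,5,3,4,9,8,11,10,6,7,16,17,12,13,14,15,19,20,18,23,21,22],
    [2,0,1,4,5,3,10,11,7,6,9,8,14,15,16,17,12,13,20,18,19,22,23,21],
    [2,1,0,5,4,3,11,10,9,8,7,6,16,17,14,15,12,13,20,19,18,23,22,21],
    [0,3,4,1,2,5,6,7,12,13,14,15,8,9,10,11,17,16,18,21,22,19,20,23],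
    [0,4,3,2,1,5,7,6,14,15,12,13,10,11,8,9,17,16,18,22,21,20,19,23],
    [3,0,4,1,5,2,12,13,6,7,15,14,8,9,17,16,10,11,21,18,22,19,23,20],
    [3,4,0,5,1,2,13,12,15,14,6,7,17,16,8,9,10,11,21,22,18,23,19,20],
    [4,0,3,2,5,1,14,15,7,6,13,12,10,11,17,16,8,9,22,18,21,20,23,19],
    [4,3,0,5,2,1,15,14,13,12,7,6,17,16,10,11,8,9,22,21,18,23,20,19],
    [1,3,5,0,2,4,8,9,12,13,16,17,6,7,11,10,15,14,19,21,23,18,20,22],
    [1,5,3,2,0,4,9,8,16,17,12,13,11,10,6,7,15,14,19,23,21,20,18,22],
    [3,1,5,0,4,2,12,13,8,9,17,16,6,7,15,14,11,10,21,19,23,18,22,20],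
    [3,5,1,4,0,2,13,12,17,16,8,9,15,14,6,7,11,10,21,23,19,22,18,20],
    [5,1,3,2,4,0,16,17,9,8,13,12,11,10,15,14,6,7,23,19,21,20,22,18],
    [5,3,1,4,2,0,17,16,13,12,9,8,15,14,11,10,6,7,23,21,19,22,20,18],
    [2,4,5,0,1,3,10,11,14,15,16,17,7,6,9,8,13,12,20,22,23,18,19,21],
    [2,5,4,1,0,3,11,10,16,17,14,15,9,8,7,6,13,12,20,23,22,19,18,21],
    [4,2,5,0,3,1,14,15,10,11,17,16,7,6,13,12,9,8,22,20,23,18,21,19],
    [4,5,2,3,0,1,15,14,17,16,10,11,13,12,7,6,9,8,22,23,20,21,18,19],
    [5,2,4,1,3,0,16,17,11,10,15,14,9,8,13,12,7,6,23,20,22,19,21,18],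
    [5,4,2,3,1,0,17,16,15,14,11,10,13,12,9,8,7,6,23,22,20,21,19,18]]"

definition act :: "nat \<Rightarrow> bool list \<Rightarrow> bool list" where
  "act k x = map ((!) x) (action_table ! k)"

text \<open>The inverse image of a relation. Compared with \<open>permute_relation\<close>, membership of a couple is read off at
its image, which is what a table lookup does; over all permutations both give the same orbits.\<close>

definition pull :: "(nat \<Rightarrow> nat) \<Rightarrow> ci_couple set \<Rightarrow> ci_couple set" where
  "pull p L = {(K, D). (p ` K, p ` D) \<in> L}"

lemma length_tables: "length perm_lists = 24" "length action_table = 24"
  by (simp_all add: perm_lists_def action_table_def)

lemma action_table_correct:
  "list_all2 (\<lambda>p t. list_all2 (\<lambda>(i, j, C) n.
      couple (p ! (i - 1), p ! (j - 1), map (\<lambda>c. p ! (c - 1)) C) = couple (codes ! n)) codes t)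
    perm_lists action_table"
  by (simp add: perm_lists_def action_table_def codes_def couple_def doubleton_eq_iff)

lemma codes_ground: "(i, j, C) \<in> set codes \<Longrightarrow> i \<in> {1..4} \<and> j \<in> {1..4} \<and> set C \<subseteq> {1..4}"
  by (auto simp: codes_def)

lemma action_table_nth:
  assumes "k < 24" "n < 24"
  shows "map_prod ((`) (perm_of k)) ((`) (perm_of k)) (couple (codes ! n)) =
    couple (codes ! (action_table ! k ! n))"
    and "length (action_table ! k) = 24"
proof -
  obtain i j C where c: "codes ! n = (i, j, C)" by (cases "codes ! n")
  have row: "list_all2 (\<lambda>(i, j, C) n. couple (perm_lists ! k ! (i - 1), perm_lists ! k ! (j - 1),
      map (\<lambda>c. perm_lists ! k ! (c - 1)) C) = couple (codes ! n)) codes (action_table ! k)"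
    using action_table_correct assms(1) by (simp add: list_all2_conv_all_nth length_tables)
  then have "couple (perm_lists ! k ! (i - 1), perm_lists ! k ! (j - 1), map (\<lambda>c. perm_lists ! k ! (c - 1)) C)
      = couple (codes ! (action_table ! k ! n))"
    using assms(2) c by (auto simp: list_all2_conv_all_nth)
  moreover have "i \<in> {1..4}" "j \<in> {1..4}" "set C \<subseteq> {1..4}"
    using codes_ground[of i j C] c assms(2) by (metis length_codes nth_mem)+
  moreover from this have "map (perm_of k) C = map (\<lambda>c. perm_lists ! k ! (c - 1)) C"
    by (intro map_cong) (auto simp: perm_of_def)
  moreover have "map_prod ((`) (perm_of k)) ((`) (perm_of k)) (couple (i, j, C)) =
      couple (perm_of k i, perm_of k j, map (perm_of k) C)"
    by (simp add: couple_def)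
  ultimately show "map_prod ((`) (perm_of k)) ((`) (perm_of k)) (couple (codes ! n)) =
    couple (codes ! (action_table ! k ! n))" unfolding c by (simp only: perm_of_def if_True)
  show "length (action_table ! k) = 24" using row by (simp add: list_all2_conv_all_nth)
qed

lemma bits_pull:
  assumes k: "k < 24"
  shows "bits (pull (perm_of k) L) = act k (bits L)"
proof (rule nth_equalityI)
  have tbl: "action_table ! k ! n < 24" if "n < 24" for n
  proof -
    have "list_all (list_all (\<lambda>m. m < 24)) action_table" by (simp add: action_table_def)
    then show ?thesis
      using k that action_table_nth(2)[OF k that] by (simp add: list_all_length length_tables)
  qed
  fix n assume "n < length (bits (pull (perm_of k) L))"
  then have n: "n < 24" by simp
  have "couple (codes ! n) \<in> pull (perm_of k) L \<longleftrightarrow>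
      map_prod ((`) (perm_of k)) ((`) (perm_of k)) (couple (codes ! n)) \<in> L"
    by (cases "couple (codes ! n)") (simp add: pull_def)
  then show "bits (pull (perm_of k) L) ! n \<longleftrightarrow> act k (bits L) ! n"
    using n k action_table_nth[OF k n] tbl[OF n] by (simp add: act_def)
qed (use action_table_nth(2)[OF k, of 0] in \<open>simp add: act_def\<close>)

lemma perm_lists_permutations:
  assumes "k < 24"
  shows "length (perm_lists ! k) = 4 \<and> distinct (perm_lists ! k) \<and> set (perm_lists ! k) = {1..4}"
proof -
  have "list_all (\<lambda>p. length p = 4 \<and> distinct p \<and> set p = {1, 2, 3, 4}) perm_lists"
    by (simp add: perm_lists_def insert_commute)
  then have "length (perm_lists ! k) = 4 \<and> distinct (perm_lists ! k) \<and> set (perm_lists ! k) = {1, 2, 3, 4}"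
    using assms unfolding list_all_length length_tables by blast
  then show ?thesis unfolding ground_set .
qed

lemma perm_of_permutes:
  assumes "k < 24"
  shows "perm_of k permutes {1..4}"
proof (rule bij_imp_permutes)
  have p: "length (perm_lists ! k) = 4" "distinct (perm_lists ! k)" "set (perm_lists ! k) = {1..4}"
    using perm_lists_permutations[OF assms] by blast+
  have "inj_on (perm_of k) {1..4}"
    using p by (auto simp: inj_on_def perm_of_def nth_eq_iff_index_eq)
  moreover have "perm_of k ` {1..4} \<subseteq> {1..4}"
  proof
    fix a assume "a \<in> perm_of k ` {1..4}"
    then obtain i where i: "i \<in> {1..4}" "a = perm_lists ! k ! (i - 1)" by (auto simp: perm_of_def)
    then have "i - 1 < length (perm_lists ! k)" using p(1) by auto
    then show "a \<in> {1..4}" using nth_mem i(2) p(3) by blast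
  qed
  ultimately show "bij_betw (perm_of k) {1..4} {1..4}"
    by (simp add: bij_betw_def endo_inj_surj)
  show "perm_of k i = i" if "i \<notin> {1..4}" for i using that by (simp only: perm_of_def if_False)
qed

text \<open>The 24 listed permutations are pairwise different and there are \<open>4!\<close> permutations in all.\<close>

lemma permutes_perm_of:
  assumes p: "p permutes {1..4}"
  obtains k where "k < 24" "perm_of k = p"
proof -
  have "inj_on perm_of {..<24}"
  proof (rule inj_onI)
    fix k m assume km: "k \<in> {..<24}" "m \<in> {..<24}" and eq: "perm_of k = perm_of m"
    have len: "length (perm_lists ! k) = 4" "length (perm_lists ! m) = 4"
      using perm_lists_permutations km by auto
    have "perm_lists ! k = perm_lists ! m"
    proof (rule nth_equalityI)
      fix i assume "i < length (perm_lists ! k)"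
      then have "Suc i \<in> {1..4}" using len by auto
      then show "perm_lists ! k ! i = perm_lists ! m ! i"
        using fun_cong[OF eq, of "Suc i"] by (simp only: perm_of_def if_True diff_Suc_1)
    qed (simp add: len)
    moreover have "distinct perm_lists" by (simp add: perm_lists_def)
    ultimately show "k = m" using km by (simp add: nth_eq_iff_index_eq length_tables)
  qed
  then have "card (perm_of ` {..<24}) = 24" by (simp add: card_image)
  moreover have "card {p. p permutes {1..4::nat}} = 24"
    using card_permutations[of "{1..4::nat}" 4] by (simp add: fact_numeral)
  moreover have "perm_of ` {..<24} \<subseteq> {p. p permutes {1..4}}"
    using perm_of_permutes by auto
  ultimately have eq: "perm_of ` {..<24} = {p. p permutes {1..4}}"
    by (intro card_subset_eq) (simp_all add: finite_permutations)
  have "p \<in> perm_of ` {..<24}" unfolding eq using p by simp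
  then obtain k where "k < 24" "p = perm_of k" by auto
  then show ?thesis by (intro that) simp_all
qed

lemma pull_pull: "pull p (pull q L) = pull (q \<circ> p) L"
  by (auto simp: pull_def image_comp)

lemma pull_id: "pull id L = L"
  by (simp add: pull_def)

lemma permute_relation_pull:
  assumes "p permutes A"
  shows "permute_relation p L = pull (Hilbert_Choice.inv p) L"
proof -
  let ?q = "Hilbert_Choice.inv p"
  have inv: "?q ` p ` X = X" "p ` ?q ` X = X" for X
    using permutes_inv_o[OF assms] by (simp_all add: image_comp)
  show ?thesis
  proof (intro Set.set_eqI iffI)
    fix c assume "c \<in> permute_relation p L"
    then show "c \<in> pull (Hilbert_Choice.inv p) L" by (auto simp: permute_relation_def pull_def inv)
  next
    fix c assume "c \<in> pull ?q L"
    then obtain K D where KD: "c = (K, D)" "(?q ` K, ?q ` D) \<in> L" by (auto simp: pull_def)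
    then have "(\<lambda>(K, D). (p ` K, p ` D)) (?q ` K, ?q ` D) \<in> permute_relation p L"
      unfolding permute_relation_def by (intro imageI)
    then show "c \<in> permute_relation p L" by (simp add: KD(1) inv)
  qed
qed

lemma pull_couples:
  assumes p: "p permutes {1..4}" and "L \<subseteq> couples 4"
  shows "pull p L \<subseteq> couples 4"
proof
  fix c assume "c \<in> pull p L"
  then obtain K D where c: "c = (K, D)" "(p ` K, p ` D) \<in> couples 4"
    using assms(2) by (auto simp: pull_def)
  have inj: "inj p" using permutes_inj[OF p] .
  have sub: "X \<subseteq> {1..4}" if "p ` X \<subseteq> {1..4}" for X
    using that permutes_in_image[OF p] by blast
  have "p ` K \<subseteq> {1..4}" "p ` D \<subseteq> {1..4}" "p ` K \<inter> p ` D = {}" "card (p ` K) = 2"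
    using c(2) by (auto simp: couples_def)
  then have "K \<subseteq> {1..4}" "D \<subseteq> {1..4}" "K \<inter> D = {}" "card K = 2"
    using sub[of K] sub[of D] card_image[OF inj_on_subset[OF inj subset_UNIV], of K] by auto
  then show "c \<in> couples 4" by (auto simp: c(1) couples_def)
qed

lemma pull_act:
  assumes "p permutes {1..4}"
  obtains k where "k < 24" "\<And>L. bits (pull p L) = act k (bits L)"
  using permutes_perm_of[OF assms] bits_pull by metis

lemma length_act: "k < 24 \<Longrightarrow> length (act k x) = 24"
  using action_table_nth(2)[of k 0] by (simp add: act_def)

lemma act_comp:
  assumes "k < 24" "m < 24"
  shows "\<exists>l<24. \<forall>x. length x = 24 \<longrightarrow> act k (act m x) = act l x"
proof -
  obtain l where l: "l < 24" "\<And>L. bits (pull (perm_of m \<circ> perm_of k) L) = act l (bits L)"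
    using pull_act[OF permutes_compose[OF perm_of_permutes perm_of_permutes]] assms by metis
  have "act k (act m x) = act l x" if "length x = 24" for x
    using l(2)[of "rel x"] bits_rel[OF that]
    by (metis pull_pull bits_pull assms)
  then show ?thesis using l(1) by blast
qed

lemma act_inverse:
  assumes "k < 24"
  shows "\<exists>l<24. \<forall>x. length x = 24 \<longrightarrow> act k (act l x) = x \<and> act l (act k x) = x"
proof -
  note p = perm_of_permutes[OF assms]
  obtain l where l: "l < 24" "\<And>L. bits (pull (Hilbert_Choice.inv (perm_of k)) L) = act l (bits L)"
    using pull_act[OF permutes_inv[OF p]] by metis
  have "act k (act l x) = x" "act l (act k x) = x" if "length x = 24" for x
  proof -
    have "pull (perm_of k) (pull (Hilbert_Choice.inv (perm_of k)) L) = L"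
      "pull (Hilbert_Choice.inv (perm_of k)) (pull (perm_of k) L) = L" for L
      using permutes_inv_o[OF p] by (simp_all add: pull_pull pull_id)
    then show "act k (act l x) = x" "act l (act k x) = x"
      using l(2) bits_pull[OF assms] bits_rel[OF that] by metis+
  qed
  then show ?thesis using l(1) by blast
qed

lemma act_below:
  assumes "k < 24" "below x y" "length x = 24"
  shows "below (act k x) (act k y)"
proof -
  have "list_all (list_all (\<lambda>m. m < 24)) action_table" by (simp add: action_table_def)
  then have "list_all (\<lambda>m. m < 24) (action_table ! k)"
    using assms(1) by (simp add: list_all_length length_tables)
  then show ?thesis using assms(2,3) by (auto simp: below_iff act_def list_all_length)
qed

lemma apm_permute: "apm (\<lambda>i j. s (p i) (p j)) i j C = apm s (p i) (p j) (map p C)"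
  by (cases "(s, i, j, C)" rule: apm.cases) auto

lemma posdef_permute:
  assumes s: "posdef s" and p: "p permutes {1..4}"
  shows "posdef (\<lambda>i j. s (p i) (p j))"
proof -
  have mem: "p i \<in> {1..4} \<longleftrightarrow> i \<in> {1..4}" for i using permutes_in_image[OF p] .
  have eq: "(\<Sum>i\<in>{1..4}. \<Sum>j\<in>{1..4}. v i * s (p i) (p j) * v j) =
     (\<Sum>i\<in>{1..4}. \<Sum>j\<in>{1..4}. v (Hilbert_Choice.inv p i) * s i j * v (Hilbert_Choice.inv p j))" for v
    by (subst (1 2) sum.permute[OF p]) (simp add: o_def permutes_inverses[OF p])
  have "0 < (\<Sum>i\<in>{1..4}. \<Sum>j\<in>{1..4}. v i * s (p i) (p j) * v j)"
    if "\<exists>i\<in>{1..4}. v i \<noteq> 0" for v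
  proof -
    have "\<exists>i\<in>{1..4}. v (Hilbert_Choice.inv p i) \<noteq> 0"
      using that by (metis mem permutes_inverses(2)[OF p])
    with s show ?thesis unfolding eq by (auto simp only: posdef_def)
  qed
  moreover have "s (p i) (p j) = s (p j) (p i)" if "i \<in> {1..4}" "j \<in> {1..4}" for i j
    using posdef_sym[OF s, of "p i" "p j"] that unfolding mem by blast
  ultimately show ?thesis unfolding posdef_def by blast
qed

lemma pull_ci_relation:
  assumes p: "p permutes {1..4}"
  shows "pull p (ci_relation s) = ci_relation (\<lambda>i j. s (p i) (p j))"
proof (intro Set.set_eqI iffI)
  have inj: "inj p" using permutes_inj[OF p] .
  fix c assume "c \<in> pull p (ci_relation s)"
  then obtain K D i' j' C' where c: "c = (K, D)" "p ` K = {i', j'}" "p ` D = set C'"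
    and d: "distinct (i' # j' # C')" "set (i' # j' # C') \<subseteq> {1..4}" "apm s i' j' C' = 0"
    by (auto simp: pull_def ci_relation_def)
  let ?q = "Hilbert_Choice.inv p"
  have pq: "p (?q a) = a" "?q (p a) = a" for a using permutes_inverses[OF p] by auto
  have "K = ?q ` p ` K" "D = ?q ` p ` D" by (simp_all add: image_comp o_def pq)
  then have "K = {?q i', ?q j'}" "D = set (map ?q C')" using c by auto
  moreover have "distinct (map ?q (i' # j' # C'))"
    using d(1) inj_on_subset[OF permutes_inj[OF permutes_inv[OF p]]] by (simp only: distinct_map) auto
  moreover have "set (map ?q (i' # j' # C')) \<subseteq> {1..4}"
    using d(2) permutes_in_image[OF permutes_inv[OF p]] by auto
  moreover have "apm (\<lambda>i j. s (p i) (p j)) (?q i') (?q j') (map ?q C') = 0"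
    using d(3) by (simp add: apm_permute pq o_def)
  ultimately show "c \<in> ci_relation (\<lambda>i j. s (p i) (p j))"
    using ci_relationI[of "?q i'" "?q j'" "map ?q C'"] unfolding c(1) by (simp only: list.map)
next
  fix c assume "c \<in> ci_relation (\<lambda>i j. s (p i) (p j))"
  then obtain i j C where c: "c = ({i, j}, set C)" "distinct (i # j # C)"
      "set (i # j # C) \<subseteq> {1..4}" "apm s (p i) (p j) (map p C) = 0"
    by (auto simp: ci_relation_def apm_permute)
  have "distinct (map p (i # j # C))"
    using c(2) inj_on_subset[OF permutes_inj[OF p]] by (simp only: distinct_map) auto
  moreover have "set (map p (i # j # C)) \<subseteq> {1..4}" using c(3) permutes_in_image[OF p] by auto
  ultimately have "({p i, p j}, set (map p C)) \<in> ci_relation s"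
    using ci_relationI[of "p i" "p j" "map p C"] c(4) by (simp only: list.map)
  then show "c \<in> pull p (ci_relation s)" by (simp add: c(1) pull_def)
qed

lemma gaussian_act:
  assumes "k < 24" "gaussian x"
  shows "gaussian (act k x)"
proof -
  obtain s where s: "posdef s" "x = bits (ci_relation s)" using assms(2) by (auto simp: gaussian_def)
  note p = perm_of_permutes[OF assms(1)]
  let ?t = "\<lambda>i j. s (perm_of k i) (perm_of k j)"
  have "act k x = bits (ci_relation ?t)"
    unfolding s(2) bits_pull[OF assms(1), symmetric] pull_ci_relation[OF p] ..
  with posdef_permute[OF s(1) p] have "posdef ?t \<and> act k x = bits (ci_relation ?t)" ..
  then show ?thesis unfolding gaussian_def by (rule exI[of _ ?t])
qed

lemma complete_bits_act:
  assumes k: "k < 24" and x: "complete_bits x"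
  shows "complete_bits (act k x)"
proof -
  have len: "length x = 24" using x by (simp add: complete_bits_def)
  have "\<exists>y. gaussian y \<and> below (act k x) y \<and> \<not> y ! n" if n: "n < 24" "\<not> act k x ! n" for n
  proof -
    have t: "act k z ! n = z ! (action_table ! k ! n)" for z
      using action_table_nth(2)[OF k n(1)] n(1) by (simp add: act_def)
    have "list_all (list_all (\<lambda>m. m < 24)) action_table" by (simp add: action_table_def)
    then have "action_table ! k ! n < 24"
      using k n(1) action_table_nth(2)[OF k n(1)] by (simp add: list_all_length length_tables)
    then obtain y where "gaussian y" "below x y" "\<not> y ! (action_table ! k ! n)"
      using x n(2) by (auto simp: complete_bits_def t)
    then show ?thesis
      using gaussian_act[OF k, of y] act_below[OF k _ len, of y] t[of y] by blast
  qed
  then show ?thesis using length_act[OF k] by (simp add: complete_bits_def)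
qed

section \<open>Inference rules for Gaussian relations\<close>

text \<open>The quadratic form on vectors supported on three indices. Positivity of the principal minors of
order two and three follows by inserting a column of an adjugate matrix.\<close>

lemma posdef_principal:
  assumes s: "posdef s" and d: "distinct [i, j, k]" "{i, j, k} \<subseteq> {1..4}"
    and nz: "a \<noteq> 0 \<or> b \<noteq> 0 \<or> c \<noteq> 0"
  shows "0 < a\<^sup>2 * s i i + b\<^sup>2 * s j j + c\<^sup>2 * s k k + 2 * a * b * s i j + 2 * a * c * s i k + 2 * b * c * s j k"
proof -
  define v where "v n = (if n = i then a else if n = j then b else if n = k then c else 0)" for n
  have v: "v i = a" "v j = b" "v k = c" using d by (auto simp: v_def)
  have sub: "(\<Sum>n\<in>{1..4}. f n) = f i + f j + f k" if "\<And>n. v n = 0 \<Longrightarrow> f n = 0" for f :: "nat \<Rightarrow> real"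
  proof -
    have "sum f {1..4} = sum f {i, j, k}"
      using d(2) by (intro sum.mono_neutral_right ballI that) (auto simp: v_def)
    also have "\<dots> = f i + f j + f k" using d(1) by simp
    finally show ?thesis .
  qed
  have sym: "s j i = s i j" "s k i = s i k" "s k j = s j k"
    using posdef_sym[OF s] d(2) by blast+
  have "\<exists>n\<in>{1..4}. v n \<noteq> 0" using nz v d(2) by (metis insert_subset)
  then have "0 < (\<Sum>m\<in>{1..4}. \<Sum>n\<in>{1..4}. v m * s m n * v n)"
    using s unfolding posdef_def by blast
  also have "\<dots> = (\<Sum>m\<in>{1..4}. v m * s m i * v i + v m * s m j * v j + v m * s m k * v k)"
    by (intro sum.cong refl sub) simp
  also have "\<dots> = (v i * s i i * v i + v i * s i j * v j + v i * s i k * v k)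
      + (v j * s j i * v i + v j * s j j * v j + v j * s j k * v k)
      + (v k * s k i * v i + v k * s k j * v j + v k * s k k * v k)"
    by (rule sub) simp
  also have "\<dots> = a\<^sup>2 * s i i + b\<^sup>2 * s j j + c\<^sup>2 * s k k
      + 2 * a * b * s i j + 2 * a * c * s i k + 2 * b * c * s j k"
    by (simp add: v sym algebra_simps power2_eq_square)
  finally show ?thesis .
qed

text \<open>Statements about two indices are instances of \<open>posdef_principal\<close> once a third index is chosen.\<close>

lemma third_index: "\<exists>k. distinct [i, j, k] \<and> k \<in> {1..(4::nat)}" if "i \<noteq> j"
proof -
  have "card ({1..4} - {i, j}) > 0"
  proof -
    have "card {1..(4::nat)} - card {i, j} \<le> card ({1..4} - {i, j})" by (rule diff_card_le_card_Diff) simp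
    then show ?thesis using that by simp
  qed
  then obtain k where "k \<in> {1..4} - {i, j}" by (metis card_gt_0_iff ex_in_conv)
  then show ?thesis using that by auto
qed

lemma minor2_pos:
  assumes s: "posdef s" and ij: "i \<noteq> j" "i \<in> {1..4}" "j \<in> {1..4}"
  shows "0 < s i i" "0 < s j j" "(s i j)\<^sup>2 < s i i * s j j"
proof -
  obtain k where k: "distinct [i, j, k]" "{i, j, k} \<subseteq> {1..4}"
    using third_index[OF ij(1)] ij by auto
  show ii: "0 < s i i" using posdef_principal[OF s k, of 1 0 0] by simp
  show jj: "0 < s j j" using posdef_principal[OF s k, of 0 1 0] by simp
  have "0 < (s j j)\<^sup>2 * s i i + (- s i j)\<^sup>2 * s j j + 2 * s j j * - s i j * s i j"
    using posdef_principal[OF s k, of "s j j" "- s i j" 0] jj by simp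
  also have "\<dots> = s j j * (s i i * s j j - (s i j)\<^sup>2)"
    by (simp add: algebra_simps power2_eq_square)
  finally show "(s i j)\<^sup>2 < s i i * s j j" using jj by (simp add: zero_less_mult_iff)
qed

lemma minor3_pos:
  assumes s: "posdef s" and d: "distinct [i, j, k]" "{i, j, k} \<subseteq> {1..4}"
  shows "0 < s i i * s j j * s k k + 2 * s i j * s i k * s j k
    - s i i * (s j k)\<^sup>2 - s j j * (s i k)\<^sup>2 - s k k * (s i j)\<^sup>2"
proof -
  have jk: "(s j k)\<^sup>2 < s j j * s k k" using minor2_pos(3)[OF s, of j k] d by auto
  \<comment> \<open>the first column of the adjugate of the submatrix on \<open>i, j, k\<close>\<close>
  let ?a = "s j j * s k k - (s j k)\<^sup>2"
  let ?b = "s i k * s j k - s i j * s k k"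
  let ?c = "s i j * s j k - s i k * s j j"
  have "0 < ?a\<^sup>2 * s i i + ?b\<^sup>2 * s j j + ?c\<^sup>2 * s k k
      + 2 * ?a * ?b * s i j + 2 * ?a * ?c * s i k + 2 * ?b * ?c * s j k"
    using jk by (intro posdef_principal[OF s d]) simp
  also have "\<dots> = ?a * (s i i * s j j * s k k + 2 * s i j * s i k * s j k
    - s i i * (s j k)\<^sup>2 - s j j * (s i k)\<^sup>2 - s k k * (s i j)\<^sup>2)"
    by Groebner_Basis.algebra
  finally show ?thesis using jk by (simp add: zero_less_mult_iff)
qed

text \<open>The linear system behind the square rule: \<open>y z - c\<^sup>2\<close> is its determinant.\<close>

lemma square_algebra:
  fixes a b c y z :: real
  assumes "a = 0 \<or> a * z = b * c" "b = 0 \<or> b * y = a * c" "0 < y" "0 < z" "c\<^sup>2 < y * z"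
  shows "a = 0 \<and> b = 0"
proof -
  have "a = 0"
  proof (rule ccontr)
    assume "a \<noteq> 0"
    then have az: "a * z = b * c" using assms(1) by blast
    then have "b \<noteq> 0" using \<open>a \<noteq> 0\<close> assms(4) by auto
    then have "b * y = a * c" using assms(2) by blast
    then have "a * (y * z) = a * c\<^sup>2" using az by Groebner_Basis.algebra
    then show False using \<open>a \<noteq> 0\<close> assms(5) by simp
  qed
  then show ?thesis using assms(2,3) by auto
qed

text \<open>The rule combines \<open>ij|C, ik|jC \<Longrightarrow> ik|C, ij|kC\<close> with its variants, that is, the semigraphoid, intersection and composition
axioms. For empty \<open>C\<close> the two hypotheses form a linear system for \<open>s i j\<close> and
\<open>s i k\<close> whose determinant is the positive minor on \<open>j, k\<close>. For \<open>C = [l]\<close> the Schur complement \<open>t\<close> of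
\<open>l\<close> is again positive definite, and its minors are those of \<open>s\<close> with \<open>l\<close> added, up to the factor \<open>s l l\<close>.\<close>

lemma square:
  assumes s: "posdef s" and d: "distinct (i # j # k # C)" "set (i # j # k # C) \<subseteq> {1..4}"
    and L: "couple (i, j, C) \<in> ci_relation s \<or> couple (i, j, k # C) \<in> ci_relation s"
      "couple (i, k, C) \<in> ci_relation s \<or> couple (i, k, j # C) \<in> ci_relation s"
  shows "couple (i, j, C) \<in> ci_relation s" "couple (i, j, k # C) \<in> ci_relation s"
    "couple (i, k, C) \<in> ci_relation s" "couple (i, k, j # C) \<in> ci_relation s"
proof -
  have sy: "s a b = s b a" if "a \<in> {i, j, k} \<union> set C" "b \<in> {i, j, k} \<union> set C" for a b
    using that d(2) by (intro posdef_sym[OF s]) auto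
  have mem: "couple (i, j, C) \<in> ci_relation s \<longleftrightarrow> apm s i j C = 0"
    "couple (i, j, k # C) \<in> ci_relation s \<longleftrightarrow> apm s i j (k # C) = 0"
    "couple (i, k, C) \<in> ci_relation s \<longleftrightarrow> apm s i k C = 0"
    "couple (i, k, j # C) \<in> ci_relation s \<longleftrightarrow> apm s i k (j # C) = 0"
    unfolding couple_def prod.case using d by (intro ci_relation_iff[OF s]; auto)+
  have jk: "0 < s j j" "0 < s k k" "(s j k)\<^sup>2 < s j j * s k k"
    using minor2_pos[OF s, of j k] d by auto
  have "length (k # C) \<le> 2" using distinct_length[of i j "k # C"] d by auto
  then consider "C = []" | l where "C = [l]" by (cases C) auto
  then have "apm s i j C = 0 \<and> apm s i j (k # C) = 0 \<and> apm s i k C = 0 \<and> apm s i k (j # C) = 0"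
  proof cases
    case 1
    have "s i j = 0 \<and> s i k = 0"
      by (rule square_algebra[of _ "s k k" _ "s j k" "s j j"])
        (use L[unfolded mem, unfolded 1] jk sy[of j k] in auto)
    then show ?thesis by (simp add: 1)
  next
    case (2 l)
    define t where "t a b = s a b * s l l - s a l * s l b" for a b
    have l: "0 < s l l" and t_pos: "0 < t j j" "0 < t k k"
      using minor2_pos[OF s, of j l] minor2_pos[OF s, of k l] d sy[of j l] sy[of k l]
      by (auto simp: 2 t_def power2_eq_square)
    have det: "0 < s j j * s k k * s l l + 2 * s j k * s j l * s k l
      - s j j * (s k l)\<^sup>2 - s k k * (s j l)\<^sup>2 - s l l * (s j k)\<^sup>2"
      using d by (intro minor3_pos[OF s]) (auto simp: 2)
    have "t j j * t k k - (t j k)\<^sup>2 = s l l * (s j j * s k k * s l l + 2 * s j k * s j l * s k l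
      - s j j * (s k l)\<^sup>2 - s k k * (s j l)\<^sup>2 - s l l * (s j k)\<^sup>2)"
      using sy[of j l] sy[of k l] sy[of j k]
      unfolding t_def 2 by (simp add: algebra_simps power2_eq_square)
    then have t_det: "(t j k)\<^sup>2 < t j j * t k k" using mult_pos_pos[OF l det] by linarith
    \<comment> \<open>Sylvester's determinant identity\<close>
    have lift: "s l l * apm s i j [k, l] = t i j * t k k - t i k * t j k"
      "s l l * apm s i k [j, l] = t i k * t j j - t i j * t j k"
      using sy[of j l] sy[of k l] sy[of j k] unfolding t_def 2
      by (simp_all add: algebra_simps power2_eq_square)
    have "t i j = 0 \<and> t i k = 0"
      by (rule square_algebra[of _ "t k k" _ "t j k" "t j j"])
        (use L[unfolded mem, unfolded 2] t_pos t_det lift in \<open>auto simp: t_def\<close>)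
    then show ?thesis using lift l by (auto simp: 2 t_def)
  qed
  then show "couple (i, j, C) \<in> ci_relation s" "couple (i, j, k # C) \<in> ci_relation s"
    "couple (i, k, C) \<in> ci_relation s" "couple (i, k, j # C) \<in> ci_relation s"
    unfolding mem by blast+
qed

text \<open>If \<open>s i j = 0\<close>, then the minor of \<open>ij|k\<close> reduces to the product \<open>- s i k * s k j\<close>, so one factor
vanishes; with a conditioning index \<open>l\<close> this happens in the Schur complement of \<open>l\<close>.\<close>

lemma weak_transitivity:
  assumes s: "posdef s" and d: "distinct (i # j # k # C)" "set (i # j # k # C) \<subseteq> {1..4}"
    and L: "couple (i, j, C) \<in> ci_relation s" "couple (i, j, k # C) \<in> ci_relation s"
  shows "couple (i, k, C) \<in> ci_relation s \<or> couple (j, k, C) \<in> ci_relation s"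
proof -
  have sy: "s a b = s b a" if "a \<in> {i, j, k} \<union> set C" "b \<in> {i, j, k} \<union> set C" for a b
    using that d(2) by (intro posdef_sym[OF s]) auto
  have mem: "couple (i, j, C) \<in> ci_relation s \<longleftrightarrow> apm s i j C = 0"
    "couple (i, j, k # C) \<in> ci_relation s \<longleftrightarrow> apm s i j (k # C) = 0"
    "couple (i, k, C) \<in> ci_relation s \<longleftrightarrow> apm s i k C = 0"
    "couple (j, k, C) \<in> ci_relation s \<longleftrightarrow> apm s j k C = 0"
    unfolding couple_def prod.case using d by (intro ci_relation_iff[OF s]; auto)+
  have "length (k # C) \<le> 2" using distinct_length[of i j "k # C"] d by auto
  then consider "C = []" | l where "C = [l]" by (cases C) auto
  then have "apm s i k C * apm s j k C = 0"
  proof cases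
    case 1
    then show ?thesis using L[unfolded mem, unfolded 1] sy[of j k] by (simp add: 1)
  next
    case (2 l)
    have "s i j * s l l - s i l * s l j = 0" "apm s i j [k, l] = 0" using L[unfolded mem, unfolded 2] by simp_all
    then show ?thesis
      using sy[of j l] sy[of k l] sy[of j k] unfolding 2 by simp Groebner_Basis.algebra
  qed
  then show ?thesis by (simp add: mem)
qed

lemma bits_ci_relation:
  assumes s: "posdef s"
  shows "bits (ci_relation s) = map (\<lambda>(i, j, C). apm s i j C = 0) codes"
proof -
  have "couple (i, j, C) \<in> ci_relation s \<longleftrightarrow> apm s i j C = 0" if "(i, j, C) \<in> set codes" for i j C
    unfolding couple_def prod.case using that by (intro ci_relation_iff[OF s]) (auto simp: codes_def)
  then show ?thesis unfolding bits_def by (intro map_cong) auto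
qed

text \<open>The 24 squares, each as the numbers of \<open>ij|C, ij|kC, ik|C, ik|jC\<close>.\<close>

definition squares :: "(nat \<times> nat \<times> nat \<times> nat) list" where
  "squares =
   [(0,6,1,8), (0,7,2,10), (1,9,2,11), (0,6,3,12), (0,7,4,14), (3,13,4,15), (1,8,3,12),
    (1,9,5,16), (3,13,5,17), (2,10,4,14), (2,11,5,16), (4,15,5,17), (7,18,9,19), (6,18,11,20),
    (8,19,10,20), (7,18,13,21), (6,18,15,22), (12,21,14,22), (9,19,13,21), (8,19,17,23),
    (12,21,16,23), (11,20,15,22), (10,20,17,23), (14,22,16,23)]"

text \<open>One round of closure under the square rule, for all squares in parallel. Gaussian
relations are closed under it.\<close>

definition step :: "bool list \<Rightarrow> bool list" where
  "step x = map (\<lambda>n. x ! n \<or> list_ex (\<lambda>(a, b, c, d). n \<in> {a, b, c, d} \<and>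
      (x ! a \<or> x ! b) \<and> (x ! c \<or> x ! d)) squares) [0..<24]"

lemma squares_sites:
  "list_all2 (\<lambda>(i, j, k, C) (a, b, c, d).
     distinct (i # j # k # C) \<and> set (i # j # k # C) \<subseteq> {1..4} \<and>
     a < 24 \<and> b < 24 \<and> c < 24 \<and> d < 24 \<and>
     couple (i, j, C) = couple (codes ! a) \<and> couple (i, j, k # C) = couple (codes ! b) \<and>
     couple (i, k, C) = couple (codes ! c) \<and> couple (i, k, j # C) = couple (codes ! d))
    [(1,2,3,[]), (1,2,4,[]), (1,3,4,[]), (2,1,3,[]), (2,1,4,[]), (2,3,4,[]),
     (3,1,2,[]), (3,1,4,[]), (3,2,4,[]), (4,1,2,[]), (4,1,3,[]), (4,2,3,[]),
     (1,2,3,[4]), (1,2,4,[3]), (1,3,4,[2]), (2,1,3,[4]), (2,1,4,[3]), (2,3,4,[1]),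
     (3,1,2,[4]), (3,1,4,[2]), (3,2,4,[1]), (4,1,2,[3]), (4,1,3,[2]), (4,2,3,[1])]
    squares"
  by (simp add: squares_def codes_def couple_def doubleton_eq_iff)

lemma gaussian_square:
  assumes y: "gaussian y" and sq: "(a, b, c, d) \<in> set squares"
    and ab: "y ! a \<or> y ! b" and cd: "y ! c \<or> y ! d"
  shows "y ! a \<and> y ! b \<and> y ! c \<and> y ! d"
proof -
  obtain s where s: "posdef s" and y: "y = bits (ci_relation s)" using y by (auto simp: gaussian_def)
  obtain n where n: "n < length squares" "squares ! n = (a, b, c, d)"
    using sq by (auto simp: in_set_conv_nth)
  obtain i j k C where site: "distinct (i # j # k # C)" "set (i # j # k # C) \<subseteq> {1..4}"
    and less: "a < 24" "b < 24" "c < 24" "d < 24"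
    and codes: "couple (i, j, C) = couple (codes ! a)" "couple (i, j, k # C) = couple (codes ! b)"
      "couple (i, k, C) = couple (codes ! c)" "couple (i, k, j # C) = couple (codes ! d)"
    using list_all2_nthD2[OF squares_sites n(1)] unfolding n(2) by (auto split: prod.splits)
  show "y ! a \<and> y ! b \<and> y ! c \<and> y ! d"
    using square[OF s site] ab cd unfolding y codes by (simp add: less)
qed

lemma squares_less: "(a, b, c, d) \<in> set squares \<Longrightarrow> a < 24 \<and> b < 24 \<and> c < 24 \<and> d < 24"
  by (auto simp: squares_def)

lemma below_step:
  assumes y: "gaussian y" and xy: "below x y"
  shows "below (step x) y"
proof -
  have len: "length x = 24" "length y = 24" using length_gaussian[OF y] xy by (auto simp: below_iff)
  have mono: "y ! n" if "x ! n" "n < 24" for n using xy that len by (auto simp: below_iff)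
  have "y ! n" if n: "n < 24" and st: "step x ! n" for n
  proof (cases "x ! n")
    case True
    then show ?thesis using mono n by blast
  next
    case False
    then obtain a b c d where sq: "(a, b, c, d) \<in> set squares" "n \<in> {a, b, c, d}"
        "x ! a \<or> x ! b" "x ! c \<or> x ! d"
      using st n by (auto simp: step_def list_ex_iff)
    have less: "a < 24" "b < 24" "c < 24" "d < 24" using squares_less[OF sq(1)] by auto
    then have "y ! a \<or> y ! b" "y ! c \<or> y ! d" using mono sq by blast+
    then show ?thesis using gaussian_square[OF y sq(1)] sq(2) by auto
  qed
  then show ?thesis using len by (simp add: below_iff step_def)
qed

text \<open>\<open>12|3, 13|4, 14|2 \<Longrightarrow> 12\<close>. Going once around the cycle multiplies \<open>s12\<close> by a product of three correlations,
each of absolute value less than 1.\<close>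

lemma cyclic_rule3:
  fixes d2 d3 d4 s12 s13 s14 s23 s24 s34 :: real
  assumes pos: "0 < d2" "0 < d3" "0 < d4"
    and m2: "s23\<^sup>2 < d2 * d3" "s24\<^sup>2 < d2 * d4" "s34\<^sup>2 < d3 * d4"
    and eq: "s12 * d3 = s13 * s23" "s13 * d4 = s14 * s34" "s14 * d2 = s12 * s24"
  shows "s12 = 0"
proof (rule ccontr)
  assume "s12 \<noteq> 0"
  have "s12 * (d2 * d3 * d4) = (s13 * d4) * s23 * d2" using eq(1) by Groebner_Basis.algebra
  also have "\<dots> = (s14 * d2) * s34 * s23" using eq(2) by Groebner_Basis.algebra
  also have "\<dots> = s12 * (s23 * s24 * s34)" using eq(3) by Groebner_Basis.algebra
  finally have "d2 * d3 * d4 = s23 * s24 * s34" using \<open>s12 \<noteq> 0\<close> by simp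
  then have "(d2 * d3) * ((d2 * d4) * (d3 * d4)) = s23\<^sup>2 * (s24\<^sup>2 * s34\<^sup>2)" by Groebner_Basis.algebra
  moreover have "s23\<^sup>2 * (s24\<^sup>2 * s34\<^sup>2) < (d2 * d3) * ((d2 * d4) * (d3 * d4))"
    using pos m2 by (intro mult_strict_mono mult_pos_pos) auto
  ultimately show False by simp
qed

text \<open>\<open>13|2, 14|3, 23|4, 24|1 \<Longrightarrow> 13\<close>, by the same contraction argument around a cycle of length four.\<close>

lemma cyclic_rule4:
  fixes d1 d2 d3 d4 s12 s13 s14 s23 s24 s34 :: real
  assumes pos: "0 < d1" "0 < d2" "0 < d3" "0 < d4"
    and m2: "s12\<^sup>2 < d1 * d2" "s34\<^sup>2 < d3 * d4"
    and eq: "s13 * d2 = s12 * s23" "s14 * d3 = s13 * s34" "s23 * d4 = s24 * s34" "s24 * d1 = s12 * s14"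
  shows "s13 = 0"
proof (rule ccontr)
  assume "s13 \<noteq> 0"
  have "s13 * ((d1 * d2) * (d3 * d4)) = s12 * (s23 * d4) * d1 * d3" using eq(1) by Groebner_Basis.algebra
  also have "\<dots> = s12 * s34 * (s24 * d1) * d3" using eq(3) by Groebner_Basis.algebra
  also have "\<dots> = s12\<^sup>2 * s34 * (s14 * d3)" using eq(4) by Groebner_Basis.algebra
  also have "\<dots> = s13 * (s12\<^sup>2 * s34\<^sup>2)" using eq(2) by Groebner_Basis.algebra
  finally have "(d1 * d2) * (d3 * d4) = s12\<^sup>2 * s34\<^sup>2" using \<open>s13 \<noteq> 0\<close> by simp
  moreover have "s12\<^sup>2 * s34\<^sup>2 < (d1 * d2) * (d3 * d4)"
    using pos m2 by (intro mult_strict_mono mult_pos_pos) auto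
  ultimately show False by simp
qed

text \<open>\<open>24, 13|2, 34|1, 12|34 \<Longrightarrow> 12\<close>. Eliminating \<open>s13\<close> and \<open>s34\<close> turns the last equation into \<open>s12\<close> times a
positive factor. For unit diagonal that factor is \<open>1 - s23\<^sup>2 (1 - s14\<^sup>2 (1 - s12\<^sup>2))\<close>.\<close>

lemma chain_rule:
  fixes d1 d2 d3 d4 s12 s13 s14 s23 s34 :: real
  assumes pos: "0 < d1" "0 < d2" "0 < d3" "0 < d4"
    and m2: "s12\<^sup>2 < d1 * d2" "s14\<^sup>2 < d1 * d4" "s23\<^sup>2 < d2 * d3"
    and eq: "s13 * d2 = s12 * s23" "s34 * d1 = s13 * s14"
      "s12 * (d3 * d4 - s34\<^sup>2) - s13 * s23 * d4 + s14 * s23 * s34 = 0"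
  shows "s12 = 0"
proof (rule ccontr)
  assume ne: "s12 \<noteq> 0"
  let ?K = "d1\<^sup>2 * d2 * d4 - s14\<^sup>2 * (d1 * d2 - s12\<^sup>2)"
  have s34: "s34 * d1 * d2 = s12 * s23 * s14" using eq(1,2) by Groebner_Basis.algebra
  \<comment> \<open>the factor \<open>(d1 * d2)\<^sup>2\<close> clears the denominators of the elimination\<close>
  have "0 = (d1 * d2)\<^sup>2 * (s12 * (d3 * d4 - s34\<^sup>2) - s13 * s23 * d4 + s14 * s23 * s34)"
    using eq(3) by simp
  also have "\<dots> = s12 * (d1 * d2)\<^sup>2 * (d3 * d4) - s12 * (s34 * d1 * d2)\<^sup>2
     - (s13 * d2) * d1\<^sup>2 * d2 * s23 * d4 + s14 * s23 * (s34 * d1 * d2) * d1 * d2"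
    by Groebner_Basis.algebra
  also have "\<dots> = s12 * ((d1 * d2)\<^sup>2 * (d3 * d4) - s23\<^sup>2 * ?K)"
    unfolding s34 eq(1) by Groebner_Basis.algebra
  finally have "s23\<^sup>2 * ?K = (d1 * d2)\<^sup>2 * (d3 * d4)" using ne by simp
  moreover have "s23\<^sup>2 * ?K \<le> s23\<^sup>2 * (d1\<^sup>2 * d2 * d4)"
    using m2(1) by (intro mult_left_mono) auto
  moreover have "s23\<^sup>2 * (d1\<^sup>2 * d2 * d4) < d2 * d3 * (d1\<^sup>2 * d2 * d4)"
    using m2(3) pos by (intro mult_strict_right_mono mult_pos_pos) auto
  moreover have "d2 * d3 * (d1\<^sup>2 * d2 * d4) = (d1 * d2)\<^sup>2 * (d3 * d4)" by Groebner_Basis.algebra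
  ultimately show False by linarith
qed

text \<open>\<open>12, 34|1, 34|2, 12|34 \<Longrightarrow> 34\<close>. For unit diagonal and \<open>s34 \<noteq> 0\<close>, eliminating \<open>s13\<close> and \<open>s24\<close> gives
\<open>(1 - s14\<^sup>2) (1 - s23\<^sup>2) = 1 - s34\<^sup>2\<close>, whereas \<open>s34 = s13 s14\<close> makes \<open>1 - s34\<^sup>2\<close> larger than \<open>1 - s14\<^sup>2\<close>.\<close>

lemma crossed_pairs_rule:
  fixes d1 d2 d3 d4 s13 s14 s23 s24 s34 :: real
  assumes pos: "0 < d1" "0 < d2" "0 < d3" "0 < d4"
    and m2: "s13\<^sup>2 < d1 * d3" "s14\<^sup>2 < d1 * d4" "s23\<^sup>2 < d2 * d3"
    and eq: "s34 * d1 = s13 * s14" "s34 * d2 = s23 * s24"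
      "s14 * (s23 * s34 - d3 * s24) = s13 * (s23 * d4 - s34 * s24)"
  shows "s34 = 0"
proof (rule ccontr)
  assume ne: "s34 \<noteq> 0"
  then have b: "s14 \<noteq> 0" using eq(1) pos(1) by auto
  have "s34 * (d1 * d2 * s34\<^sup>2 + s14\<^sup>2 * s23\<^sup>2 - d1 * d4 * s23\<^sup>2 - d2 * d3 * s14\<^sup>2) =
     (s34 * d1) * (s34 * d2) * s34 + s34 * s14\<^sup>2 * s23\<^sup>2 - (s34 * d1) * d4 * s23\<^sup>2
     - (s34 * d2) * d3 * s14\<^sup>2" by Groebner_Basis.algebra
  also have "\<dots> = s14 * s23 * (s14 * (s23 * s34 - d3 * s24) - s13 * (s23 * d4 - s34 * s24))"
    unfolding eq(1,2) by Groebner_Basis.algebra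
  also have "\<dots> = 0" using eq(3) by simp
  finally have *: "d1 * d2 * s34\<^sup>2 + s14\<^sup>2 * s23\<^sup>2 = d1 * d4 * s23\<^sup>2 + d2 * d3 * s14\<^sup>2"
    using ne by simp
  have "s13\<^sup>2 * s14\<^sup>2 < d1 * d3 * s14\<^sup>2"
    using m2(1) b by (intro mult_strict_right_mono) auto
  moreover have "s13\<^sup>2 * s14\<^sup>2 = d1 * (d1 * s34\<^sup>2)" using eq(1) by Groebner_Basis.algebra
  ultimately have "d1 * (d1 * s34\<^sup>2) < d1 * (d3 * s14\<^sup>2)" by (simp add: mult.assoc)
  then have "d1 * s34\<^sup>2 < d3 * s14\<^sup>2" using pos(1) by simp
  then have "d2 * (d1 * s34\<^sup>2) < d2 * (d3 * s14\<^sup>2)" using pos(2) by simp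
  moreover have "s14\<^sup>2 * s23\<^sup>2 \<le> d1 * d4 * s23\<^sup>2"
    using m2(2) by (intro mult_right_mono) auto
  ultimately show False using * by (simp add: algebra_simps)
qed

text \<open>\<open>13, 24, 14|23, 23|14 \<Longrightarrow> 14\<close>. For unit diagonal and \<open>s14 \<noteq> 0\<close> the two equations force \<open>s23\<^sup>2 = s14\<^sup>2\<close> and
then \<open>s12\<^sup>2 s34\<^sup>2 = (1 - s14\<^sup>2)\<^sup>2\<close>; but positivity of the minors on \<open>124\<close> and \<open>134\<close> bounds both \<open>s12\<^sup>2\<close> and
\<open>s34\<^sup>2\<close> strictly by \<open>1 - s14\<^sup>2\<close>.\<close>

lemma four_cycle_rule:
  fixes d1 d2 d3 d4 s12 s14 s23 s34 :: real
  assumes pos: "0 < d1" "0 < d2" "0 < d3" "0 < d4"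
    and m: "s14\<^sup>2 < d1 * d4" "d4 * s12\<^sup>2 < d2 * (d1 * d4 - s14\<^sup>2)" "d1 * s34\<^sup>2 < d3 * (d1 * d4 - s14\<^sup>2)"
    and eq: "s14 * (d2 * d3 - s23\<^sup>2) = - (s12 * s23 * s34)" "s23 * (d1 * d4 - s14\<^sup>2) = - (s12 * s14 * s34)"
  shows "s14 = 0"
proof (rule ccontr)
  assume ne: "s14 \<noteq> 0"
  let ?M = "d1 * d4 - s14\<^sup>2"
  \<comment> \<open>multiply the equations by \<open>s14\<close> and \<open>s23\<close>; their right-hand sides then agree\<close>
  have sq: "s14\<^sup>2 * (d2 * d3) = s23\<^sup>2 * (d1 * d4)" using eq by Groebner_Basis.algebra
  have "(d4 * s12\<^sup>2) * (d1 * s34\<^sup>2) < (d2 * ?M) * (d3 * ?M)"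
    using m pos by (intro mult_strict_mono[OF m(2,3)]) (auto intro!: mult_pos_pos)
  then have "(d4 * s12\<^sup>2) * (d1 * s34\<^sup>2) * s14\<^sup>2 < (d2 * ?M) * (d3 * ?M) * s14\<^sup>2"
    using ne by (intro mult_strict_right_mono) auto
  moreover have "(d2 * ?M) * (d3 * ?M) * s14\<^sup>2 = (s14\<^sup>2 * (d2 * d3)) * ?M\<^sup>2" by Groebner_Basis.algebra
  moreover have "\<dots> = (d1 * d4) * (s23 * ?M)\<^sup>2" unfolding sq by Groebner_Basis.algebra
  moreover have "\<dots> = (d4 * s12\<^sup>2) * (d1 * s34\<^sup>2) * s14\<^sup>2" unfolding eq(2) by Groebner_Basis.algebra
  ultimately show False by linarith
qed

text \<open>The five rules with one conclusion, for one labelling of the indices; the others are obtained by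
\<open>act\<close>.\<close>

definition horn_clauses :: "(nat list \<times> nat) list" where
  "horn_clauses =
   [([6,9,10],0), ([8,11,13,14],1), ([4,8,16,18],0), ([0,16,17,18],5), ([1,4,20,21],2)]"

text \<open>Weak transitivity for the pair 12 and the index 3, without and with conditioning on 4. The
conclusion is a disjunction.\<close>

definition weak_clauses :: "(nat list \<times> nat \<times> nat) list" where
  "weak_clauses =
   [([0,6],1,3), ([7,18],9,13)]"

lemma gaussian_weak:
  assumes y: "gaussian y" and cl: "(P, q, r) \<in> set weak_clauses" and P: "\<forall>n\<in>set P. y ! n"
  shows "y ! q \<or> y ! r"
proof -
  obtain s where s: "posdef s" and y: "y = bits (ci_relation s)" using y by (auto simp: gaussian_def)
  have wt: "couple (1, 3, C) \<in> ci_relation s \<or> couple (2, 3, C) \<in> ci_relation s"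
    if "couple (1, 2, C) \<in> ci_relation s" "couple (1, 2, 3 # C) \<in> ci_relation s"
       "C = [] \<or> C = [4]" for C
    using that by (intro weak_transitivity[OF s]) auto
  show ?thesis
    using cl P wt[of "[]"] wt[of "[4]"]
    by (auto simp: weak_clauses_def y codes_def couple_def)
qed

lemma gaussian_horn:
  assumes y: "gaussian y" and cl: "(P, q) \<in> set horn_clauses" and P: "\<forall>n\<in>set P. y ! n"
  shows "y ! q"
proof -
  obtain s where s: "posdef s" and y: "y = bits (ci_relation s)" using y by (auto simp: gaussian_def)
  have sy: "s 2 1 = s 1 2" "s 3 1 = s 1 3" "s 4 1 = s 1 4" "s 3 2 = s 2 3" "s 4 2 = s 2 4" "s 4 3 = s 3 4"
    using posdef_sym[OF s] by auto
  note sy = sy[simplified]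
  have pos: "0 < s 1 1" "0 < s 2 2" "0 < s 3 3" "0 < s 4 4"
    and m2: "(s 1 2)\<^sup>2 < s 1 1 * s 2 2" "(s 1 3)\<^sup>2 < s 1 1 * s 3 3" "(s 1 4)\<^sup>2 < s 1 1 * s 4 4"
      "(s 2 3)\<^sup>2 < s 2 2 * s 3 3" "(s 2 4)\<^sup>2 < s 2 2 * s 4 4" "(s 3 4)\<^sup>2 < s 3 3 * s 4 4"
    using minor2_pos[OF s, of 1 2] minor2_pos[OF s, of 1 3] minor2_pos[OF s, of 1 4]
      minor2_pos[OF s, of 2 3] minor2_pos[OF s, of 2 4] minor2_pos[OF s, of 3 4] by simp_all
  have m3: "s 4 4 * (s 1 2)\<^sup>2 < s 2 2 * (s 1 1 * s 4 4 - (s 1 4)\<^sup>2)" if "s 2 4 = 0"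
    using minor3_pos[OF s, of 1 2 4] that by (simp add: algebra_simps)
  have m3': "s 1 1 * (s 3 4)\<^sup>2 < s 3 3 * (s 1 1 * s 4 4 - (s 1 4)\<^sup>2)" if "s 1 3 = 0"
    using minor3_pos[OF s, of 1 3 4] that by (simp add: algebra_simps)
  have ys: "y = map (\<lambda>(i, j, C). apm s i j C = 0) codes"
    unfolding y by (rule bits_ci_relation[OF s])
  consider "P = [6,9,10] \<and> q = 0" | "P = [8,11,13,14] \<and> q = 1" | "P = [4,8,16,18] \<and> q = 0"
    | "P = [0,16,17,18] \<and> q = 5" | "P = [1,4,20,21] \<and> q = 2"
    using cl by (auto simp: horn_clauses_def)
  then show ?thesis
  proof cases
    case 1
    then have "s 1 2 = 0"
      using P by (intro cyclic_rule3[OF pos(2,3,4) m2(4,5,6), of _ "s 1 3" "s 1 4"])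
        (simp_all add: ys codes_def sy)
    then show ?thesis using 1 by (simp add: ys codes_def)
  next
    case 2
    then have "s 1 3 = 0"
      using P by (intro cyclic_rule4[OF pos m2(1,6), of _ "s 2 3" "s 1 4" "s 2 4"])
        (simp_all add: ys codes_def sy)
    then show ?thesis using 2 by (simp add: ys codes_def)
  next
    case 3
    then have 0: "s 2 4 = 0" using P by (simp add: ys codes_def)
    have "s 1 2 = 0"
      using P 3 by (intro chain_rule[OF pos m2(1,3,4), of "s 1 3" "s 3 4"])
        (simp_all add: ys codes_def sy 0 0[simplified] power2_eq_square algebra_simps)
    then show ?thesis using 3 by (simp add: ys codes_def)
  next
    case 4
    then have 0: "s 1 2 = 0" using P by (simp add: ys codes_def)
    have "s 3 4 = 0"
      using P 4 by (intro crossed_pairs_rule[OF pos m2(2,3,4), of _ "s 2 4"])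
        (simp_all add: ys codes_def sy 0 0[simplified] power2_eq_square algebra_simps)
    then show ?thesis using 4 by (simp add: ys codes_def)
  next
    case 5
    then have 0: "s 1 3 = 0" "s 2 4 = 0" using P by (simp_all add: ys codes_def)
    have "s 1 4 = 0"
      using P 5 by (intro four_cycle_rule[OF pos m2(3) m3[OF 0(2)] m3'[OF 0(1)], of "s 2 3"])
        (simp_all add: ys codes_def sy 0 0[simplified] power2_eq_square algebra_simps)
    then show ?thesis using 5 by (simp add: ys codes_def)
  qed
qed

section \<open>Derivations from the inference rules\<close>

definition bit_vector :: "nat list \<Rightarrow> bool list" where
  "bit_vector ns = map (\<lambda>n. n \<in> set ns) [0..<24]"

lemma length_bit_vector [simp]: "length (bit_vector ns) = 24"
  by (simp add: bit_vector_def)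

lemma bit_vector_nth [simp]: "n < 24 \<Longrightarrow> bit_vector ns ! n \<longleftrightarrow> n \<in> set ns"
  by (simp add: bit_vector_def)

definition join :: "bool list \<Rightarrow> bool list \<Rightarrow> bool list" where
  "join x y = map2 (\<or>) x y"

lemma below_join: "below x z \<Longrightarrow> below y z \<Longrightarrow> below (join x y) z"
  by (auto simp: below_iff join_def)

lemma below_trans: "below x y \<Longrightarrow> below y z \<Longrightarrow> below x z"
  by (auto simp: below_iff)

text \<open>A relabelled clause holds in \<open>y\<close> because the original one holds in the oppositely relabelled \<open>y\<close>, which
is Gaussian too.\<close>

lemma transport_clause:
  assumes k: "k < 24" and y: "gaussian y" and P: "set P \<subseteq> {..<24}"
    and prem: "below (act k (bit_vector P)) y"
  obtains z where "gaussian z" "\<forall>n\<in>set P. z ! n"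
    "\<And>n. n < 24 \<Longrightarrow> z ! n \<Longrightarrow> below (act k (bit_vector [n])) y"
proof -
  obtain l where l: "l < 24" "\<And>x. length x = 24 \<Longrightarrow> act k (act l x) = x"
    "\<And>x. length x = 24 \<Longrightarrow> act l (act k x) = x" using act_inverse[OF k] by metis
  have len: "length y = 24" "length (act l y) = 24"
    using length_gaussian[OF y] length_act[OF l(1)] by auto
  have "below (act l (act k (bit_vector P))) (act l y)"
    using act_below[OF l(1) prem] length_act[OF k] by simp
  then have "below (bit_vector P) (act l y)" using l(3)[of "bit_vector P"] by simp
  then have "\<forall>n\<in>set P. act l y ! n" using P by (auto simp: below_iff)
  moreover have "below (act k (bit_vector [n])) y" if "n < 24" "act l y ! n" for n
  proof -
    have "below (bit_vector [n]) (act l y)" using that len by (simp add: below_iff)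
    then have "below (act k (bit_vector [n])) (act k (act l y))" by (intro act_below[OF k]) simp_all
    then show ?thesis using l(2)[OF len(1)] by simp
  qed
  ultimately show ?thesis using that gaussian_act[OF l(1) y] by blast
qed

definition horn_premise :: "nat \<Rightarrow> bool list" where
  "horn_premise r = bit_vector (fst (horn_clauses ! r))"
definition horn_conclusion :: "nat \<Rightarrow> bool list" where
  "horn_conclusion r = bit_vector [snd (horn_clauses ! r)]"
definition weak_premise :: "nat \<Rightarrow> bool list" where
  "weak_premise r = bit_vector (fst (weak_clauses ! r))"
definition weak_left :: "nat \<Rightarrow> bool list" where
  "weak_left r = bit_vector [fst (snd (weak_clauses ! r))]"
definition weak_right :: "nat \<Rightarrow> bool list" where
  "weak_right r = bit_vector [snd (snd (weak_clauses ! r))]"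

lemma horn_act:
  assumes "r < 5" "k < 24" "gaussian y" "below (act k (horn_premise r)) y"
  shows "below (act k (horn_conclusion r)) y"
proof -
  obtain P q where Pq: "horn_clauses ! r = (P, q)" by (cases "horn_clauses ! r")
  have mem: "(P, q) \<in> set horn_clauses"
    using assms(1) Pq nth_mem[of r horn_clauses] by (simp add: horn_clauses_def)
  then have P: "set P \<subseteq> {..<24}" "q < 24" by (auto simp: horn_clauses_def)
  obtain z where z: "gaussian z" "\<forall>n\<in>set P. z ! n"
    "\<And>n. n < 24 \<Longrightarrow> z ! n \<Longrightarrow> below (act k (bit_vector [n])) y"
    using transport_clause[OF assms(2,3) P(1)] assms(4) by (auto simp: horn_premise_def Pq)
  show ?thesis using z(3)[OF P(2) gaussian_horn[OF z(1) mem z(2)]] by (simp add: horn_conclusion_def Pq)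
qed

lemma weak_act:
  assumes "r < 2" "k < 24" "gaussian y" "below (act k (weak_premise r)) y"
  shows "below (act k (weak_left r)) y \<or> below (act k (weak_right r)) y"
proof -
  obtain P p q where Pq: "weak_clauses ! r = (P, p, q)" by (cases "weak_clauses ! r")
  have mem: "(P, p, q) \<in> set weak_clauses"
    using assms(1) Pq nth_mem[of r weak_clauses] by (simp add: weak_clauses_def)
  then have P: "set P \<subseteq> {..<24}" "p < 24" "q < 24" by (auto simp: weak_clauses_def)
  obtain z where z: "gaussian z" "\<forall>n\<in>set P. z ! n"
    "\<And>n. n < 24 \<Longrightarrow> z ! n \<Longrightarrow> below (act k (bit_vector [n])) y"
    using transport_clause[OF assms(2,3) P(1)] assms(4) by (auto simp: weak_premise_def Pq)
  show ?thesis using z(3) P(2,3) gaussian_weak[OF z(1) mem z(2)]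
    by (auto simp: weak_left_def weak_right_def Pq)
qed

text \<open>Every node first applies \<open>n\<close> rounds of the square rule, where \<open>n\<close> is its first argument. Then \<open>Done\<close>
compares with the goal, \<open>Use\<close> applies Horn clause \<open>r\<close>, relabelled by permutation \<open>m\<close>, and \<open>Split\<close> distinguishes the two conclusions of
such a weak transitivity clause.\<close>

datatype derivation =
    Done nat
  | Use nat nat nat derivation
  | Split nat nat nat derivation derivation

fun derives :: "derivation \<Rightarrow> bool list \<Rightarrow> nat \<Rightarrow> bool list \<Rightarrow> bool" where
  "derives (Done n) x k t \<longleftrightarrow> below t (act k ((step ^^ n) x))"
| "derives (Use n r m d) x k t \<longleftrightarrow> r < 5 \<and> m < 24 \<and>
     below (act m (horn_premise r)) ((step ^^ n) x) \<and>
     derives d (join ((step ^^ n) x) (act m (horn_conclusion r))) k t"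
| "derives (Split n r m d e) x k t \<longleftrightarrow> r < 2 \<and> m < 24 \<and>
     below (act m (weak_premise r)) ((step ^^ n) x) \<and>
     derives d (join ((step ^^ n) x) (act m (weak_left r))) k t \<and>
     derives e (join ((step ^^ n) x) (act m (weak_right r))) k t"

lemma below_steps:
  assumes "gaussian y" "below x y"
  shows "below ((step ^^ n) x) y"
  by (induction n) (use assms below_step in auto)

text \<open>All branches aim at the same \<open>t\<close> and the same relabelling \<open>k\<close>, so that the conclusion can later be
intersected over all Gaussian \<open>y\<close> above \<open>x\<close>.\<close>

lemma derives_sound:
  assumes y: "gaussian y" and k: "k < 24"
  shows "below x y \<Longrightarrow> derives d x k t \<Longrightarrow> below t (act k y)"
proof (induction d arbitrary: x)
  case (Done n)
  have b: "below ((step ^^ n) x) y" using below_steps[OF y Done.prems(1)] .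
  then have "length ((step ^^ n) x) = 24" using length_gaussian[OF y] by (simp add: below_iff)
  then show ?case using Done.prems(2) act_below[OF k b] by (auto intro: below_trans)
next
  case (Use n r m d)
  have b: "below ((step ^^ n) x) y" using below_steps[OF y Use.prems(1)] .
  have "below (act m (horn_conclusion r)) y"
    using Use.prems(2) b by (intro horn_act[OF _ _ y]) (auto intro: below_trans)
  then show ?case using Use.prems(2) by (intro Use.IH[OF below_join[OF b]]) auto
next
  case (Split n r m d e)
  have b: "below ((step ^^ n) x) y" using below_steps[OF y Split.prems(1)] .
  have "below (act m (weak_left r)) y \<or> below (act m (weak_right r)) y"
    using Split.prems(2) b by (intro weak_act[OF _ _ y]) (auto intro: below_trans)
  then show ?case
  proof
    assume "below (act m (weak_left r)) y"
    then show ?thesis using Split.prems(2) by (intro Split.IH(1)[OF below_join[OF b]]) auto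
  next
    assume "below (act m (weak_right r)) y"
    then show ?thesis using Split.prems(2) by (intro Split.IH(2)[OF below_join[OF b]]) auto
  qed
qed

text \<open>All lists that arise by turning a single \<open>False\<close> into \<open>True\<close>, in increasing order of the position.\<close>

fun extensions :: "bool list \<Rightarrow> bool list list" where
  "extensions [] = []"
| "extensions (True # x) = map ((#) True) (extensions x)"
| "extensions (False # x) = (True # x) # map ((#) False) (extensions x)"

lemma extensions_update: "n < length x \<Longrightarrow> \<not> x ! n \<Longrightarrow> x[n := True] \<in> set (extensions x)"
proof (induction x arbitrary: n rule: extensions.induct)
  case (2 x)
  then show ?case by (cases n) auto
next
  case (3 x)
  then show ?case by (cases n) auto
qed simp

text \<open>One relation from each class, as the list of its couples in the numbering of \<open>codes\<close>. The list is
ordered by cardinality, hence a relation that properly contains a copy of another one comes later.\<close>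

definition representatives :: "nat list list" where
  "representatives =
   [[], [5], [17], [23], [2,3], [5,7], [5,14], [5,17], [5,18], [5,22], [5,23], [11,13], [15,16],
    [16,17], [17,18], [17,22], [17,23], [20,21], [2,3,13], [2,3,21], [2,3,23], [5,6,7], [5,7,12],
    [5,7,17], [5,7,18], [5,7,22], [5,7,23], [5,10,12], [5,14,17], [5,14,18], [5,14,19], [5,14,20],
    [5,14,22], [5,16,17], [5,17,18], [5,17,22], [5,17,23], [5,18,23], [5,20,21], [11,12,13],
    [11,13,14], [11,13,21], [11,13,23], [15,16,19], [15,16,23], [16,17,18], [16,17,23],
    [17,18,23], [2,3,11,13], [2,3,20,21], [4,5,15,17], [5,7,17,18], [5,10,12,18], [5,14,17,22],
    [5,16,17,23], [10,11,12,13], [11,13,20,21], [14,16,22,23], [2,3,12,13,21], [4,5,12,15,17],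
    [4,5,15,16,17], [4,5,15,17,21], [4,5,15,17,23], [5,7,16,17,23], [5,12,14,21,22],
    [5,14,16,22,23], [5,16,17,18,23], [13,14,16,22,23], [14,16,17,22,23], [2,3,11,12,13,21],
    [3,4,5,13,15,17], [4,5,12,15,17,21], [4,5,15,16,17,23], [5,7,16,17,18,23], [5,12,14,17,21,22],
    [5,14,16,17,22,23], [12,14,16,21,22,23], [2,3,5,11,13,16,17], [4,5,8,15,17,19,23],
    [11,12,14,15,20,21,22], [2,3,5,11,13,16,17,23], [2,3,10,11,12,13,20,21],
    [3,4,5,13,15,16,17,23], [4,5,8,15,16,17,19,23], [4,5,12,15,16,17,21,23],
    [4,5,14,15,16,17,22,23], [5,10,12,16,17,20,21,23], [5,12,14,16,17,21,22,23],
    [2,3,5,11,12,13,16,17,21,23], [3,4,5,13,14,15,16,17,22,23], [4,5,8,14,15,16,17,19,22,23],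
    [4,5,12,14,15,16,17,21,22,23], [2,3,5,10,11,12,13,16,17,20,21,23],
    [2,4,5,10,11,14,15,16,17,20,22,23], [3,4,5,12,13,14,15,16,17,21,22,23],
    [2,3,4,5,10,11,13,14,15,16,17,20,22,23], [2,4,5,10,11,12,14,15,16,17,20,21,22,23],
    [1,2,3,4,8,9,10,11,12,13,14,15,19,20,21,22], [2,3,4,5,10,11,12,13,14,15,16,17,20,21,22,23],
    [1,2,3,4,5,8,9,10,11,12,13,14,15,16,17,19,20,21,22,23],
    [0,1,2,3,4,5,6,7,8,9,10,11,12,13,14,15,16,17,18,19,20,21,22,23]]"

definition rep :: "nat \<Rightarrow> bool list" where
  "rep j = bit_vector (representatives ! j)"

text \<open>For every couple missing from representative \<open>j\<close>, the list \<open>ds\<close> names a later representative \<open>i\<close>, a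
relabelling \<open>k\<close>, and a derivation which shows that \<open>i\<close> is contained, after relabelling by \<open>k\<close>, in all
Gaussian relations that contain \<open>j\<close> and that couple.\<close>

definition climbs :: "nat \<Rightarrow> (nat \<times> nat \<times> derivation) list \<Rightarrow> bool" where
  "climbs j ds \<longleftrightarrow> list_all2 (\<lambda>x (i, k, d). j < i \<and> i < 101 \<and> k < 24 \<and> derives d x k (rep i))
     (extensions (rep j)) ds"

text \<open>A derivation speaks about Gaussian relations. It applies to the complete \<open>x\<close> as well: a couple
missing from \<open>act k x\<close> would be missing from some Gaussian relation above it.\<close>

lemma climb:
  assumes j: "climbs j ds" and x: "complete_bits x" and le: "below (rep j) x" and ne: "rep j \<noteq> x"
  obtains i k where "j < i" "i < 101" "k < 24" "below (rep i) (act k x)"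
proof -
  have len: "length x = 24" "length (rep j) = 24" using x by (simp_all add: complete_bits_def rep_def)
  obtain n where n: "n < 24" "\<not> rep j ! n" "x ! n"
  proof -
    have "\<exists>n<24. rep j ! n \<noteq> x ! n" using nth_equalityI[of "rep j" x] ne len by auto
    then show ?thesis using that le len by (auto simp: below_iff)
  qed
  let ?x' = "(rep j)[n := True]"
  have "?x' \<in> set (extensions (rep j))" using n len by (intro extensions_update) simp_all
  then obtain m where m: "m < length (extensions (rep j))" "extensions (rep j) ! m = ?x'"
    by (auto simp: in_set_conv_nth)
  obtain i k d where ikd: "ds ! m = (i, k, d)" by (cases "ds ! m")
  have d: "j < i" "i < 101" "k < 24" "derives d ?x' k (rep i)"
    using list_all2_nthD[OF j[unfolded climbs_def] m(1)] by (simp_all add: m(2) ikd)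
  have le': "below ?x' x" using le n len by (auto simp: below_iff nth_list_update)
  have "below (rep i) (act k x)"
  proof (rule ccontr)
    assume "\<not> below (rep i) (act k x)"
    then obtain a where a: "a < 24" "rep i ! a" "\<not> act k x ! a"
      using length_act[OF d(3)] by (auto simp: below_iff rep_def)
    obtain y where y: "gaussian y" "below (act k x) y" "\<not> y ! a"
      using complete_bits_act[OF d(3) x] a by (auto simp: complete_bits_def)
    \<comment> \<open>the derivation is about \<open>x\<close>, so \<open>y\<close> is moved back by the inverse relabelling\<close>
    obtain l where l: "l < 24" "\<And>x. length x = 24 \<Longrightarrow> act k (act l x) = x"
      "\<And>x. length x = 24 \<Longrightarrow> act l (act k x) = x" using act_inverse[OF d(3)] by metis
    have "below (act l (act k x)) (act l y)"
      using y(2) length_act[OF d(3)] by (intro act_below[OF l(1)]) simp_all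
    then have "below ?x' (act l y)" using l(3)[OF len(1)] le' by (auto intro: below_trans)
    then have "below (rep i) (act k (act l y))"
      using derives_sound[OF gaussian_act[OF l(1) y(1)] d(3)] d(4) by blast
    then have "below (rep i) y" using l(2)[OF length_gaussian[OF y(1)]] by simp
    then show False using a y(3) by (auto simp: below_iff rep_def)
  qed
  then show ?thesis using that d by blast
qed

section \<open>Checking the derivations\<close>

lemma zero_less_one_nat: "(0::nat) < 1"
  by simp

text \<open>The derivations are checked by rewriting with exactly the equations collected here. Lists of
length 24 are matched in a single step, so that each relabelling and each closure round is one rewrite
followed by Boolean simplification.\<close>

lemmas num_eval = zero_less_one_nat numeral_le_iff le_num_simps numeral_eq_iff num.distinct num.inject eq_num_simps
  zero_neq_numeral numeral_neq_zero one_eq_numeral_iff numeral_eq_one_iff zero_neq_one one_neq_zero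
  numeral_less_iff less_num_simps zero_less_numeral one_less_numeral_iff zero_less_one
  not_numeral_less_zero not_numeral_less_one less_irrefl

lemma upt_eval:
  "[0..<24] = [0,1,2,3,4,5,6,7,8,9,10,11,12,13,14,15,16,17,18,19,20,21,22,23]"
  "[0..<101] = [0, 1, 2, 3, 4, 5, 6, 7, 8, 9, 10, 11, 12, 13, 14, 15, 16, 17, 18, 19, 20, 21, 22, 23, 24, 25,
    26, 27, 28, 29, 30, 31, 32, 33, 34, 35, 36, 37, 38, 39, 40, 41, 42, 43, 44, 45, 46, 47, 48,
    49, 50, 51, 52, 53, 54, 55, 56, 57, 58, 59, 60, 61, 62, 63, 64, 65, 66, 67, 68, 69, 70, 71,
    72, 73, 74, 75, 76, 77, 78, 79, 80, 81, 82, 83, 84, 85, 86, 87, 88, 89, 90, 91, 92, 93, 94,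
    95, 96, 97, 98, 99, 100]"
  by (simp_all add: upt_conv_Cons)

lemma nth_eval:
"[x0,x1,x2,x3,x4,x5,x6,x7,x8,x9,x10,x11,x12,x13,x14,x15,x16,x17,x18,x19,x20,x21,x22,x23] ! 0 = x0"
  "[x0,x1,x2,x3,x4,x5,x6,x7,x8,x9,x10,x11,x12,x13,x14,x15,x16,x17,x18,x19,x20,x21,x22,x23] ! 1 = x1"
  "[x0,x1,x2,x3,x4,x5,x6,x7,x8,x9,x10,x11,x12,x13,x14,x15,x16,x17,x18,x19,x20,x21,x22,x23] ! 2 = x2"
  "[x0,x1,x2,x3,x4,x5,x6,x7,x8,x9,x10,x11,x12,x13,x14,x15,x16,x17,x18,x19,x20,x21,x22,x23] ! 3 = x3"
  "[x0,x1,x2,x3,x4,x5,x6,x7,x8,x9,x10,x11,x12,x13,x14,x15,x16,x17,x18,x19,x20,x21,x22,x23] ! 4 = x4"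
  "[x0,x1,x2,x3,x4,x5,x6,x7,x8,x9,x10,x11,x12,x13,x14,x15,x16,x17,x18,x19,x20,x21,x22,x23] ! 5 = x5"
  "[x0,x1,x2,x3,x4,x5,x6,x7,x8,x9,x10,x11,x12,x13,x14,x15,x16,x17,x18,x19,x20,x21,x22,x23] ! 6 = x6"
  "[x0,x1,x2,x3,x4,x5,x6,x7,x8,x9,x10,x11,x12,x13,x14,x15,x16,x17,x18,x19,x20,x21,x22,x23] ! 7 = x7"
  "[x0,x1,x2,x3,x4,x5,x6,x7,x8,x9,x10,x11,x12,x13,x14,x15,x16,x17,x18,x19,x20,x21,x22,x23] ! 8 = x8"
  "[x0,x1,x2,x3,x4,x5,x6,x7,x8,x9,x10,x11,x12,x13,x14,x15,x16,x17,x18,x19,x20,x21,x22,x23] ! 9 = x9"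
  "[x0,x1,x2,x3,x4,x5,x6,x7,x8,x9,x10,x11,x12,x13,x14,x15,x16,x17,x18,x19,x20,x21,x22,x23] ! 10 = x10"
  "[x0,x1,x2,x3,x4,x5,x6,x7,x8,x9,x10,x11,x12,x13,x14,x15,x16,x17,x18,x19,x20,x21,x22,x23] ! 11 = x11"
  "[x0,x1,x2,x3,x4,x5,x6,x7,x8,x9,x10,x11,x12,x13,x14,x15,x16,x17,x18,x19,x20,x21,x22,x23] ! 12 = x12"
  "[x0,x1,x2,x3,x4,x5,x6,x7,x8,x9,x10,x11,x12,x13,x14,x15,x16,x17,x18,x19,x20,x21,x22,x23] ! 13 = x13"
  "[x0,x1,x2,x3,x4,x5,x6,x7,x8,x9,x10,x11,x12,x13,x14,x15,x16,x17,x18,x19,x20,x21,x22,x23] ! 14 = x14"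
  "[x0,x1,x2,x3,x4,x5,x6,x7,x8,x9,x10,x11,x12,x13,x14,x15,x16,x17,x18,x19,x20,x21,x22,x23] ! 15 = x15"
  "[x0,x1,x2,x3,x4,x5,x6,x7,x8,x9,x10,x11,x12,x13,x14,x15,x16,x17,x18,x19,x20,x21,x22,x23] ! 16 = x16"
  "[x0,x1,x2,x3,x4,x5,x6,x7,x8,x9,x10,x11,x12,x13,x14,x15,x16,x17,x18,x19,x20,x21,x22,x23] ! 17 = x17"
  "[x0,x1,x2,x3,x4,x5,x6,x7,x8,x9,x10,x11,x12,x13,x14,x15,x16,x17,x18,x19,x20,x21,x22,x23] ! 18 = x18"
  "[x0,x1,x2,x3,x4,x5,x6,x7,x8,x9,x10,x11,x12,x13,x14,x15,x16,x17,x18,x19,x20,x21,x22,x23] ! 19 = x19"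
  "[x0,x1,x2,x3,x4,x5,x6,x7,x8,x9,x10,x11,x12,x13,x14,x15,x16,x17,x18,x19,x20,x21,x22,x23] ! 20 = x20"
  "[x0,x1,x2,x3,x4,x5,x6,x7,x8,x9,x10,x11,x12,x13,x14,x15,x16,x17,x18,x19,x20,x21,x22,x23] ! 21 = x21"
  "[x0,x1,x2,x3,x4,x5,x6,x7,x8,x9,x10,x11,x12,x13,x14,x15,x16,x17,x18,x19,x20,x21,x22,x23] ! 22 = x22"
  "[x0,x1,x2,x3,x4,x5,x6,x7,x8,x9,x10,x11,x12,x13,x14,x15,x16,x17,x18,x19,x20,x21,x22,x23] ! 23 = x23"
  by simp_all

lemma act_map: "map (\<lambda>k. act k x) [0..<24] = map (map ((!) x)) action_table"
proof -
  have "map (\<lambda>k. act k x) [0..<24] = map (map ((!) x)) (map ((!) action_table) [0..<length action_table])"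
    by (simp add: act_def length_tables)
  then show ?thesis by (simp only: map_nth)
qed

lemmas act_eval = act_map[of "[x0,x1,x2,x3,x4,x5,x6,x7,x8,x9,x10,x11,x12,x13,x14,x15,x16,x17,x18,x19,x20,x21,x22,x23]" for x0 x1 x2 x3 x4 x5 x6 x7 x8 x9 x10 x11 x12 x13 x14 x15 x16 x17 x18 x19 x20 x21 x22 x23,
  unfolded action_table_def, simplified upt_eval list.map list.inject nth_eval simp_thms]

lemmas step_eval = step_def[of "[x0,x1,x2,x3,x4,x5,x6,x7,x8,x9,x10,x11,x12,x13,x14,x15,x16,x17,x18,x19,x20,x21,x22,x23]" for x0 x1 x2 x3 x4 x5 x6 x7 x8 x9 x10 x11 x12 x13 x14 x15 x16 x17 x18 x19 x20 x21 x22 x23,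
  unfolded squares_def, simplified upt_eval list.map list_ex_Nil_iff list_ex_Cons_iff prod.case insert_iff empty_iff
    num_eval nth_eval simp_thms]

lemma length_representatives: "length representatives = 101"
  by (simp add: representatives_def)

lemma rep_map: "map rep [0..<101] = map bit_vector representatives"
proof -
  have "map rep [0..<length representatives] = map bit_vector (map ((!) representatives) [0..<length representatives])"
    by (simp only: rep_def[abs_def] map_map o_def)
  also have "\<dots> = map bit_vector representatives" by (simp only: map_nth)
  finally show ?thesis by (simp only: length_representatives)
qed

lemmas rep_eval = rep_map[unfolded representatives_def bit_vector_def, simplified upt_eval list.map list.inject
  list.set insert_iff empty_iff num_eval simp_thms]

lemma clause_eval:
  "horn_premise 0 = bit_vector [6,9,10]" "horn_premise 1 = bit_vector [8,11,13,14]" "horn_premise 2 = bit_vector [4,8,16,18]"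
  "horn_premise 3 = bit_vector [0,16,17,18]" "horn_premise 4 = bit_vector [1,4,20,21]"
  "horn_conclusion 0 = bit_vector [0]" "horn_conclusion 1 = bit_vector [1]" "horn_conclusion 2 = bit_vector [0]"
  "horn_conclusion 3 = bit_vector [5]" "horn_conclusion 4 = bit_vector [2]"
  "weak_premise 0 = bit_vector [0,6]" "weak_premise 1 = bit_vector [7,18]"
  "weak_left 0 = bit_vector [1]" "weak_left 1 = bit_vector [9]" "weak_right 0 = bit_vector [3]" "weak_right 1 = bit_vector [13]"
  by (simp_all add: horn_premise_def horn_conclusion_def weak_premise_def weak_left_def weak_right_def
      horn_clauses_def weak_clauses_def)

lemmas clause_bits_eval = clause_eval[unfolded bit_vector_def, simplified upt_eval list.map
  list.set insert_iff empty_iff num_eval simp_thms]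

lemma rounds_eval:
  "(step ^^ 0) x = x" "(step ^^ 1) x = step x" "(step ^^ 2) x = step (step x)"
  "(step ^^ 3) x = step (step (step x))" "(step ^^ 4) x = step (step (step (step x)))"
  by (simp_all add: eval_nat_numeral)

lemma join_eval: "join [] [] = []" "join (a # x) (b # y) = (a \<or> b) # join x y"
  by (simp_all add: join_def)

lemma below_eval: "below [] []" "below (a # x) (b # y) \<longleftrightarrow> (a \<longrightarrow> b) \<and> below x y"
  by simp_all

lemmas climb_eval = derives.simps act_eval step_eval clause_bits_eval rounds_eval join_eval below_eval
  num_eval simp_thms

lemmas row_eval = climbs_def rep_eval extensions.simps list.map list_all2_Cons list_all2_Nil prod.case climb_eval

text \<open>The entries follow the order of \<open>extensions (rep j)\<close>, that is, of the missing couples.\<close>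

lemma climbs_from_0:
  "climbs 0
   [(1,16,Done 0), (1,10,Done 0), (1,8,Done 0), (1,4,Done 0), (1,2,Done 0), (1,0,Done 0),
    (2,22,Done 0), (2,16,Done 0), (2,20,Done 0), (2,10,Done 0), (2,14,Done 0), (2,8,Done 0),
    (2,18,Done 0), (2,4,Done 0), (2,12,Done 0), (2,2,Done 0), (2,6,Done 0), (2,0,Done 0),
    (3,16,Done 0), (3,10,Done 0), (3,8,Done 0), (3,4,Done 0), (3,2,Done 0), (3,0,Done 0)]"
  "climbs 1
   [(4,3,Done 0), (50,7,Done 1), (50,6,Done 1), (50,1,Done 1), (50,0,Done 1), (5,1,Done 0),
    (5,0,Done 0), (6,7,Done 0), (50,7,Done 1), (6,6,Done 0), (50,6,Done 1), (6,1,Done 0),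
    (50,1,Done 1), (6,0,Done 0), (50,0,Done 1), (7,6,Done 0), (7,0,Done 0), (8,0,Done 0),
    (9,7,Done 0), (9,6,Done 0), (9,1,Done 0), (9,0,Done 0), (10,0,Done 0)]"
  "climbs 2
   [(5,16,Done 0), (6,10,Done 0), (6,8,Done 0), (50,1,Done 1), (50,0,Done 1), (7,0,Done 0),
    (11,5,Done 0), (11,3,Done 0), (57,7,Done 1), (12,7,Done 0), (57,6,Done 1), (12,6,Done 0),
    (12,4,Done 0), (50,1,Done 1), (12,2,Done 0), (50,0,Done 1), (13,0,Done 0), (14,0,Done 0),
    (57,7,Done 1), (57,6,Done 1), (15,1,Done 0), (15,0,Done 0), (16,0,Done 0)]"
  "climbs 3
   [(8,16,Done 0), (9,10,Done 0), (9,8,Done 0), (9,4,Done 0), (9,2,Done 0), (10,0,Done 0),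
    (14,22,Done 0), (14,16,Done 0), (57,7,Done 1), (15,10,Done 0), (57,6,Done 1), (15,8,Done 0),
    (57,1,Done 1), (15,4,Done 0), (57,0,Done 1), (15,2,Done 0), (16,6,Done 0), (16,0,Done 0),
    (17,3,Done 0), (57,7,Done 1), (57,6,Done 1), (57,1,Done 1), (57,0,Done 1)]"
  "climbs 4
   [(77,16,Done 1), (77,10,Done 1), (77,2,Done 1), (77,0,Done 1), (50,19,Done 1), (50,15,Done 1),
    (50,18,Done 1), (50,9,Done 1), (18,13,Done 0), (18,7,Done 0), (18,21,Done 0), (18,0,Done 0),
    (50,12,Done 1), (50,3,Done 1), (50,6,Done 1), (50,1,Done 1), (20,16,Done 0), (20,10,Done 0),
    (19,7,Done 0), (19,0,Done 0), (20,2,Done 0), (20,0,Done 0)]"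
  "climbs 5
   [(18,12,Done 0), (50,7,Done 1), (77,9,Done 1), (50,1,Done 1), (77,3,Done 1), (21,0,Done 0),
    (22,6,Done 0), (78,10,Done 1), (50,15,Done 1), (50,6,Done 1), (22,0,Done 0), (78,4,Done 1),
    (50,13,Done 1), (50,0,Done 1), (23,6,Done 0), (23,0,Done 0), (24,0,Done 0), (57,21,Done 1),
    (25,6,Done 0), (57,19,Done 1), (25,0,Done 0), (26,0,Done 0)]"
  "climbs 6
   [(50,13,Done 1), (50,7,Done 1), (60,14,Done 1), (59,1,Done 1), (60,2,Done 1), (22,1,Done 0),
    (50,13,Done 1), (27,1,Done 0), (50,7,Done 1), (50,12,Done 1), (50,6,Done 1), (64,0,Done 1),
    (59,1,Done 1), (60,2,Done 1), (65,0,Done 1), (28,0,Done 0), (29,0,Done 0), (30,0,Done 0),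
    (31,0,Done 0), (64,0,Done 1), (32,0,Done 0), (65,0,Done 1)]"
  "climbs 7
   [(18,3,Done 0), (60,7,Done 1), (60,6,Done 1), (50,1,Done 1), (50,0,Done 1), (23,1,Done 0),
    (23,0,Done 0), (65,7,Done 1), (60,7,Done 1), (65,6,Done 1), (60,6,Done 1), (28,1,Done 0),
    (50,1,Done 1), (28,0,Done 0), (50,0,Done 1), (33,0,Done 0), (34,0,Done 0), (65,7,Done 1),
    (65,6,Done 1), (35,1,Done 0), (35,0,Done 0), (36,0,Done 0)]"
  "climbs 8
   [(19,12,Done 0), (50,7,Done 1), (50,6,Done 1), (50,1,Done 1), (50,0,Done 1), (24,1,Done 0),
    (24,0,Done 0), (29,7,Done 0), (78,10,Done 1), (29,6,Done 0), (78,8,Done 1), (29,1,Done 0),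
    (78,4,Done 1), (29,0,Done 0), (78,2,Done 1), (34,6,Done 0), (34,0,Done 0), (57,21,Done 1),
    (57,15,Done 1), (57,19,Done 1), (57,13,Done 1), (37,0,Done 0)]"
  "climbs 9
   [(20,3,Done 0), (50,7,Done 1), (50,6,Done 1), (61,1,Done 1), (62,2,Done 1), (57,13,Done 1),
    (25,0,Done 0), (30,7,Done 0), (50,7,Done 1), (31,6,Done 0), (62,8,Done 1), (64,0,Done 1),
    (61,1,Done 1), (32,0,Done 0), (62,2,Done 1), (65,0,Done 1), (35,0,Done 0), (57,13,Done 1),
    (38,1,Done 0), (57,12,Done 1), (64,0,Done 1), (65,0,Done 1)]"
  "climbs 10
   [(19,3,Done 0), (62,7,Done 1), (62,6,Done 1), (62,1,Done 1), (62,0,Done 1), (26,1,Done 0),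
    (26,0,Done 0), (65,7,Done 1), (62,7,Done 1), (65,6,Done 1), (62,6,Done 1), (65,1,Done 1),
    (62,1,Done 1), (65,0,Done 1), (62,0,Done 1), (36,6,Done 0), (36,0,Done 0), (37,0,Done 0),
    (65,7,Done 1), (65,6,Done 1), (65,1,Done 1), (65,0,Done 1)]"
  "climbs 11
   [(27,16,Done 0), (50,9,Done 1), (23,8,Done 0), (23,4,Done 0), (50,3,Done 1), (77,0,Done 1),
    (57,15,Done 1), (57,19,Done 1), (40,7,Done 0), (78,11,Done 1), (39,7,Done 0), (39,0,Done 0),
    (40,0,Done 0), (78,3,Done 1), (50,6,Done 1), (50,1,Done 1), (79,13,Done 1), (57,18,Done 1),
    (41,7,Done 0), (41,0,Done 0), (57,12,Done 1), (42,0,Done 0)]"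
  "climbs 12
   [(22,17,Done 0), (50,7,Done 1), (50,6,Done 1), (59,3,Done 1), (28,2,Done 0), (60,0,Done 1),
    (57,13,Done 1), (40,14,Done 0), (40,4,Done 0), (50,7,Done 1), (28,14,Use 0 0 9 (Done 0)),
    (62,8,Done 1), (67,1,Done 1), (59,3,Done 1), (68,2,Done 1), (60,0,Done 1), (57,13,Done 1),
    (43,0,Done 0), (57,12,Done 1), (67,1,Done 1), (68,2,Done 1), (44,0,Done 0)]"
  "climbs 13
   [(21,16,Done 0), (60,7,Done 1), (60,6,Done 1), (60,1,Done 1), (60,0,Done 1), (33,0,Done 0),
    (39,5,Done 0), (39,3,Done 0), (68,7,Done 1), (60,7,Done 1), (68,6,Done 1), (60,6,Done 1),
    (68,1,Done 1), (60,1,Done 1), (68,0,Done 1), (60,0,Done 1), (45,0,Done 0), (68,7,Done 1),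
    (68,6,Done 1), (68,1,Done 1), (68,0,Done 1), (46,0,Done 0)]"
  "climbs 14
   [(26,16,Done 0), (30,10,Done 0), (30,8,Done 0), (50,1,Done 1), (50,0,Done 1), (34,0,Done 0),
    (41,18,Done 0), (41,12,Done 0), (57,7,Done 1), (57,21,Done 1), (57,6,Done 1), (57,15,Done 1),
    (43,4,Done 0), (78,4,Done 1), (43,2,Done 0), (78,2,Done 1), (45,0,Done 0), (79,9,Done 1),
    (79,11,Done 1), (57,19,Done 1), (57,13,Done 1), (47,0,Done 0)]"
  "climbs 15
   [(25,16,Done 0), (29,10,Done 0), (31,8,Done 0), (61,1,Done 1), (62,2,Done 1), (35,0,Done 0),
    (57,13,Done 1), (42,3,Done 0), (57,7,Done 1), (43,7,Done 0), (57,6,Done 1), (57,12,Done 1),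
    (67,3,Done 1), (61,1,Done 1), (44,2,Done 0), (62,2,Done 1), (68,0,Done 1), (57,13,Done 1),
    (57,7,Done 1), (68,14,Done 1), (67,3,Done 1), (68,0,Done 1)]"
  "climbs 16
   [(24,16,Done 0), (32,10,Done 0), (32,8,Done 0), (62,1,Done 1), (62,0,Done 1), (36,0,Done 0),
    (41,5,Done 0), (41,3,Done 0), (57,7,Done 1), (44,7,Done 0), (57,6,Done 1), (44,6,Done 0),
    (68,1,Done 1), (62,1,Done 1), (68,0,Done 1), (62,0,Done 1), (46,0,Done 0), (47,0,Done 0),
    (57,7,Done 1), (57,6,Done 1), (68,1,Done 1), (68,0,Done 1)]"
  by (simp_all only: row_eval)

lemma climbs_from_17:
  "climbs 17
   [(38,16,Done 0), (38,10,Done 0), (37,8,Done 0), (37,4,Done 0), (38,2,Done 0), (38,0,Done 0),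
    (57,15,Done 1), (57,19,Done 1), (57,9,Done 1), (57,18,Done 1), (47,14,Done 0), (47,8,Done 0),
    (47,18,Done 0), (47,4,Done 0), (57,3,Done 1), (57,12,Done 1), (57,1,Done 1), (57,6,Done 1),
    (79,13,Done 1), (79,7,Done 1), (79,0,Done 1), (79,2,Done 1)]"
  "climbs 18
   [(77,16,Done 1), (77,10,Done 1), (77,2,Done 1), (77,0,Done 1), (60,19,Done 1), (78,17,Done 1),
    (60,18,Done 1), (78,11,Done 1), (48,2,Done 0), (48,0,Done 0),
    (58,0,Split 0 0 12 (Done 2) (Done 2)), (50,12,Done 1), (50,3,Done 1), (50,6,Done 1),
    (50,1,Done 1), (65,19,Done 1), (65,18,Done 1), (51,5,Split 0 0 18 (Done 1) (Done 2)),
    (58,0,Split 0 0 18 (Done 2) (Done 2)), (53,5,Split 0 0 18 (Done 1) (Done 2)),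
    (53,4,Split 0 0 18 (Done 2) (Done 1))]"
  "climbs 19
   [(77,16,Done 1), (77,10,Done 1), (77,2,Done 1), (77,0,Done 1), (62,19,Done 1), (78,17,Done 1),
    (62,18,Done 1), (78,11,Done 1), (51,15,Split 0 0 3 (Done 1) (Done 2)),
    (51,9,Split 0 0 5 (Done 1) (Done 2)), (58,0,Split 0 0 12 (Done 2) (Done 2)),
    (58,0,Split 0 0 18 (Done 2) (Done 2)), (78,12,Done 1), (62,5,Done 1), (78,6,Done 1),
    (62,4,Done 1), (65,19,Done 1), (65,18,Done 1), (49,0,Done 0), (65,5,Done 1), (65,4,Done 1)]"
  "climbs 20
   [(77,16,Done 1), (77,10,Done 1), (77,2,Done 1), (80,0,Done 1), (50,19,Done 1), (50,15,Done 1),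
    (65,10,Done 1), (61,9,Done 1), (65,8,Done 1), (53,8,Split 0 0 5 (Done 2) (Done 1)),
    (65,4,Done 1), (53,4,Split 0 0 18 (Done 2) (Done 1)), (62,12,Done 1), (61,3,Done 1),
    (62,6,Done 1), (62,1,Done 1), (80,16,Use 0 4 4 (Done 1)), (64,8,Done 1), (65,8,Done 1),
    (65,4,Done 1), (64,4,Done 1)]"
  "climbs 21
   [(58,12,Split 0 0 0 (Done 2) (Done 2)), (77,11,Done 1), (77,9,Done 1), (77,5,Done 1),
    (77,3,Done 1), (60,23,Done 1), (78,10,Done 1), (60,17,Done 1), (78,8,Done 1), (60,22,Done 1),
    (78,4,Done 1), (60,16,Done 1), (78,2,Done 1), (48,11,Split 0 0 16 (Done 1) (Done 1)),
    (48,5,Split 0 0 22 (Done 1) (Done 1)), (58,12,Split 0 1 0 (Done 2) (Done 2)), (68,23,Done 1),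
    (68,17,Done 1), (68,22,Done 1), (68,16,Done 1),
    (48,5,Use 0 3 16 (Split 0 0 0 (Done 2) (Done 1)))]"
  "climbs 22
   [(60,22,Done 1), (59,18,Done 1), (77,9,Done 1), (60,4,Done 1), (77,3,Done 1), (60,22,Done 1),
    (59,18,Done 1), (78,10,Done 1), (50,15,Done 1), (50,6,Done 1), (83,4,Done 1), (65,3,Done 1),
    (59,0,Done 1), (65,1,Done 1), (60,4,Split 0 0 22 (Done 1) (Done 3)),
    (53,19,Split 0 1 0 (Done 2) (Done 1)), (67,21,Done 1), (80,9,Use 0 2 3 (Done 1)),
    (68,19,Done 1), (64,0,Done 1), (65,1,Done 1)]"
  "climbs 23
   [(48,3,Done 0), (60,7,Done 1), (77,9,Done 1), (50,1,Done 1), (77,3,Done 1),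
    (48,5,Split 0 0 22 (Done 1) (Done 1)), (65,7,Done 1), (78,10,Done 1), (78,15,Done 1),
    (60,6,Done 1), (60,4,Split 0 0 22 (Done 1) (Done 3)), (78,4,Done 1), (50,13,Done 1),
    (50,0,Done 1), (63,0,Split 0 0 16 (Done 3) (Done 2)), (51,0,Done 0), (79,9,Done 1),
    (65,6,Done 1), (51,0,Done 1), (53,0,Split 0 0 22 (Done 3) (Done 1)),
    (63,0,Split 0 0 22 (Done 3) (Done 2))]"
  "climbs 24
   [(58,12,Split 0 0 1 (Done 2) (Done 2)), (50,7,Done 1), (77,9,Done 1), (50,1,Done 1),
    (77,3,Done 1), (58,12,Split 0 1 0 (Done 2) (Done 2)), (53,21,Split 0 1 0 (Done 1) (Done 2)),
    (78,10,Done 1), (62,17,Done 1), (78,8,Done 1), (53,19,Split 0 1 0 (Done 2) (Done 1)),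
    (78,4,Done 1), (62,16,Done 1), (78,2,Done 1), (51,6,Done 0), (51,0,Done 0), (57,21,Done 1),
    (68,17,Done 1), (57,19,Done 1), (68,16,Done 1), (51,0,Split 0 1 0 (Done 2) (Done 1))]"
  "climbs 25
   [(53,16,Split 0 0 1 (Done 2) (Done 1)), (50,7,Done 1), (77,9,Done 1), (61,1,Done 1),
    (80,3,Done 1), (68,16,Done 1), (80,3,Use 0 2 13 (Done 1)), (78,10,Done 1), (61,15,Done 1),
    (62,8,Done 1), (64,0,Done 1), (78,4,Done 1), (62,13,Done 1), (62,2,Done 1), (65,0,Done 1),
    (53,0,Split 0 0 22 (Done 3) (Done 1)), (68,16,Done 1), (57,21,Done 1), (67,12,Done 1),
    (64,0,Done 1), (65,0,Done 1)]"
  "climbs 26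
   [(48,3,Split 0 0 1 (Done 2) (Done 1)), (62,7,Done 1), (77,9,Done 1), (62,1,Done 1),
    (77,3,Done 1), (48,5,Use 0 3 16 (Split 0 0 0 (Done 2) (Done 1))), (65,7,Done 1),
    (78,10,Done 1), (78,15,Done 1), (62,6,Done 1), (65,1,Done 1), (78,4,Done 1), (78,13,Done 1),
    (62,0,Done 1), (63,0,Split 0 0 16 (Done 3) (Done 2)), (63,0,Split 0 0 22 (Done 3) (Done 2)),
    (51,0,Split 0 1 0 (Done 2) (Done 1)), (79,9,Done 1), (65,6,Done 1), (79,3,Done 1),
    (65,0,Done 1)]"
  "climbs 27
   [(77,16,Done 1), (60,20,Done 1), (60,8,Done 1), (60,4,Done 1), (59,0,Done 1), (50,19,Done 1),
    (50,15,Done 1), (78,20,Done 1), (59,7,Done 1), (60,8,Done 1), (60,4,Done 1), (78,12,Done 1),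
    (59,0,Done 1), (65,1,Done 1), (65,6,Done 1), (52,0,Done 0), (64,6,Done 1),
    (65,6,Split 0 1 5 (Done 3) (Done 1)), (65,1,Split 0 1 18 (Done 3) (Done 1)), (64,0,Done 1),
    (86,0,Done 1)]"
  "climbs 28
   [(50,13,Done 1), (60,7,Done 1), (60,6,Done 1), (59,1,Done 1), (60,2,Done 1),
    (60,2,Split 0 0 22 (Done 3) (Done 1)), (50,13,Done 1), (65,7,Done 1), (60,7,Done 1),
    (62,14,Done 1), (60,6,Done 1), (74,0,Done 1), (59,1,Done 1), (60,2,Done 1), (75,0,Done 1),
    (60,2,Split 0 0 22 (Done 4) (Done 1)), (65,7,Done 1), (65,6,Done 1), (74,0,Done 1),
    (53,0,Done 0), (75,0,Done 1)]"
  "climbs 29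
   [(62,16,Done 1), (50,7,Done 1), (61,12,Done 1), (59,1,Done 1), (60,2,Done 1),
    (53,13,Split 0 1 1 (Done 2) (Done 1)), (62,16,Done 1), (52,1,Done 0), (78,10,Done 1),
    (61,12,Done 1), (78,8,Done 1), (64,0,Done 1), (78,4,Done 1), (83,2,Done 1), (65,0,Done 1),
    (60,2,Split 0 0 22 (Done 4) (Done 1)), (57,21,Done 1), (67,15,Done 1), (64,0,Done 1),
    (68,13,Done 1), (65,0,Done 1)]"
  "climbs 30
   [(50,13,Done 1), (62,10,Done 1), (61,6,Done 1), (59,1,Done 1), (60,2,Done 1),
    (80,11,Use 0 2 2 (Done 1)), (78,16,Done 1), (65,7,Split 0 1 4 (Done 3) (Done 1)),
    (62,10,Done 1), (78,14,Done 1), (61,6,Done 1), (64,0,Done 1), (62,4,Done 1), (60,2,Done 1),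
    (65,0,Done 1), (65,7,Done 1), (57,21,Done 1), (64,6,Done 1), (79,1,Done 1),
    (65,0,Split 0 1 19 (Done 4) (Done 1)), (86,1,Done 1)]"
  "climbs 31
   [(61,13,Done 1), (61,7,Done 1), (72,14,Done 1), (59,1,Done 1), (60,2,Done 1), (67,15,Done 1),
    (61,13,Done 1), (64,6,Done 1), (61,7,Done 1), (62,14,Done 1), (62,8,Done 1), (64,0,Done 1),
    (59,1,Done 1), (72,2,Done 1), (65,0,Done 1), (65,6,Done 1), (67,15,Done 1), (64,6,Done 1),
    (64,0,Done 1), (68,12,Done 1), (75,0,Done 1)]"
  "climbs 32
   [(62,13,Done 1), (50,7,Done 1), (62,12,Done 1), (71,1,Done 1), (72,2,Done 1), (68,13,Done 1),
    (62,13,Done 1), (65,0,Split 0 1 19 (Done 3) (Done 1)), (50,7,Done 1), (62,12,Done 1),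
    (62,8,Done 1), (64,0,Done 1), (71,1,Done 1), (72,2,Done 1), (65,0,Done 1), (53,0,Done 0),
    (68,13,Done 1), (65,0,Split 0 1 19 (Done 4) (Done 1)), (68,12,Done 1), (64,0,Done 1),
    (65,0,Done 1)]"
  "climbs 33
   [(58,3,Split 0 0 16 (Done 2) (Done 2)), (60,7,Done 1), (60,6,Done 1), (60,1,Done 1),
    (60,0,Done 1), (63,1,Split 0 0 16 (Done 2) (Done 3)), (63,0,Split 0 0 16 (Done 3) (Done 2)),
    (75,7,Done 1), (60,7,Done 1), (75,6,Done 1), (60,6,Done 1), (75,1,Done 1), (60,1,Done 1),
    (75,0,Done 1), (60,0,Done 1), (66,0,Split 0 0 16 (Done 3) (Done 3)), (75,7,Done 1),
    (75,6,Done 1), (75,1,Done 1), (75,0,Done 1), (54,0,Done 0)]"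
  by (simp_all only: row_eval)

lemma climbs_from_34:
  "climbs 34
   [(51,1,Split 0 0 22 (Done 1) (Done 2)), (60,7,Done 1), (60,6,Done 1), (50,1,Done 1),
    (50,0,Done 1), (51,1,Done 0), (51,0,Done 0), (65,7,Done 1), (78,10,Done 1), (65,6,Done 1),
    (78,8,Done 1), (60,4,Split 0 0 22 (Done 1) (Done 4)), (78,4,Done 1),
    (60,2,Split 0 0 22 (Done 4) (Done 1)), (78,2,Done 1), (66,0,Split 0 0 16 (Done 3) (Done 3)),
    (79,9,Done 1), (79,11,Done 1), (51,0,Done 1), (51,1,Done 1),
    (66,0,Split 0 0 22 (Done 3) (Done 3))]"
  "climbs 35
   [(53,0,Split 0 0 22 (Done 2) (Done 1)), (60,7,Done 1), (60,6,Done 1), (61,1,Done 1),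
    (62,2,Done 1), (51,1,Done 1), (53,0,Split 0 0 22 (Done 3) (Done 1)), (65,7,Done 1),
    (60,7,Done 1), (65,6,Done 1), (60,6,Done 1), (74,0,Done 1), (61,1,Done 1), (53,0,Done 0),
    (62,2,Done 1), (75,0,Done 1), (51,1,Done 1), (65,7,Done 1), (65,6,Done 1), (74,0,Done 1),
    (75,0,Done 1)]"
  "climbs 36
   [(58,3,Split 0 0 22 (Done 2) (Done 2)), (72,7,Done 1), (72,6,Done 1), (62,1,Done 1),
    (62,0,Done 1), (63,1,Split 0 0 22 (Done 2) (Done 3)), (63,0,Split 0 0 22 (Done 3) (Done 2)),
    (65,7,Done 1), (72,7,Done 1), (65,6,Done 1), (72,6,Done 1), (75,1,Done 1), (62,1,Done 1),
    (75,0,Done 1), (62,0,Done 1), (54,0,Done 0), (66,0,Split 0 0 22 (Done 3) (Done 3)),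
    (65,7,Done 1), (65,6,Done 1), (75,1,Done 1), (75,0,Done 1)]"
  "climbs 37
   [(49,3,Done 0), (62,7,Done 1), (62,6,Done 1), (62,1,Done 1), (62,0,Done 1),
    (51,7,Split 0 1 1 (Done 1) (Done 2)), (51,0,Split 0 1 0 (Done 2) (Done 1)), (65,7,Done 1),
    (78,10,Done 1), (65,6,Done 1), (78,8,Done 1), (65,1,Done 1), (78,4,Done 1), (65,0,Done 1),
    (78,2,Done 1), (66,0,Split 0 0 16 (Done 3) (Done 3)), (66,0,Split 0 0 22 (Done 3) (Done 3)),
    (79,9,Done 1), (79,11,Done 1), (79,3,Done 1), (79,5,Done 1)]"
  "climbs 38
   [(80,5,Use 0 4 10 (Done 1)), (61,7,Done 1), (62,8,Done 1), (62,4,Done 1), (61,0,Done 1),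
    (57,15,Done 1), (57,19,Done 1), (64,6,Done 1), (61,7,Done 1),
    (65,6,Split 0 1 5 (Done 4) (Done 1)), (62,8,Done 1), (65,1,Split 0 1 18 (Done 4) (Done 1)),
    (62,4,Done 1), (64,0,Done 1), (61,0,Done 1), (65,1,Done 1), (65,6,Done 1), (79,13,Done 1),
    (79,7,Done 1), (79,0,Done 1), (86,0,Done 1)]"
  "climbs 39
   [(60,19,Done 1), (77,10,Done 1), (48,10,Split 0 0 5 (Done 1) (Done 1)),
    (63,4,Split 0 0 12 (Done 3) (Done 2)), (60,5,Done 1), (77,0,Done 1), (78,22,Done 1),
    (68,19,Done 1), (60,18,Done 1), (78,11,Done 1), (55,0,Done 0), (68,5,Done 1), (78,3,Done 1),
    (78,6,Done 1), (60,4,Done 1), (79,13,Done 1), (68,18,Done 1),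
    (51,18,Split 0 1 3 (Done 1) (Done 1)), (63,4,Split 0 1 12 (Done 3) (Done 2)), (79,0,Done 1),
    (68,4,Done 1)]"
  "climbs 40
   [(59,13,Done 1), (50,9,Done 1), (60,14,Done 1), (60,3,Split 0 0 18 (Done 1) (Done 3)),
    (60,3,Done 1), (77,0,Done 1), (67,15,Done 1), (65,22,Done 1), (60,18,Use 0 1 22 (Done 1)),
    (78,11,Done 1), (60,14,Done 1), (68,5,Done 1), (83,3,Done 1), (62,6,Done 1), (59,1,Done 1),
    (79,13,Done 1), (57,18,Done 1), (53,12,Split 0 1 3 (Done 3) (Done 1)), (68,5,Done 1),
    (68,12,Done 1), (67,0,Done 1)]"
  "climbs 41
   [(65,22,Split 0 1 12 (Done 1) (Done 3)), (51,8,Done 1), (51,8,Done 0),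
    (63,4,Split 0 0 18 (Done 3) (Done 2)), (62,5,Done 1), (77,0,Done 1), (57,15,Done 1),
    (57,19,Done 1), (53,20,Split 0 1 12 (Done 3) (Done 1)), (78,11,Done 1),
    (51,14,Split 0 1 12 (Done 1) (Done 1)), (63,4,Split 0 1 12 (Done 3) (Done 2)), (68,5,Done 1),
    (78,3,Done 1), (78,6,Done 1), (62,4,Done 1), (79,13,Done 1), (57,18,Done 1), (56,0,Done 0),
    (79,0,Done 1), (68,4,Done 1)]"
  "climbs 42
   [(52,16,Done 0), (61,9,Done 1), (53,8,Split 0 0 5 (Done 3) (Done 1)),
    (53,4,Split 0 0 18 (Done 3) (Done 1)), (61,3,Done 1), (80,0,Done 1), (57,15,Done 1),
    (57,19,Done 1), (67,7,Done 1), (78,11,Done 1), (68,8,Done 1), (68,4,Done 1), (67,0,Done 1),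
    (78,3,Done 1), (62,6,Done 1), (62,1,Done 1), (79,13,Done 1), (67,7,Done 1), (68,8,Done 1),
    (68,4,Done 1), (67,0,Done 1)]"
  "climbs 43
   [(80,11,Use 0 2 10 (Done 1)), (62,10,Done 1), (61,6,Done 1), (59,3,Done 1),
    (60,0,Split 0 0 19 (Done 4) (Done 1)), (60,0,Done 1), (57,13,Done 1), (57,21,Done 1),
    (53,7,Split 0 1 4 (Done 3) (Done 1)), (62,10,Done 1), (67,9,Done 1), (61,6,Done 1),
    (67,1,Done 1), (78,5,Done 1), (68,2,Done 1), (83,0,Done 1), (79,15,Done 1), (79,6,Done 1),
    (68,4,Done 1), (68,2,Done 1), (68,7,Done 1)]"
  "climbs 44
   [(53,2,Split 0 1 22 (Done 2) (Done 1)), (62,7,Done 1), (62,6,Done 1), (71,3,Done 1),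
    (53,2,Done 0), (72,0,Done 1), (57,13,Done 1), (53,2,Split 0 1 22 (Done 3) (Done 1)),
    (68,7,Done 1), (62,7,Done 1), (68,6,Done 1), (62,6,Done 1), (67,1,Done 1), (71,3,Done 1),
    (68,2,Done 1), (72,0,Done 1), (57,13,Done 1), (68,7,Done 1), (68,14,Done 1), (67,1,Done 1),
    (68,2,Done 1)]"
  "climbs 45
   [(51,7,Use 0 3 0 (Split 0 0 16 (Done 1) (Done 2))), (60,7,Done 1), (60,6,Done 1),
    (60,1,Done 1), (60,0,Done 1), (66,0,Split 0 0 16 (Done 3) (Done 3)),
    (51,7,Split 0 1 1 (Done 1) (Done 1)), (51,0,Split 0 1 0 (Done 1) (Done 1)), (68,7,Done 1),
    (78,10,Done 1), (68,6,Done 1), (78,8,Done 1), (68,1,Done 1), (78,4,Done 1), (68,0,Done 1),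
    (78,2,Done 1), (79,9,Done 1), (79,11,Done 1), (79,3,Done 1), (79,5,Done 1),
    (66,0,Split 0 1 16 (Done 3) (Done 3))]"
  "climbs 46
   [(58,3,Split 0 1 16 (Done 2) (Done 2)), (72,7,Done 1), (72,6,Done 1), (72,1,Done 1),
    (72,0,Done 1), (54,0,Done 0), (63,1,Split 0 1 16 (Done 2) (Done 3)),
    (63,0,Split 0 1 16 (Done 3) (Done 2)), (68,7,Done 1), (72,7,Done 1), (68,6,Done 1),
    (72,6,Done 1), (68,1,Done 1), (72,1,Done 1), (68,0,Done 1), (72,0,Done 1),
    (66,0,Split 0 1 16 (Done 3) (Done 3)), (68,7,Done 1), (68,6,Done 1), (68,1,Done 1),
    (68,0,Done 1)]"
  "climbs 47
   [(51,22,Split 0 1 16 (Done 1) (Done 2)), (65,10,Split 0 1 16 (Done 1) (Done 4)),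
    (65,8,Split 0 1 16 (Done 4) (Done 1)), (62,1,Done 1), (62,0,Done 1),
    (66,0,Split 0 0 22 (Done 3) (Done 3)), (56,5,Done 0), (56,3,Done 0), (57,7,Done 1),
    (57,21,Done 1), (57,6,Done 1), (56,5,Done 1), (68,1,Done 1), (78,4,Done 1), (68,0,Done 1),
    (78,2,Done 1), (66,0,Split 0 1 16 (Done 3) (Done 3)), (79,9,Done 1), (79,11,Done 1),
    (79,3,Done 1), (79,5,Done 1)]"
  "climbs 48
   [(77,16,Done 1), (77,10,Done 1), (77,2,Done 1), (77,0,Done 1), (78,22,Done 1), (78,17,Done 1),
    (60,18,Done 1), (78,11,Done 1), (69,7,Split 0 0 3 (Done 2) (Done 2)),
    (69,0,Split 0 0 5 (Done 2) (Done 2)), (60,14,Done 1), (78,3,Done 1), (77,0,Done 2),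
    (77,0,Done 2), (79,13,Done 1), (65,18,Done 1), (69,7,Split 0 0 18 (Done 1) (Done 2)),
    (69,0,Split 0 0 5 (Done 1) (Done 2)), (65,14,Done 1), (80,0,Split 0 0 5 (Done 3) (Done 1))]"
  "climbs 49
   [(77,16,Done 1), (77,10,Done 1), (77,2,Done 1), (77,0,Done 1), (78,22,Done 1), (78,17,Done 1),
    (78,20,Done 1), (78,11,Done 1), (81,0,Split 0 0 3 (Done 2) (Done 2)),
    (81,0,Split 0 0 5 (Done 2) (Done 2)), (81,0,Split 0 0 12 (Done 2) (Done 2)),
    (81,0,Split 0 0 18 (Done 2) (Done 2)), (78,12,Done 1), (78,3,Done 1), (78,6,Done 1),
    (78,1,Done 1), (79,13,Done 1), (79,7,Done 1), (79,0,Done 1), (79,2,Done 1)]"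
  "climbs 50
   [(77,3,Done 1), (77,1,Done 1), (60,2,Done 1), (70,0,Done 1), (78,2,Done 1), (77,3,Done 1),
    (78,0,Done 1), (77,1,Done 1), (60,2,Done 1), (62,2,Done 1), (59,0,Done 0), (70,0,Done 1),
    (60,2,Done 0), (60,0,Done 0), (78,2,Done 1), (78,0,Done 1), (62,2,Done 1), (61,0,Done 0),
    (62,2,Done 0), (62,0,Done 0)]"
  by (simp_all only: row_eval)

lemma climbs_from_51:
  "climbs 51
   [(69,12,Split 0 0 22 (Done 1) (Done 2)), (60,7,Done 1), (77,9,Done 1), (78,4,Done 2),
    (77,3,Done 1), (69,12,Split 0 0 22 (Done 1) (Done 1)), (65,7,Done 1), (78,10,Done 1),
    (78,15,Done 1), (78,8,Done 1), (83,4,Split 0 1 0 (Done 3) (Done 1)), (78,4,Done 1),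
    (62,16,Done 1), (78,2,Done 1), (73,0,Split 0 1 0 (Done 2) (Done 2)), (79,9,Done 1),
    (79,11,Done 1), (78,4,Done 2), (68,16,Done 1), (73,0,Split 0 1 0 (Done 1) (Done 2))]"
  "climbs 52
   [(80,16,Done 1), (60,20,Done 1), (60,8,Done 1), (60,4,Done 1), (59,0,Done 1), (62,22,Done 1),
    (62,17,Done 1), (78,20,Done 1), (78,10,Done 1), (83,8,Done 1), (83,4,Done 1), (78,12,Done 1),
    (78,2,Done 1), (65,1,Done 1), (65,6,Done 1), (67,21,Done 1), (68,15,Done 1), (68,19,Done 1),
    (64,0,Done 1), (86,0,Done 1)]"
  "climbs 53
   [(62,13,Done 1), (60,7,Done 1), (62,12,Done 1), (71,1,Done 1), (72,2,Done 1), (68,13,Done 1),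
    (62,13,Done 1), (65,7,Done 1), (60,7,Done 1), (62,14,Done 1), (60,6,Done 1), (74,0,Done 1),
    (71,1,Done 1), (72,2,Done 1), (75,0,Done 1), (68,13,Done 1), (65,7,Done 1), (65,6,Done 1),
    (74,0,Done 1), (75,0,Done 1)]"
  "climbs 54
   [(58,3,Done 0), (72,7,Done 1), (72,6,Done 1), (72,1,Done 1), (72,0,Done 1), (63,1,Done 0),
    (63,0,Done 0), (75,7,Done 1), (72,7,Done 1), (75,6,Done 1), (72,6,Done 1), (75,1,Done 1),
    (72,1,Done 1), (75,0,Done 1), (72,0,Done 1), (66,0,Done 0), (75,7,Done 1), (75,6,Done 1),
    (75,1,Done 1), (75,0,Done 1)]"
  "climbs 55
   [(77,16,Done 1), (77,10,Done 1), (81,0,Split 0 0 3 (Done 2) (Done 2)),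
    (81,0,Split 0 0 12 (Done 2) (Done 2)), (77,2,Done 1), (77,0,Done 1), (78,22,Done 1),
    (78,17,Done 1), (78,20,Done 1), (78,11,Done 1), (78,12,Done 1), (78,3,Done 1), (78,6,Done 1),
    (78,1,Done 1), (79,13,Done 1), (79,7,Done 1), (81,0,Split 0 1 3 (Done 2) (Done 2)),
    (81,0,Split 0 1 12 (Done 2) (Done 2)), (79,0,Done 1), (79,2,Done 1)]"
  "climbs 56
   [(65,22,Split 0 1 12 (Done 1) (Done 3)), (62,9,Done 1), (73,8,Split 0 1 12 (Done 1) (Done 2)),
    (73,4,Split 0 1 3 (Done 1) (Done 2)), (62,5,Done 1), (77,0,Done 1), (79,13,Done 2),
    (79,13,Done 2), (68,9,Done 1), (78,11,Done 1), (73,8,Split 0 1 12 (Done 1) (Done 1)),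
    (73,4,Split 0 1 3 (Done 1) (Done 1)), (68,5,Done 1), (78,3,Done 1), (78,6,Done 1),
    (78,1,Done 1), (79,13,Done 1), (79,7,Done 1), (79,0,Done 1), (79,2,Done 1)]"
  "climbs 57
   [(78,13,Done 1), (78,7,Done 1), (62,6,Done 1), (64,4,Done 0), (65,2,Done 0), (65,0,Done 0),
    (79,5,Done 1), (78,13,Done 1), (79,4,Done 1), (78,7,Done 1), (62,14,Done 1), (62,6,Done 1),
    (76,0,Done 1), (67,0,Done 0), (68,2,Done 0), (68,0,Done 0), (79,5,Done 1), (79,4,Done 1),
    (68,14,Done 1), (76,0,Done 1)]"
  "climbs 58
   [(77,16,Done 1), (77,10,Done 1), (77,2,Done 1), (77,0,Done 1), (72,19,Done 1), (78,17,Done 1),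
    (72,18,Done 1), (78,11,Done 1), (69,2,Done 0), (69,0,Done 0), (78,12,Done 1), (72,5,Done 1),
    (78,6,Done 1), (72,4,Done 1), (75,19,Done 1), (75,18,Done 1),
    (73,5,Split 0 0 12 (Done 1) (Done 2)), (75,5,Done 1), (75,4,Done 1)]"
  "climbs 59
   [(77,3,Done 1), (77,1,Done 1), (96,0,Done 2), (70,0,Done 1), (78,2,Done 1), (77,3,Done 1),
    (78,0,Done 1), (77,1,Done 1), (96,0,Done 2), (96,0,Done 2), (70,0,Done 1), (84,2,Done 1),
    (84,0,Done 1), (78,2,Done 1), (78,0,Done 1), (96,0,Done 2), (71,0,Done 0), (84,2,Done 1),
    (84,0,Done 1)]"
  "climbs 60
   [(77,3,Done 1), (77,1,Done 1), (93,0,Done 2), (70,0,Done 1), (78,2,Done 1), (77,3,Done 1),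
    (83,0,Done 1), (77,1,Done 1), (75,6,Done 1), (93,0,Done 2), (84,0,Done 1), (70,0,Done 1),
    (85,0,Done 1), (78,2,Done 1), (83,0,Done 1), (75,6,Done 1), (84,0,Done 1), (85,0,Done 1),
    (72,0,Done 0)]"
  "climbs 61
   [(77,3,Done 1), (77,1,Done 1), (96,0,Done 2), (70,0,Done 1), (78,2,Done 1), (77,3,Done 1),
    (78,0,Done 1), (77,1,Done 1), (96,0,Done 2), (96,0,Done 2), (71,0,Done 0), (70,0,Done 1),
    (84,2,Done 1), (84,0,Done 1), (78,2,Done 1), (78,0,Done 1), (96,0,Done 2), (84,2,Done 1),
    (84,0,Done 1)]"
  "climbs 62
   [(77,3,Done 1), (80,1,Done 1), (72,6,Done 1), (70,0,Done 1), (78,2,Done 1), (77,3,Done 1),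
    (78,0,Done 1), (80,1,Done 1), (93,0,Done 2), (72,6,Done 1), (84,0,Done 1), (70,0,Done 1),
    (85,0,Done 1), (72,0,Done 0), (78,2,Done 1), (78,0,Done 1), (93,0,Done 2), (84,0,Done 1),
    (85,0,Done 1)]"
  "climbs 63
   [(69,3,Done 0), (72,7,Done 1), (77,9,Done 1), (72,1,Done 1), (77,3,Done 1),
    (69,5,Use 0 3 16 (Done 0)), (75,7,Done 1), (78,10,Done 1), (78,15,Done 1), (72,6,Done 1),
    (75,1,Done 1), (78,4,Done 1), (78,13,Done 1), (72,0,Done 1), (73,0,Done 0), (79,9,Done 1),
    (75,6,Done 1), (79,3,Done 1), (75,0,Done 1)]"
  "climbs 64
   [(95,3,Done 2), (78,18,Done 1), (78,12,Done 1), (84,4,Done 1), (84,2,Done 1), (95,3,Done 2),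
    (95,3,Done 2), (78,18,Done 1), (79,1,Done 1), (78,12,Done 1), (79,0,Done 1), (84,4,Done 1),
    (84,2,Done 1), (76,0,Done 1), (74,0,Done 0), (95,3,Done 2), (79,1,Done 1), (79,0,Done 1),
    (76,0,Done 1)]"
  "climbs 65
   [(78,13,Done 1), (78,7,Done 1), (93,0,Done 2), (84,1,Done 1), (85,0,Done 1), (79,5,Done 1),
    (78,13,Done 1), (86,1,Done 1), (78,7,Done 1), (75,0,Done 1), (93,0,Done 2), (76,0,Done 1),
    (84,1,Done 1), (85,0,Done 1), (75,0,Done 0), (79,5,Done 1), (86,1,Done 1), (75,0,Done 1),
    (76,0,Done 1)]"
  "climbs 66
   [(73,1,Split 0 0 16 (Done 1) (Done 2)), (72,7,Done 1), (72,6,Done 1), (72,1,Done 1),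
    (72,0,Done 1), (73,1,Done 0), (73,0,Done 0), (75,7,Done 1), (78,10,Done 1), (75,6,Done 1),
    (78,8,Done 1), (75,1,Done 1), (78,4,Done 1), (75,0,Done 1), (78,2,Done 1), (79,9,Done 1),
    (79,11,Done 1), (79,3,Done 1), (79,5,Done 1)]"
  "climbs 67
   [(78,13,Done 1), (78,7,Done 1), (95,0,Done 2), (74,4,Done 0), (84,3,Done 1), (84,1,Done 1),
    (79,5,Done 1), (78,13,Done 1), (79,4,Done 1), (78,7,Done 1), (95,0,Done 2), (95,0,Done 2),
    (76,0,Done 1), (84,3,Done 1), (84,1,Done 1), (79,5,Done 1), (79,4,Done 1), (95,0,Done 2),
    (76,0,Done 1)]"
  by (simp_all only: row_eval)

lemma climbs_from_68:
  "climbs 68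
   [(78,13,Done 1), (83,7,Done 1), (72,6,Done 1), (84,1,Done 1), (85,0,Done 1), (75,0,Done 0),
    (79,5,Done 1), (78,13,Done 1), (79,4,Done 1), (83,7,Done 1), (93,0,Done 2), (72,6,Done 1),
    (76,0,Done 1), (84,1,Done 1), (85,0,Done 1), (79,5,Done 1), (79,4,Done 1), (93,0,Done 2),
    (76,0,Done 1)]"
  "climbs 69
   [(77,16,Done 1), (77,10,Done 1), (77,2,Done 1), (77,0,Done 1), (78,22,Done 1), (78,17,Done 1),
    (77,10,Done 2), (78,11,Done 1), (81,0,Split 0 0 3 (Done 2) (Done 2)), (78,12,Done 1),
    (78,3,Done 1), (78,6,Done 1), (77,0,Done 2), (79,13,Done 1), (78,11,Done 2),
    (81,0,Split 0 0 12 (Done 1) (Done 2)), (79,0,Done 1), (78,6,Done 2)]"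
  "climbs 70
   [(77,5,Done 1), (77,4,Done 1), (77,2,Done 1), (77,5,Done 1), (78,4,Done 1), (77,4,Done 1),
    (78,5,Done 1), (77,2,Done 1), (78,3,Done 1), (82,4,Split 0 0 12 (Done 2) (Done 2)),
    (82,2,Split 0 0 13 (Done 2) (Done 2)), (82,0,Split 0 0 16 (Done 2) (Done 2)), (78,2,Done 1),
    (78,0,Done 1), (78,1,Done 1), (82,4,Split 0 1 12 (Done 2) (Done 2)),
    (82,2,Split 0 1 13 (Done 2) (Done 2)), (82,0,Split 0 1 16 (Done 2) (Done 2))]"
  "climbs 71
   [(77,3,Done 1), (77,1,Done 1), (96,0,Done 2), (82,4,Done 1), (78,2,Done 1), (77,3,Done 1),
    (78,0,Done 1), (77,1,Done 1), (96,0,Done 2), (96,0,Done 2), (82,4,Done 1), (84,2,Done 1),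
    (84,0,Done 1), (78,2,Done 1), (78,0,Done 1), (96,0,Done 2), (84,2,Done 1), (84,0,Done 1)]"
  "climbs 72
   [(77,3,Done 1), (80,1,Done 1), (93,0,Done 2), (82,0,Done 1), (78,2,Done 1), (77,3,Done 1),
    (83,0,Done 1), (80,1,Done 1), (93,0,Done 2), (93,0,Done 2), (84,0,Done 1), (82,0,Done 1),
    (85,0,Done 1), (78,2,Done 1), (83,0,Done 1), (93,0,Done 2), (84,0,Done 1), (85,0,Done 1)]"
  "climbs 73
   [(81,3,Split 0 0 16 (Done 1) (Done 2)), (78,10,Done 2), (77,9,Done 1), (78,4,Done 2),
    (77,3,Done 1), (81,3,Use 0 3 16 (Done 0)), (79,9,Done 2), (78,10,Done 1), (78,15,Done 1),
    (78,8,Done 1), (79,3,Done 2), (78,4,Done 1), (78,13,Done 1), (78,2,Done 1), (79,9,Done 1),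
    (79,11,Done 1), (79,3,Done 1), (79,5,Done 1)]"
  "climbs 74
   [(95,3,Done 2), (78,18,Done 1), (78,12,Done 1), (84,4,Done 1), (84,2,Done 1), (95,3,Done 2),
    (95,3,Done 2), (78,18,Done 1), (79,1,Done 1), (78,12,Done 1), (79,0,Done 1), (84,4,Done 1),
    (84,2,Done 1), (87,0,Done 1), (95,3,Done 2), (79,1,Done 1), (79,0,Done 1), (87,0,Done 1)]"
  "climbs 75
   [(78,13,Done 1), (83,7,Done 1), (93,0,Done 2), (84,1,Done 1), (85,0,Done 1), (79,5,Done 1),
    (78,13,Done 1), (86,1,Done 1), (83,7,Done 1), (93,0,Done 2), (93,0,Done 2), (87,0,Done 1),
    (84,1,Done 1), (85,0,Done 1), (79,5,Done 1), (86,1,Done 1), (93,0,Done 2), (87,0,Done 1)]"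
  "climbs 76
   [(78,19,Done 1), (78,7,Done 1), (78,12,Done 1), (87,4,Split 0 0 12 (Done 2) (Done 2)),
    (87,2,Split 0 0 13 (Done 2) (Done 2)), (87,0,Split 0 0 16 (Done 2) (Done 2)), (78,19,Done 1),
    (78,13,Done 1), (78,18,Done 1), (78,7,Done 1), (78,12,Done 1), (78,6,Done 1),
    (87,4,Split 0 1 12 (Done 2) (Done 2)), (87,2,Split 0 1 13 (Done 2) (Done 2)),
    (87,0,Split 0 1 16 (Done 2) (Done 2)), (79,3,Done 1), (79,1,Done 1), (79,2,Done 1)]"
  "climbs 77
   [(97,2,Done 2), (95,7,Done 2), (95,0,Done 2), (97,2,Done 2), (97,2,Done 2), (80,0,Done 1),
    (95,7,Done 2), (88,7,Done 1), (88,0,Done 1), (80,0,Done 1), (95,0,Done 2), (97,2,Done 2),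
    (80,0,Done 1), (88,7,Done 1), (88,0,Done 1), (80,0,Done 1), (80,0,Done 0)]"
  "climbs 78
   [(97,4,Done 2), (88,6,Done 1), (83,0,Done 1), (95,1,Done 2), (97,4,Done 2), (97,4,Done 2),
    (88,6,Done 1), (96,6,Done 2), (83,0,Done 1), (83,0,Done 1), (95,1,Done 2), (90,0,Done 1),
    (83,0,Done 0), (97,4,Done 2), (96,6,Done 2), (83,0,Done 1), (90,0,Done 1)]"
  "climbs 79
   [(84,13,Done 1), (97,0,Done 2), (90,12,Done 1), (90,3,Done 1), (86,2,Done 0), (84,2,Done 1),
    (96,13,Done 2), (84,13,Done 1), (97,0,Done 2), (97,0,Done 2), (90,12,Done 1), (90,3,Done 1),
    (96,0,Done 2), (84,2,Done 1), (96,13,Done 2), (97,0,Done 2), (96,0,Done 2)]"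
  "climbs 80
   [(97,2,Done 2), (95,7,Done 2), (95,0,Done 2), (97,2,Done 2), (97,2,Done 2), (95,7,Done 2),
    (95,7,Done 2), (88,7,Done 1), (88,0,Done 1), (95,0,Done 2), (95,0,Done 2), (97,2,Done 2),
    (95,7,Done 2), (88,7,Done 1), (88,0,Done 1), (95,0,Done 2)]"
  "climbs 81
   [(92,16,Done 2), (92,10,Done 2), (92,2,Done 2), (92,0,Done 2), (92,16,Done 2), (92,16,Done 2),
    (92,10,Done 2), (92,10,Done 2), (92,2,Done 2), (92,2,Done 2), (92,0,Done 2), (92,0,Done 2),
    (92,16,Done 2), (92,10,Done 2), (92,2,Done 2), (92,0,Done 2)]"
  "climbs 82
   [(98,3,Done 2), (95,1,Done 2), (95,0,Done 2), (98,3,Done 2), (98,3,Done 2), (95,1,Done 2),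
    (95,1,Done 2), (95,0,Done 2), (95,0,Done 2), (89,1,Done 1), (89,0,Done 1), (98,3,Done 2),
    (95,1,Done 2), (95,0,Done 2), (89,1,Done 1), (89,0,Done 1)]"
  "climbs 83
   [(97,4,Done 2), (88,6,Done 1), (96,6,Done 2), (95,1,Done 2), (97,4,Done 2), (97,4,Done 2),
    (88,6,Done 1), (96,6,Done 2), (96,6,Done 2), (95,1,Done 2), (95,1,Done 2), (90,0,Done 1),
    (97,4,Done 2), (96,6,Done 2), (95,1,Done 2), (90,0,Done 1)]"
  "climbs 84
   [(98,3,Done 2), (95,1,Done 2), (96,0,Done 2), (89,1,Done 1), (98,3,Done 2), (98,3,Done 2),
    (95,1,Done 2), (95,1,Done 2), (96,0,Done 2), (96,0,Done 2), (89,1,Done 1), (91,0,Done 1),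
    (98,3,Done 2), (95,1,Done 2), (96,0,Done 2), (91,0,Done 1)]"
  by (simp_all only: row_eval)

lemma climbs_from_85:
  "climbs 85
   [(88,3,Done 1), (88,1,Done 1), (93,0,Done 2), (89,0,Done 1), (90,2,Done 1), (88,3,Done 1),
    (90,0,Done 1), (88,1,Done 1), (93,0,Done 2), (93,0,Done 2), (91,0,Done 1), (89,0,Done 1),
    (90,2,Done 1), (90,0,Done 1), (93,0,Done 2), (91,0,Done 1)]"
  "climbs 86
   [(97,2,Done 2), (96,7,Done 2), (90,6,Done 1), (90,1,Done 1), (96,0,Done 2), (97,2,Done 2),
    (97,2,Done 2), (96,7,Done 2), (96,7,Done 2), (90,6,Done 1), (90,1,Done 1), (96,0,Done 2),
    (96,0,Done 2), (97,2,Done 2), (96,7,Done 2), (96,0,Done 2)]"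
  "climbs 87
   [(98,3,Done 2), (96,1,Done 2), (96,0,Done 2), (91,1,Done 1), (91,0,Done 1), (98,3,Done 2),
    (98,3,Done 2), (96,1,Done 2), (96,1,Done 2), (96,0,Done 2), (96,0,Done 2), (91,1,Done 1),
    (91,0,Done 1), (98,3,Done 2), (96,1,Done 2), (96,0,Done 2)]"
  "climbs 88
   [(97,2,Done 2), (95,7,Done 2), (98,0,Done 2), (97,2,Done 2), (97,2,Done 2), (95,7,Done 2),
    (95,7,Done 2), (92,0,Done 1), (98,0,Done 2), (98,0,Done 2), (97,2,Done 2), (95,7,Done 2),
    (92,0,Done 1), (98,0,Done 2)]"
  "climbs 89
   [(98,3,Done 2), (98,1,Done 2), (95,0,Done 2), (98,3,Done 2), (98,3,Done 2), (98,1,Done 2),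
    (98,1,Done 2), (95,0,Done 2), (95,0,Done 2), (94,0,Done 1), (98,3,Done 2), (98,1,Done 2),
    (95,0,Done 2), (94,0,Done 1)]"
  "climbs 90
   [(97,4,Done 2), (92,1,Done 1), (96,6,Done 2), (98,1,Done 2), (97,4,Done 2), (97,4,Done 2),
    (92,1,Done 1), (96,6,Done 2), (96,6,Done 2), (98,1,Done 2), (98,1,Done 2), (97,4,Done 2),
    (96,6,Done 2), (98,1,Done 2)]"
  "climbs 91
   [(98,3,Done 2), (98,1,Done 2), (96,0,Done 2), (94,0,Done 1), (98,3,Done 2), (98,3,Done 2),
    (98,1,Done 2), (98,1,Done 2), (96,0,Done 2), (96,0,Done 2), (94,0,Done 1), (98,3,Done 2),
    (98,1,Done 2), (96,0,Done 2)]"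
  "climbs 92
   [(97,2,Done 2), (98,7,Done 2), (98,0,Done 2), (97,2,Done 2), (97,2,Done 2), (98,7,Done 2),
    (98,7,Done 2), (98,0,Done 2), (98,0,Done 2), (97,2,Done 2), (98,7,Done 2), (98,0,Done 2)]"
  "climbs 93
   [(95,12,Done 1), (95,6,Done 1), (95,0,Done 1), (96,12,Done 1), (95,12,Done 1), (96,6,Done 1),
    (95,6,Done 1), (96,0,Done 1), (95,0,Done 1), (96,12,Done 1), (96,6,Done 1), (96,0,Done 1)]"
  "climbs 94
   [(98,3,Done 2), (98,1,Done 2), (98,0,Done 2), (98,3,Done 2), (98,3,Done 2), (98,1,Done 2),
    (98,1,Done 2), (98,0,Done 2), (98,0,Done 2), (98,3,Done 2), (98,1,Done 2), (98,0,Done 2)]"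
  "climbs 95
   [(99,2,Done 2), (99,0,Done 2), (99,2,Done 2), (99,2,Done 2), (99,0,Done 2), (99,0,Done 2),
    (98,0,Done 1), (99,2,Done 2), (99,0,Done 2), (98,0,Done 1)]"
  "climbs 96
   [(99,2,Done 2), (99,0,Done 2), (98,0,Done 1), (99,2,Done 2), (99,2,Done 2), (99,0,Done 2),
    (99,0,Done 2), (98,0,Done 1), (99,2,Done 2), (99,0,Done 2)]"
  "climbs 97
   [(99,16,Done 2), (99,0,Done 2), (99,16,Done 2), (99,16,Done 2), (99,0,Done 2), (99,0,Done 2),
    (99,16,Done 2), (99,0,Done 2)]"
  "climbs 98
   [(99,2,Done 2), (99,0,Done 2), (99,2,Done 2), (99,2,Done 2), (99,0,Done 2), (99,0,Done 2),
    (99,2,Done 2), (99,0,Done 2)]"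
  "climbs 99
   [(100,0,Done 2), (100,0,Done 2), (100,0,Done 2), (100,0,Done 2)]"
  "climbs 100
   []"
  by (simp_all only: row_eval)

section \<open>Completeness and inequivalence of the representatives\<close>

text \<open>The symmetric matrix with constant diagonal \<open>w ! 0\<close> and the entries 12, 13, 14, 23, 24, 34 in the
rest of \<open>w\<close>. For these pairs \<open>i + j\<close> is \<open>3, 4, 5\<close> if \<open>i = 1\<close> and \<open>5, 6, 7\<close> otherwise, which explains the two
shifts.\<close>

definition sym_mat :: "int list \<Rightarrow> nat \<Rightarrow> nat \<Rightarrow> real" where
  "sym_mat w i j = of_int (w ! (if i = j then 0 else if i = 1 \<or> j = 1 then i + j - 2 else i + j - 1))"

text \<open>Completing the square three times: \<open>t\<close> and \<open>u\<close> are the successive Schur complements, without the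
denominators.\<close>

lemma posdefI:
  fixes s t u :: "nat \<Rightarrow> nat \<Rightarrow> real"
  assumes sym: "\<And>i j. s i j = s j i"
    and t: "\<And>i j. t i j = s 1 1 * s i j - s 1 i * s 1 j"
    and u: "\<And>i j. u i j = t 2 2 * t i j - t 2 i * t 2 j"
    and pos: "0 < s 1 1" "0 < t 2 2" "0 < u 3 3" "(u 3 4)\<^sup>2 < u 3 3 * u 4 4"
  shows "posdef s"
  unfolding posdef_def
proof (intro conjI ballI allI impI sym)
  fix v :: "nat \<Rightarrow> real"
  assume nz: "\<exists>i\<in>{1..4}. v i \<noteq> 0"
  define a b c d where "a = v 1" "b = v 2" "c = v 3" "d = v 4"
  note abcd = this
  have sy: "s 2 1 = s 1 2" "s 3 1 = s 1 3" "s 4 1 = s 1 4" "s 3 2 = s 2 3" "s 4 2 = s 2 4" "s 4 3 = s 3 4"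
    using sym by blast+
  define Q where "Q = (\<Sum>i\<in>{1..4}. \<Sum>j\<in>{1..4}. v i * s i j * v j)"
  have Q: "Q = a\<^sup>2 * s 1 1 + b\<^sup>2 * s 2 2 + c\<^sup>2 * s 3 3 + d\<^sup>2 * s 4 4 + 2 * a * b * s 1 2 + 2 * a * c * s 1 3
    + 2 * a * d * s 1 4 + 2 * b * c * s 2 3 + 2 * b * d * s 2 4 + 2 * c * d * s 3 4"
    unfolding Q_def ground_set abcd by (simp add: sy sy[simplified] algebra_simps power2_eq_square)
  define T where "T = b\<^sup>2 * t 2 2 + c\<^sup>2 * t 3 3 + d\<^sup>2 * t 4 4 + 2 * b * c * t 2 3 + 2 * b * d * t 2 4 + 2 * c * d * t 3 4"
  define U where "U = c\<^sup>2 * u 3 3 + d\<^sup>2 * u 4 4 + 2 * c * d * u 3 4"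
  have QT: "s 1 1 * Q = (a * s 1 1 + b * s 1 2 + c * s 1 3 + d * s 1 4)\<^sup>2 + T"
    unfolding Q T_def t by (simp add: algebra_simps power2_eq_square)
  have TU: "t 2 2 * T = (b * t 2 2 + c * t 2 3 + d * t 2 4)\<^sup>2 + U"
    unfolding T_def U_def u by (simp add: algebra_simps power2_eq_square)
  have Ud: "u 3 3 * U = (c * u 3 3 + d * u 3 4)\<^sup>2 + d\<^sup>2 * (u 3 3 * u 4 4 - (u 3 4)\<^sup>2)"
    unfolding U_def by (simp add: algebra_simps power2_eq_square)
  have "a \<noteq> 0 \<or> b \<noteq> 0 \<or> c \<noteq> 0 \<or> d \<noteq> 0" using nz unfolding ground_set abcd by auto
  then consider "d \<noteq> 0" | "d = 0" "c \<noteq> 0" | "d = 0" "c = 0" "b \<noteq> 0"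
    | "d = 0" "c = 0" "b = 0" "a \<noteq> 0" by blast
  then have "0 < Q"
  proof cases
    case 1
    have "0 < u 3 3 * U" unfolding Ud using 1 pos(4) by (intro add_nonneg_pos mult_pos_pos) auto
    then have "0 < t 2 2 * T" unfolding TU using pos(3) by (intro add_nonneg_pos) (auto simp: zero_less_mult_iff)
    then have "0 < s 1 1 * Q" unfolding QT using pos(2) by (intro add_nonneg_pos) (auto simp: zero_less_mult_iff)
    then show ?thesis using pos(1) by (auto simp: zero_less_mult_iff)
  next
    case 2
    then have "0 < U" using pos(3) by (simp add: U_def)
    then have "0 < t 2 2 * T" unfolding TU by (intro add_nonneg_pos) auto
    then have "0 < s 1 1 * Q" unfolding QT using pos(2) by (intro add_nonneg_pos) (auto simp: zero_less_mult_iff)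
    then show ?thesis using pos(1) by (auto simp: zero_less_mult_iff)
  next
    case 3
    then have "0 < T" using pos(2) by (simp add: T_def)
    then have "0 < s 1 1 * Q" unfolding QT by (intro add_nonneg_pos) auto
    then show ?thesis using pos(1) by (auto simp: zero_less_mult_iff)
  next
    case 4
    then show ?thesis using pos(1) by (simp add: Q)
  qed
  then show "0 < (\<Sum>i\<in>{1..4}. \<Sum>j\<in>{1..4}. v i * s i j * v j)" by (simp only: Q_def)
qed

text \<open>The relations of these matrices represent, up to relabelling, the Gaussian relations that are not
intersections of larger ones. \<open>witness_relations\<close> lists them in the same order.\<close>

definition witness_matrices :: "int list list" where
  "witness_matrices =
   [[4,2,-3,0,0,-2,-1], [4,1,-2,2,-2,2,0], [6,2,3,4,1,3,0], [6,1,-3,3,4,2,0], [4,1,-1,2,1,2,0],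
    [8,-4,2,-4,-5,2,0], [8,-6,4,-4,-7,3,0], [3,2,-2,-1,-1,-2,0], [12,6,-8,4,-1,2,-6],
    [12,8,-6,-6,-8,-2,3], [20,8,-10,-10,-10,-10,5], [2,1,1,0,0,1,-1], [10,5,8,3,4,6,0],
    [4,-2,2,-1,-1,2,-2], [4,2,2,-1,1,0,0], [4,-3,3,-2,-3,0,0], [4,2,-2,-2,-1,-1,0],
    [12,-6,-8,-6,1,3,4], [2,-1,1,0,0,1,0], [4,2,1,2,2,0,0], [6,3,4,2,2,1,3], [2,-1,-1,0,0,0,0],
    [4,2,2,0,1,0,0], [2,1,0,0,0,0,0]]"

definition witness_relations :: "nat list list" where
  "witness_relations =
   [[2,3,23], [5,6,7], [5,7,12], [5,7,22], [5,7,23], [5,14,19], [5,14,20], [5,20,21], [11,13,14],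
    [15,16,19], [16,17,18], [2,3,20,21], [5,10,12,18], [10,11,12,13], [4,5,12,15,17],
    [4,5,15,17,21], [5,12,14,21,22], [13,14,16,22,23], [2,3,5,11,13,16,17], [4,5,8,15,17,19,23],
    [11,12,14,15,20,21,22], [2,3,4,5,10,11,13,14,15,16,17,20,22,23],
    [2,4,5,10,11,12,14,15,16,17,20,21,22,23],
    [1,2,3,4,5,8,9,10,11,12,13,14,15,16,17,19,20,21,22,23]]"

definition positive_pivots :: "(nat \<Rightarrow> nat \<Rightarrow> real) \<Rightarrow> bool" where
  "positive_pivots s \<longleftrightarrow>
     (let t = (\<lambda>i j. s 1 1 * s i j - s 1 i * s 1 j);
          u = (\<lambda>i j. t 2 2 * t i j - t 2 i * t 2 j)
      in 0 < s 1 1 \<and> 0 < t 2 2 \<and> 0 < u 3 3 \<and> (u 3 4)\<^sup>2 < u 3 3 * u 4 4)"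

lemma sym_mat_sym: "sym_mat w i j = sym_mat w j i"
  by (auto simp: sym_mat_def add.commute)

lemma posdef_sym_mat: "positive_pivots (sym_mat w) \<Longrightarrow> posdef (sym_mat w)"
  unfolding positive_pivots_def Let_def by (rule posdefI[OF sym_mat_sym refl refl]) auto

lemma sym_mat_eval:
  "sym_mat [d,a,b,c,e,f,g] 1 1 = of_int d" "sym_mat [d,a,b,c,e,f,g] 2 2 = of_int d"
  "sym_mat [d,a,b,c,e,f,g] 3 3 = of_int d" "sym_mat [d,a,b,c,e,f,g] 4 4 = of_int d"
  "sym_mat [d,a,b,c,e,f,g] 1 2 = of_int a" "sym_mat [d,a,b,c,e,f,g] 2 1 = of_int a"
  "sym_mat [d,a,b,c,e,f,g] 1 3 = of_int b" "sym_mat [d,a,b,c,e,f,g] 3 1 = of_int b"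
  "sym_mat [d,a,b,c,e,f,g] 1 4 = of_int c" "sym_mat [d,a,b,c,e,f,g] 4 1 = of_int c"
  "sym_mat [d,a,b,c,e,f,g] 2 3 = of_int e" "sym_mat [d,a,b,c,e,f,g] 3 2 = of_int e"
  "sym_mat [d,a,b,c,e,f,g] 2 4 = of_int f" "sym_mat [d,a,b,c,e,f,g] 4 2 = of_int f"
  "sym_mat [d,a,b,c,e,f,g] 3 4 = of_int g" "sym_mat [d,a,b,c,e,f,g] 4 3 = of_int g"
  by (simp_all add: sym_mat_def)

lemma witnesses_checked:
  "list_all2 (\<lambda>w r. positive_pivots (sym_mat w) \<and>
      map (\<lambda>(i, j, C). apm (sym_mat w) i j C = 0) codes = bit_vector r) witness_matrices witness_relations"
  unfolding witness_matrices_def witness_relations_def bit_vector_def upt_eval positive_pivots_def codes_def Let_def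
  by (simp add: sym_mat_eval[simplified])

definition witness :: "nat \<Rightarrow> bool list" where
  "witness a = bit_vector (witness_relations ! a)"

lemma length_witness_relations: "length witness_relations = 24"
  by (simp add: witness_relations_def)

lemma gaussian_witness:
  assumes "a < 24"
  shows "gaussian (witness a)"
proof -
  let ?s = "sym_mat (witness_matrices ! a)"
  have "positive_pivots ?s \<and> map (\<lambda>(i, j, C). apm ?s i j C = 0) codes = witness a"
    unfolding witness_def
    by (rule list_all2_nthD2[OF witnesses_checked]) (simp add: assms length_witness_relations)
  then have "posdef ?s \<and> witness a = bits (ci_relation ?s)"
    using posdef_sym_mat bits_ci_relation by metis
  then show ?thesis unfolding gaussian_def by blast
qed

lemma witness_map: "map witness [0..<24] = map bit_vector witness_relations"
proof -
  have "map witness [0..<length witness_relations] =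
      map bit_vector (map ((!) witness_relations) [0..<length witness_relations])"
    by (simp only: witness_def[abs_def] map_map o_def)
  also have "\<dots> = map bit_vector witness_relations" by (simp only: map_nth)
  finally show ?thesis by (simp only: length_witness_relations)
qed

lemmas witness_eval = witness_map[unfolded witness_relations_def bit_vector_def, simplified upt_eval list.map
  list.inject list.set insert_iff empty_iff num_eval simp_thms]

definition meet :: "bool list \<Rightarrow> bool list \<Rightarrow> bool list" where
  "meet x y = map2 (\<and>) x y"

text \<open>A couple missing from an intersection is missing from one of its members, and complete relations
are intersections of Gaussian ones.\<close>

lemma complete_meet:
  assumes g: "gaussian g" and x: "complete_bits x"
  shows "complete_bits (meet g x)"
proof -
  have len: "length g = 24" "length x = 24"
    using length_gaussian[OF g] x by (simp_all add: complete_bits_def)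
  have le: "below (meet g x) g" "below (meet g x) x" using len by (auto simp: below_iff meet_def)
  have "\<exists>y. gaussian y \<and> below (meet g x) y \<and> \<not> y ! n" if n: "n < 24" "\<not> meet g x ! n" for n
  proof (cases "g ! n")
    case True
    then have "\<not> x ! n" using n len by (simp add: meet_def)
    then obtain y where "gaussian y" "below x y" "\<not> y ! n" using x n by (auto simp: complete_bits_def)
    then show ?thesis using below_trans[OF le(2)] by blast
  qed (use g le in blast)
  then show ?thesis using len by (simp add: complete_bits_def meet_def)
qed

definition meets :: "(nat \<times> nat) list \<Rightarrow> bool list" where
  "meets ms = foldr (\<lambda>(a, k). meet (act k (witness a))) ms (replicate 24 True)"

lemma meet_eval: "meet [] [] = []" "meet (a # x) (b # y) = (a \<and> b) # meet x y"
  by (simp_all add: meet_def)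

lemma meets_eval:
  "meets [] = [True,True,True,True,True,True,True,True,True,True,True,True,True,True,True,True,True,True,True,True,True,True,True,True]"
  "meets ((a, k) # ms) = meet (act k (witness a)) (meets ms)"
  by (simp_all add: meets_def eval_nat_numeral)

lemma complete_meets:
  "list_all (\<lambda>(a, k). a < 24 \<and> k < 24) ms \<Longrightarrow> complete_bits (meets ms)"
proof (induction ms)
  case Nil
  then show ?case by (simp add: meets_def complete_bits_def)
next
  case (Cons m ms)
  obtain a k where "m = (a, k)" by (cases m)
  then show ?case
    using Cons complete_meet[OF gaussian_act[OF _ gaussian_witness]] by (simp add: meets_def)
qed

text \<open>For each representative the pairs \<open>(a, k)\<close> such that it is the intersection of the witness relations
\<open>a\<close>, each relabelled by \<open>k\<close>; the last representative, consisting of all couples, is the empty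
intersection.\<close>

definition meet_representations :: "(nat \<times> nat) list list" where
  "meet_representations =
   [[(0,0),(0,3)], [(0,4),(1,0)], [(1,16),(2,18)], [(0,0),(0,1)], [(0,0),(0,2)], [(1,0),(2,0)],
    [(2,1),(5,0)], [(14,0),(14,1)], [(11,4),(12,0)], [(0,4),(3,0)], [(4,0),(4,1)], [(8,0),(8,7)],
    [(2,22),(8,3)], [(1,16),(10,0)], [(4,16),(5,12)], [(3,16),(6,12)], [(16,12),(16,13)],
    [(7,0),(7,2)], [(18,0),(18,2)], [(11,0),(21,7)], [(0,0)], [(1,0)], [(2,0)], [(18,4),(19,3)],
    [(19,3),(19,13)], [(3,0)], [(4,0)], [(12,0),(22,0)], [(14,1),(18,4)], [(12,1),(21,4)],
    [(5,0)], [(6,0)], [(16,0),(19,7)], [(18,0),(18,1)], [(19,2),(19,3)], [(15,1),(19,2)],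
    [(19,0),(19,1)], [(11,4),(22,8)], [(7,0)], [(13,0),(21,7)], [(8,0)], [(19,19),(20,10)],
    [(12,16),(21,0)], [(9,0)], [(17,1),(20,5)], [(10,0)], [(20,2),(20,3)], [(20,8),(20,9)],
    [(18,0),(23,16)], [(11,0)], [(14,0),(15,0)], [(19,3),(23,12)], [(12,0)],
    [(21,0),(21,4),(21,6),(22,1)], [(21,0),(21,9),(21,6)], [(13,0)], [(20,10),(23,0)],
    [(16,3),(17,0)], [(21,7),(21,10)], [(14,0)], [(18,1),(21,0)], [(15,0)], [(19,0),(21,0)],
    [(21,8),(22,9)], [(16,0)], [(19,7),(21,0)], [(22,8),(22,9)], [(17,0)], [(20,3),(21,0)],
    [(21,7),(23,2),(23,16)], [(21,0),(21,1),(21,4)], [(21,1),(21,4),(22,0)],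
    [(21,0),(21,1),(21,6)], [(22,9),(23,2),(23,12)], [(21,4),(22,0),(22,1)],
    [(21,0),(22,1),(21,6)], [(22,0),(22,1),(22,4)], [(18,0)], [(19,0)], [(20,0)], [(21,0),(21,7)],
    [(23,0),(23,2),(23,13),(23,16)], [(21,0),(21,1)], [(21,1),(22,6)], [(21,1),(22,0)],
    [(21,0),(23,3),(21,6)], [(22,0),(22,7)], [(22,0),(22,1)], [(21,7),(23,2)], [(21,0),(23,3)],
    [(22,6),(23,3)], [(22,0),(23,3)], [(23,0),(23,2),(23,13)], [(21,0),(21,6)],
    [(23,0),(23,2),(23,3)], [(21,0)], [(22,0)], [(23,0),(23,16)], [(23,0),(23,2)], [(23,0)], []]"

lemma meet_representations_checked:
  "list_all2 (\<lambda>j ms. list_all (\<lambda>(a, k). a < 24 \<and> k < 24) ms \<and> meets ms = rep j)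
     [0..<101] meet_representations"
  unfolding meet_representations_def upt_eval
  by (simp only: list_all2_Cons list_all2_Nil list_all_Cons_iff list_all_Nil_iff prod.case
      meets_eval meet_eval witness_eval act_eval rep_eval list.inject num_eval simp_thms)

lemma complete_rep:
  assumes "j < 101"
  shows "complete_bits (rep j)"
proof -
  have "list_all (\<lambda>(a, k). a < 24 \<and> k < 24) (meet_representations ! j) \<and>
      meets (meet_representations ! j) = rep ([0..<101] ! j)"
    using list_all2_nthD[OF meet_representations_checked, of j] assms by simp
  then show ?thesis using complete_meets[of "meet_representations ! j"] assms by simp
qed

text \<open>The lexicographic order with \<open>False < True\<close>; it singles out one member of each orbit.\<close>

fun lex_le :: "bool list \<Rightarrow> bool list \<Rightarrow> bool" where
  "lex_le (a # x) (b # y) \<longleftrightarrow> \<not> a \<and> b \<or> a = b \<and> lex_le x y"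
| "lex_le _ _ \<longleftrightarrow> True"

lemma lex_le_antisym: "length x = length y \<Longrightarrow> lex_le x y \<Longrightarrow> lex_le y x \<Longrightarrow> x = y"
  by (induction x y rule: list_induct2) auto

text \<open>Consequently, equivalent representatives are each below the other, hence equal.\<close>

lemma rep_lex_least:
  assumes "j < 101" "k < 24"
  shows "lex_le (rep j) (act k (rep j))"
proof -
  have "list_all (\<lambda>j. list_all (\<lambda>k. lex_le (rep j) (act k (rep j))) [0..<24]) [0..<101]"
    by (simp only: upt_eval list_all_Cons_iff list_all_Nil_iff rep_eval act_eval lex_le.simps simp_thms)
  then show ?thesis using assms by (simp add: list_all_iff)
qed

lemma rep_inj:
  assumes "i < 101" "j < 101" "rep i = rep j"
  shows "i = j"
proof -
  have "distinct (map rep [0..<101])"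
    by (simp only: upt_eval list.map rep_eval distinct.simps list.set insert_iff empty_iff list.inject
        simp_thms)
  then show ?thesis using assms by (simp add: distinct_map inj_on_def)
qed

section \<open>The classification\<close>

lemma climbs_ex:
  assumes "j < 101"
  shows "\<exists>ds. climbs j ds"
proof -
  have "list_all (\<lambda>j. \<exists>ds. climbs j ds) [0..<101]"
    unfolding upt_eval list_all_Cons_iff list_all_Nil_iff
    by (intro conjI TrueI; (rule exI, rule climbs_from_0 climbs_from_17 climbs_from_34 climbs_from_51 climbs_from_68 climbs_from_85))
  then show ?thesis using assms by (simp add: list_all_iff)
qed

text \<open>Since the empty relation is listed first and \<open>climb\<close> leads to strictly later representatives, the
last representative contained in a relabelling of \<open>x\<close> must be all of it.\<close>

lemma complete_bits_rep:
  assumes x: "complete_bits x"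
  shows "\<exists>j<101. \<exists>k<24. rep j = act k x"
proof -
  have len: "length x = 24" using x by (simp add: complete_bits_def)
  define J where "J = {j. j < 101 \<and> (\<exists>k<24. below (rep j) (act k x))}"
  have "finite J" by (simp add: J_def)
  have "0 \<in> J"
  proof -
    have "\<not> rep 0 ! n" if "n < 24" for n using that by (simp add: rep_def representatives_def)
    then have "below (rep 0) (act 0 x)"
      using length_act[of 0 x] by (simp add: below_iff rep_def)
    moreover have "(0::nat) < 24" "(0::nat) < 101" by simp_all
    ultimately show ?thesis unfolding J_def by blast
  qed
  define j where "j = Max J"
  have "j \<in> J" using \<open>finite J\<close> \<open>0 \<in> J\<close> unfolding j_def by (intro Max_in) auto
  then obtain k where j: "j < 101" "k < 24" "below (rep j) (act k x)" by (auto simp: J_def)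
  have "rep j = act k x"
  proof (rule ccontr)
    assume ne: "rep j \<noteq> act k x"
    obtain ds where "climbs j ds" using climbs_ex[OF j(1)] by blast
    then obtain i m where i: "j < i" "i < 101" "m < 24" "below (rep i) (act m (act k x))"
      using climb[OF _ complete_bits_act[OF j(2) x] j(3) ne] by blast
    obtain l where "l < 24" "act m (act k x) = act l x"
      using act_comp[OF i(3) j(2)] len by blast
    then have "i \<in> J" using i unfolding J_def by auto
    then have "i \<le> j" using \<open>finite J\<close> unfolding j_def by simp
    then show False using i(1) by simp
  qed
  then show ?thesis using j by blast
qed

text \<open>Images and inverse images under permutations generate the same equivalence.\<close>

lemma ci_equiv_iff_pull:
  assumes "L \<subseteq> couples 4" "M \<subseteq> couples 4"
  shows "(L, M) \<in> ci_equiv 4 \<longleftrightarrow> (\<exists>p. p permutes {1..4} \<and> pull p L = M)"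
proof
  assume "(L, M) \<in> ci_equiv 4"
  then obtain p where p: "p permutes {1..4}" "permute_relation p L = M"
    by (auto simp: ci_equiv_def)
  then show "\<exists>p. p permutes {1..4} \<and> pull p L = M"
    using permutes_inv[OF p(1)] permute_relation_pull[OF p(1)] by metis
next
  assume "\<exists>p. p permutes {1..4} \<and> pull p L = M"
  then obtain p where p: "p permutes {1..4}" "pull p L = M" by blast
  let ?q = "Hilbert_Choice.inv p"
  have "permute_relation ?q L = M"
    using permute_relation_pull[OF permutes_inv[OF p(1)]] permutes_inv_inv[OF p(1)] p(2) by simp
  then show "(L, M) \<in> ci_equiv 4"
    using assms permutes_inv[OF p(1)] unfolding ci_equiv_def by blast
qed

theorem theorem2p3:
  shows "card ({L. complete_relation 4 L} // ci_equiv 4) = 101"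
proof -
  let ?E = "ci_equiv 4" and ?R = "\<lambda>j. rel (rep j)"
  have len: "length (rep j) = 24" for j by (simp add: rep_def)
  have bits: "bits (?R j) = rep j" for j by (rule bits_rel[OF len])
  have complete: "complete_relation 4 (?R j)" if "j < 101" for j
    using complete_relation_bits[OF rel_subset] complete_rep[OF that] bits by metis
  have classified: "\<exists>j<101. (L, ?R j) \<in> ?E" if L: "complete_relation 4 L" for L
  proof -
    have sub: "L \<subseteq> couples 4" using L by (simp add: complete_relation_def)
    then obtain j k where jk: "j < 101" "k < 24" "rep j = act k (bits L)"
      using complete_bits_rep L complete_relation_bits by metis
    have p: "perm_of k permutes {1..4}" by (rule perm_of_permutes[OF jk(2)])
    have "?R j = pull (perm_of k) L"
      using jk(3) bits_pull[OF jk(2)] rel_bits[OF pull_couples[OF p sub]] by metis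
    then show ?thesis using jk(1) p ci_equiv_iff_pull[OF sub rel_subset] by metis
  qed
  have least: "lex_le (rep i) (rep j)" if i: "i < 101" and ij: "(?R i, ?R j) \<in> ?E" for i j
  proof -
    obtain p where p: "p permutes {1..4}" "pull p (?R i) = ?R j"
      using ij ci_equiv_iff_pull[OF rel_subset rel_subset] by blast
    obtain k where "k < 24" "bits (pull p (?R i)) = act k (bits (?R i))"
      using pull_act[OF p(1)] by metis
    then show ?thesis using rep_lex_least[OF i] p(2) bits by metis
  qed
  have inj: "i = j" if i: "i < 101" and j: "j < 101" and ij: "(?R i, ?R j) \<in> ?E" for i j
  proof -
    have ji: "(?R j, ?R i) \<in> ?E" using ij equiv_ci_equiv by (meson equivE symE)
    then have "rep i = rep j"
      using least[OF i ij] least[OF j ji] len by (intro lex_le_antisym) auto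
    then show ?thesis using rep_inj[OF i j] by blast
  qed
  have mem: "?R j \<in> Pow (couples 4)" for j using rel_subset by blast
  have "{L. complete_relation 4 L} // ?E = (\<lambda>j. ?E `` {?R j}) ` {..<101}"
  proof
    show "{L. complete_relation 4 L} // ?E \<subseteq> (\<lambda>j. ?E `` {?R j}) ` {..<101}"
    proof
      fix X assume "X \<in> {L. complete_relation 4 L} // ?E"
      then obtain L where L: "complete_relation 4 L" "X = ?E `` {L}" by (auto elim: quotientE)
      obtain j where j: "j < 101" "(L, ?R j) \<in> ?E" using classified[OF L(1)] by blast
      have "X = ?E `` {?R j}" using L(2) equiv_class_eq[OF equiv_ci_equiv j(2)] by simp
      then show "X \<in> (\<lambda>j. ?E `` {?R j}) ` {..<101}" using j(1) by blast
    qed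
    show "(\<lambda>j. ?E `` {?R j}) ` {..<101} \<subseteq> {L. complete_relation 4 L} // ?E"
      using complete by (auto intro: quotientI)
  qed
  moreover have "inj_on (\<lambda>j. ?E `` {?R j}) {..<101}"
  proof (rule inj_onI)
    fix i j assume ij: "i \<in> {..<101}" "j \<in> {..<101}" "?E `` {?R i} = ?E `` {?R j}"
    then have "(?R i, ?R j) \<in> ?E" using eq_equiv_class[OF _ equiv_ci_equiv mem] by blast
    then show "i = j" using inj ij by blast
  qed
  ultimately show ?thesis by (simp add: card_image)
qed

end
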